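(* Let $f:\mathbb C\to\mathbb C$ be a surjective entire function and let $Q:\mathbb C\to[0,1]$ be a weakly continuous weight function for $f$ which is normal, tight, and irreducible. Let $A$ be the associated transfer operator and $J_Q(f)$ the $Q$-Julia set. Then for every $\varphi\in C_b(\mathbb C)$ the sequence of functions $(A^n(\varphi))_n$ converges locally uniformly on $J_Q(f)$ to a constant function $\varphi_\infty$, and the functional in $(C_b(J_Q(f)))^*$ defined by $\varphi\mapsto\varphi_\infty$ is (integration against) a Borel probability measure $\mu$ on $J_Q(f)$ with full support. Moreover, $\mu$ is $A^*$-invariant (and thus $f$-invariant) and mixing for $f$, and if $\nu$ is an arbitrary Borel probability measure on $J_Q(f)$, then the sequence of probability measures $((A^* )^n(\nu))_n$ converges weakly to $\mu$. In particular, for all $w\in J_Q(f)$ the sequence $(Q^n_w)_n$ converges weakly to $\mu$.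
   Context: Let $f:\mathbb C\to\mathbb C$ be a surjective entire function. Sums over preimages count multiplicity. $D(a,r)$ is the open disk. $C_b(X)$ is the Banach space of bounded continuous complex-valued functions on $X$ with the sup norm. A weight function for $f$ is a function $Q:\mathbb C\to[0,1]$ such that $\sum_{z\in f^{-1}(w)}Q(z)=1$ for every $w\in\mathbb C$. Put $Q_w:=\sum_{z\in f^{-1}(w)}Q(z)\delta_z$ and, for $\varphi\in C_b(\mathbb C)$, $A(\varphi)(w):=\sum_{z\in f^{-1}(w)}Q(z)\varphi(z)$. The weight function $Q$ is weakly continuous if $A(\varphi)$ is continuous for every $\varphi\in C_b(\mathbb C)$; then $A:C_b(\mathbb C)\to C_b(\mathbb C)$ is a bounded operator with $\|A\|\le1$, called the transfer operator, and $A^*$ denotes its transpose. For $n\ge1$ put $Q^n(z)=\prod_{j=0}^{n-1}Q(f^j(z))$ and $Q^n_w=(A^* )^n\delta_w=\sum_{z\in f^{-n}(w)}Q^n(z)\delta_z$. $Q$ is normal if for every $\varphi\in C_b(\mathbb C)$ the family $(A^n(\varphi))_{n\in\mathbb N}$ is equicontinuous on $\mathbb C$. $Q$ is tight if for every $\epsilon>0$ there is a compact $K\subset\mathbb C$ such that for every $w\in\mathbb C$ there is $n_0\in\mathbb N$ with $Q^n_w(K)\ge1-\epsilon$ for all $n\ge n_0$. $Q$ is irreducible if one of the following holds: (a) there is a repelling fixed point $p$ of $f$ with $0<Q(p)<1$ such that for every $r>0$ and every compact $K\subset\mathbb C$ there is $n\in\mathbb N$ such that for every $w\in K$ there is $z\in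 D(p,r)$ with $f^n(z)=w$ and $Q^n(z)>0$; (b) there are two distinct repelling periodic points $p_1,p_2$ with coprime periods and $Q(p_i)>0$ such that for every $i=1,2$, every $r>0$ and every compact $K\subset\mathbb C$ there is $n\in\mathbb N$ such that for every $w\in K$ there is $z\in D(p_i,r)$ with $f^n(z)=w$ and $Q^n(z)>0$. The $Q$-Julia set $J_Q(f)$ is the set of all $z_0\in\mathbb C$ such that for every $r>0$ the set $\{w\in\mathbb C:\exists z\in D(z_0,r),\,n\in\mathbb N,\ f^n(z)=w,\ Q^n(z)>0\}$ omits at most one point of $\mathbb C$. It is closed, forward invariant, and contains every preimage $z$ of its points with $Q(z)>0$; hence for $w\in J_Q(f)$ the measures $Q^n_w$ are carried by $J_Q(f)$, the restriction of $A^n(\varphi)$ to $J_Q(f)$ depends only on $\varphi|_{J_Q(f)}$, and $A$ and $A^*$ act on $C_b(J_Q(f))$ and its dual. *)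

theory Defs
  imports "HOL-Complex_Analysis.Complex_Analysis" "HOL-Probability.Probability"
begin

text \<open>
  \<open>Cb X\<close> is the space of bounded continuous functions on \<open>X\<close>, represented by total functions
  whose values outside \<open>X\<close> are irrelevant; \<open>Cb UNIV\<close> is the set \<^const>\<open>bcontfun\<close>.
\<close>

definition Cb :: "complex set \<Rightarrow> (complex \<Rightarrow> complex) set" where
  "Cb X = {\<phi>. continuous_on X \<phi> \<and> bounded (\<phi> ` X)}"

text \<open>
  The dual of \<open>Cb X\<close> for the sup norm (for nonempty \<open>X\<close>). Boundedness forces the value of a
  functional at \<open>\<phi>\<close> to depend only on the restriction of \<open>\<phi>\<close> to \<open>X\<close>.
\<close>

definition Cb_dual :: "complex set \<Rightarrow> ((complex \<Rightarrow> complex) \<Rightarrow> complex) set" where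
  "Cb_dual X = {\<Lambda>.
     (\<forall>\<phi>\<in>Cb X. \<forall>\<psi>\<in>Cb X. \<Lambda> (\<lambda>z. \<phi> z + \<psi> z) = \<Lambda> \<phi> + \<Lambda> \<psi>) \<and>
     (\<forall>c. \<forall>\<phi>\<in>Cb X. \<Lambda> (\<lambda>z. c * \<phi> z) = c * \<Lambda> \<phi>) \<and>
     (\<exists>B. \<forall>\<phi>\<in>Cb X. norm (\<Lambda> \<phi>) \<le> B * (SUP z\<in>X. norm (\<phi> z)))}"

text \<open>
  \<open>mult f z\<close> is the multiplicity of \<open>z\<close> as a preimage of \<open>f z\<close>, for \<open>f\<close> nonconstant entire.
\<close>

definition mult :: "(complex \<Rightarrow> complex) \<Rightarrow> complex \<Rightarrow> nat" where
  "mult f z = nat (zorder (\<lambda>u. f u - f z) z)"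

definition weight_function :: "(complex \<Rightarrow> complex) \<Rightarrow> (complex \<Rightarrow> real) \<Rightarrow> bool" where
  "weight_function f Q \<longleftrightarrow>
     (\<forall>z. 0 \<le> Q z \<and> Q z \<le> 1) \<and>
     (\<forall>w. ((\<lambda>z. real (mult f z) * Q z) has_sum 1) (f -` {w}))"

definition transfer ::
  "(complex \<Rightarrow> complex) \<Rightarrow> (complex \<Rightarrow> real) \<Rightarrow> (complex \<Rightarrow> complex) \<Rightarrow> complex \<Rightarrow> complex" where
  "transfer f Q \<phi> w = (\<Sum>\<^sub>\<infinity>z\<in>f -` {w}. of_nat (mult f z) * of_real (Q z) * \<phi> z)"

definition transfer_transpose ::
  "(complex \<Rightarrow> complex) \<Rightarrow> (complex \<Rightarrow> real) \<Rightarrow>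
   ((complex \<Rightarrow> complex) \<Rightarrow> complex) \<Rightarrow> (complex \<Rightarrow> complex) \<Rightarrow> complex" where
  "transfer_transpose f Q \<Lambda> = (\<lambda>\<phi>. \<Lambda> (transfer f Q \<phi>))"

definition weakly_continuous :: "(complex \<Rightarrow> complex) \<Rightarrow> (complex \<Rightarrow> real) \<Rightarrow> bool" where
  "weakly_continuous f Q \<longleftrightarrow> (\<forall>\<phi>\<in>Cb UNIV. continuous_on UNIV (transfer f Q \<phi>))"

definition Q_iter :: "(complex \<Rightarrow> complex) \<Rightarrow> (complex \<Rightarrow> real) \<Rightarrow> nat \<Rightarrow> complex \<Rightarrow> real" where
  "Q_iter f Q n z = (\<Prod>j<n. Q ((f ^^ j) z))"

text \<open>
  The Borel measure \<open>Q\<^sup>n\<^sub>w\<close> on the plane: the sum of the point masses at the points of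
  \<open>f\<^sup>-\<^sup>n(w)\<close> with weight \<open>Q\<^sup>n\<close>, counted with the multiplicity of \<open>f\<^sup>n\<close>.
\<close>

definition Q_measure ::
  "(complex \<Rightarrow> complex) \<Rightarrow> (complex \<Rightarrow> real) \<Rightarrow> nat \<Rightarrow> complex \<Rightarrow> complex measure" where
  "Q_measure f Q n w =
     distr (point_measure ((f ^^ n) -` {w})
             (\<lambda>z. ennreal (real (mult (f ^^ n) z) * Q_iter f Q n z)))
           borel (\<lambda>z. z)"

definition normal_weight :: "(complex \<Rightarrow> complex) \<Rightarrow> (complex \<Rightarrow> real) \<Rightarrow> bool" where
  "normal_weight f Q \<longleftrightarrow>
     (\<forall>\<phi>\<in>Cb UNIV. \<forall>w. \<forall>\<epsilon>>0. \<exists>\<delta>>0. \<forall>n. \<forall>w'. dist w' w < \<delta> \<longrightarrow>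
        dist ((transfer f Q ^^ n) \<phi> w') ((transfer f Q ^^ n) \<phi> w) < \<epsilon>)"

definition tight_weight :: "(complex \<Rightarrow> complex) \<Rightarrow> (complex \<Rightarrow> real) \<Rightarrow> bool" where
  "tight_weight f Q \<longleftrightarrow>
     (\<forall>\<epsilon>>0. \<exists>K. compact K \<and>
        (\<forall>w. \<exists>n0. \<forall>n\<ge>n0. measure (Q_measure f Q n w) K \<ge> 1 - \<epsilon>))"

text \<open>Here \<open>m\<close> is the minimal period of \<open>p\<close>; \<open>m = 1\<close> gives the repelling fixed points.\<close>

definition repelling_periodic :: "(complex \<Rightarrow> complex) \<Rightarrow> nat \<Rightarrow> complex \<Rightarrow> bool" where
  "repelling_periodic f m p \<longleftrightarrow>
     m > 0 \<and> (f ^^ m) p = p \<and> (\<forall>k. 0 < k \<and> k < m \<longrightarrow> (f ^^ k) p \<noteq> p) \<and>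
     norm (deriv (f ^^ m) p) > 1"

definition expands_over_compacts ::
  "(complex \<Rightarrow> complex) \<Rightarrow> (complex \<Rightarrow> real) \<Rightarrow> complex \<Rightarrow> bool" where
  "expands_over_compacts f Q p \<longleftrightarrow>
     (\<forall>r>0. \<forall>K. compact K \<longrightarrow>
        (\<exists>n\<ge>1. \<forall>w\<in>K. \<exists>z\<in>ball p r. (f ^^ n) z = w \<and> Q_iter f Q n z > 0))"

definition irreducible_weight :: "(complex \<Rightarrow> complex) \<Rightarrow> (complex \<Rightarrow> real) \<Rightarrow> bool" where
  "irreducible_weight f Q \<longleftrightarrow>
     (\<exists>p. repelling_periodic f 1 p \<and> 0 < Q p \<and> Q p < 1 \<and> expands_over_compacts f Q p) \<or>
     (\<exists>p1 p2 m1 m2. p1 \<noteq> p2 \<and> repelling_periodic f m1 p1 \<and> repelling_periodic f m2 p2 \<and>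
        coprime m1 m2 \<and> Q p1 > 0 \<and> Q p2 > 0 \<and>
        expands_over_compacts f Q p1 \<and> expands_over_compacts f Q p2)"

text \<open>Only iterates with \<open>n \<ge> 1\<close> are used, as \<open>Q\<^sup>n\<close> is introduced for \<open>n \<ge> 1\<close>.\<close>

definition Q_Julia :: "(complex \<Rightarrow> complex) \<Rightarrow> (complex \<Rightarrow> real) \<Rightarrow> complex set" where
  "Q_Julia f Q =
     {z0. \<forall>r>0. \<exists>a. - {w. \<exists>z\<in>ball z0 r. \<exists>n\<ge>1. (f ^^ n) z = w \<and> Q_iter f Q n z > 0} \<subseteq> {a}}"

definition locally_uniform_limit ::
  "complex set \<Rightarrow> (nat \<Rightarrow> complex \<Rightarrow> complex) \<Rightarrow> (complex \<Rightarrow> complex) \<Rightarrow> bool" where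
  "locally_uniform_limit X F g \<longleftrightarrow>
     (\<forall>x\<in>X. \<exists>r>0. uniform_limit (ball x r \<inter> X) F g sequentially)"

definition borel_prob_on :: "complex set \<Rightarrow> complex measure \<Rightarrow> bool" where
  "borel_prob_on X M \<longleftrightarrow> prob_space M \<and> sets M = sets (restrict_space borel X)"

definition full_support_on :: "complex set \<Rightarrow> complex measure \<Rightarrow> bool" where
  "full_support_on X M \<longleftrightarrow> (\<forall>U. open U \<and> U \<inter> X \<noteq> {} \<longrightarrow> emeasure M (U \<inter> X) > 0)"

definition integral_functional :: "complex measure \<Rightarrow> (complex \<Rightarrow> complex) \<Rightarrow> complex" where
  "integral_functional M \<phi> = (\<integral>z. \<phi> z \<partial>M)"

definition weakly_converges_on ::
  "complex set \<Rightarrow> (nat \<Rightarrow> complex measure) \<Rightarrow> complex measure \<Rightarrow> bool" where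
  "weakly_converges_on X N M \<longleftrightarrow>
     (\<forall>n. borel_prob_on X (N n)) \<and> borel_prob_on X M \<and>
     (\<forall>\<phi>\<in>Cb X. (\<lambda>n. \<integral>z. \<phi> z \<partial>N n) \<longlonglongrightarrow> (\<integral>z. \<phi> z \<partial>M))"

definition invariant_measure :: "(complex \<Rightarrow> complex) \<Rightarrow> complex measure \<Rightarrow> bool" where
  "invariant_measure f M \<longleftrightarrow> f \<in> measurable M M \<and> distr M M f = M"

definition mixing_measure :: "(complex \<Rightarrow> complex) \<Rightarrow> complex measure \<Rightarrow> bool" where
  "mixing_measure f M \<longleftrightarrow> invariant_measure f M \<and>
     (\<forall>A\<in>sets M. \<forall>B\<in>sets M.
        (\<lambda>n. measure M ((f ^^ n) -` A \<inter> B)) \<longlonglongrightarrow> measure M A * measure M B)"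

end

theory Submission
  imports Defs
begin

text \<open>
  The measures \<open>Q\<^sup>n\<^sub>w\<close> are the \<open>n\<close>-step distributions of a Markov chain that moves from a point to one of
  its weighted preimages. Tightness brings the chain back to a fixed compact set from any starting point,
  and irreducibility then takes it, in a fixed number of steps, close to an expanding point \<open>p\<close> with
  probability bounded below. Two independent copies of the chain are therefore simultaneously near \<open>p\<close> with
  a positive lower bound on the probability, while normality says that nearby starting points have nearby
  futures. Iterating this coupling shows that \<open>A\<^sup>n(\<phi>)\<close> loses its oscillation, and tightness makes it converge
  to a constant, on the whole plane.

  The limit functional is represented by a measure that is a weak limit of the tight sequence \<open>Q\<^sup>n\<^sub>p\<close>.
  Invariance and mixing come from \<open>A\<^sup>n((\<phi> \<circ> f\<^sup>n) \<psi>) = \<phi> A\<^sup>n(\<psi>)\<close>. The remaining part of irreducibility is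
  used only to see that a point of the Julia set reaches every point of the plane, without exception, which
  gives the full support.
\<close>

section \<open>Equicontinuous Markov kernels\<close>

text \<open>The obstacle is that the times in tightness depend on the starting point. The mass
  arriving near \<open>p\<close> has a lower bound common to all points, but there is no common
  time, so the oscillation cannot be contracted in the sup norm. What is contracted is a bound that
  each pair of starting points satisfies eventually: dominated convergence under the law of the
  coupled pair carries such a bound through one more coupling, and the infimum of these bounds must
  then be zero.

  Weak continuity and normality speak only about continuous functions, so indicators of disks and
  closed sets are replaced by tent functions.

  A subsequence is taken only to turn the limit functional into a measure; convergence of the whole
  sequence is known beforehand. The limit measure first lives on the plane, where the chain acts on
  continuous functions, and is restricted to the Julia set at the end. A function in
  \<open>Cb J\<close> has arbitrary values off \<open>J\<close>, so it is exchanged for a continuous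
  extension with the same transfers on \<open>J\<close>.\<close>

lemma equicontinuous_uniform_limit_const:
  fixes F :: "nat \<Rightarrow> 'a::metric_space \<Rightarrow> 'b::metric_space"
  assumes "compact K"
    and equi: "\<And>x \<epsilon>. x \<in> K \<Longrightarrow> \<epsilon> > 0 \<Longrightarrow> \<exists>\<delta>>0. \<forall>n. \<forall>y. dist y x < \<delta> \<longrightarrow> dist (F n y) (F n x) < \<epsilon>"
    and lim: "\<And>x. x \<in> K \<Longrightarrow> (\<lambda>n. F n x) \<longlonglongrightarrow> c"
  shows "uniform_limit K F (\<lambda>_. c) sequentially"
proof (rule uniform_limitI)
  fix \<epsilon> :: real assume "\<epsilon> > 0"
  then have "\<epsilon>/2 > 0" by simp
  have "\<forall>x\<in>K. \<exists>\<delta>>0. \<forall>n. \<forall>y. dist y x < \<delta> \<longrightarrow> dist (F n y) (F n x) < \<epsilon>/2"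
    using equi \<open>\<epsilon>/2 > 0\<close> by blast
  then obtain \<delta> where \<delta>: "\<And>x. x \<in> K \<Longrightarrow> \<delta> x > 0"
    "\<And>x n y. x \<in> K \<Longrightarrow> dist y x < \<delta> x \<Longrightarrow> dist (F n y) (F n x) < \<epsilon>/2"
    by metis
  \<comment> \<open>The radius \<open>\<delta> x\<close> serves all \<open>n\<close> at once, so
    only the limits at finitely many centres have to be awaited.\<close>
  have "K \<subseteq> (\<Union>x\<in>K. ball x (\<delta> x))"
    using \<delta>(1) by (auto intro!: bexI)
  then obtain T where T: "T \<subseteq> K" "finite T" "K \<subseteq> (\<Union>x\<in>T. ball x (\<delta> x))"
    by (rule compactE_image[OF \<open>compact K\<close>, rotated]) auto
  have "\<forall>\<^sub>F n in sequentially. dist (F n x) c < \<epsilon>/2" if "x \<in> T" for x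
    using lim[of x] that T \<open>\<epsilon>/2 > 0\<close> tendstoD by blast
  then have "\<forall>\<^sub>F n in sequentially. \<forall>x\<in>T. dist (F n x) c < \<epsilon>/2"
    using T(2) by (simp add: eventually_ball_finite)
  then show "\<forall>\<^sub>F n in sequentially. \<forall>x\<in>K. dist (F n x) c < \<epsilon>"
  proof eventually_elim
    case (elim n)
    show ?case
    proof
      fix y assume "y \<in> K"
      then obtain x where x: "x \<in> T" "dist y x < \<delta> x"
        using T(3) by (auto simp: dist_commute)
      then have "dist (F n y) (F n x) < \<epsilon>/2" "dist (F n x) c < \<epsilon>/2"
        using \<delta>(2) T(1) elim by blast+
      then show "dist (F n y) c < \<epsilon>"
        using dist_triangle[of "F n y" c "F n x"] by linarith
    qed
  qed
qed

text \<open>The first step is split off, not the last, to match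
  \<open>transfer f Q ^^ Suc n\<close>, whose outermost application averages over the preimages of
  the starting point.\<close>

primrec kernel_iter :: "('a \<Rightarrow> 'a pmf) \<Rightarrow> nat \<Rightarrow> 'a \<Rightarrow> 'a pmf" where
  "kernel_iter \<kappa> 0 w = return_pmf w"
| "kernel_iter \<kappa> (Suc n) w = bind_pmf (\<kappa> w) (kernel_iter \<kappa> n)"

lemma kernel_iter_add: "kernel_iter \<kappa> (m + n) w = bind_pmf (kernel_iter \<kappa> m w) (kernel_iter \<kappa> n)"
  by (induction m arbitrary: w) (auto simp: bind_return_pmf bind_assoc_pmf intro!: bind_pmf_cong)

lemma integrable_pmf_bounded:
  fixes \<phi> :: "'a \<Rightarrow> 'b::{banach, second_countable_topology}"
  assumes "bounded (range \<phi>)"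
  shows "integrable (measure_pmf p) \<phi>"
proof -
  obtain B where "\<And>x. norm (\<phi> x) \<le> B" using assms by (auto simp: bounded_iff)
  then show ?thesis by (intro measure_pmf.integrable_const_bound[where B=B]) auto
qed

lemma norm_expectation_pmf_le:
  fixes \<phi> :: "'a \<Rightarrow> 'b::{banach, second_countable_topology}"
  assumes "\<And>x. norm (\<phi> x) \<le> B"
  shows "norm (measure_pmf.expectation p \<phi>) \<le> B"
proof -
  have "integrable (measure_pmf p) \<phi>"
    using assms by (intro integrable_pmf_bounded) (auto simp: bounded_iff)
  then have "norm (measure_pmf.expectation p \<phi>) \<le> measure_pmf.expectation p (\<lambda>x. norm (\<phi> x))"
    by (intro integral_norm_bound)
  also have "\<dots> \<le> measure_pmf.expectation p (\<lambda>x. B)"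
    using assms by (intro integral_mono integrable_pmf_bounded) (auto simp: bounded_iff)
  finally show ?thesis by simp
qed

lemma expectation_bind_pmf_real:
  fixes \<phi> :: "'a \<Rightarrow> real"
  assumes "bounded (range \<phi>)"
  shows "measure_pmf.expectation (bind_pmf p \<kappa>) \<phi> =
    measure_pmf.expectation p (\<lambda>x. measure_pmf.expectation (\<kappa> x) \<phi>)"
proof -
  obtain B where B: "\<And>x. norm (\<phi> x) \<le> B" using assms by (auto simp: bounded_iff)
  show ?thesis unfolding measure_pmf_bind
    by (rule integral_bind[where K="count_space UNIV" and B=B and B'=1])
       (use B in \<open>auto intro: measure_pmf.finite_measure_axioms
          simp: measure_pmf.emeasure_space_1 measure_pmf_in_subprob_algebra\<close>)
qed

lemma expectation_bind_pmf_complex: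
  fixes \<phi> :: "'a \<Rightarrow> complex"
  assumes "bounded (range \<phi>)"
  shows "measure_pmf.expectation (bind_pmf p \<kappa>) \<phi> =
    measure_pmf.expectation p (\<lambda>x. measure_pmf.expectation (\<kappa> x) \<phi>)"
proof -
  obtain B where B: "\<And>x. norm (\<phi> x) \<le> B" using assms by (auto simp: bounded_iff)
  have Re_Im: "bounded (range (\<lambda>x. Re (\<phi> x)))" "bounded (range (\<lambda>x. Im (\<phi> x)))"
    using order_trans[OF abs_Re_le_cmod B] order_trans[OF abs_Im_le_cmod B]
    by (auto simp: bounded_iff intro!: exI[of _ B])
  have int: "integrable (measure_pmf q) \<phi>" for q :: "'a pmf"
    by (rule integrable_pmf_bounded[OF assms])
  have int': "integrable (measure_pmf p) (\<lambda>x. measure_pmf.expectation (\<kappa> x) \<phi>)"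
    using norm_expectation_pmf_le[of \<phi> B] B
    by (intro integrable_pmf_bounded) (auto simp: bounded_iff)
  show ?thesis
    by (rule complex_eqI)
      (simp_all only: integral_Re[symmetric] integral_Im[symmetric] int int'
        expectation_bind_pmf_real Re_Im)
qed

lemma expectation_kernel_iter_add:
  fixes \<phi> :: "'a \<Rightarrow> complex"
  assumes "bounded (range \<phi>)"
  shows "measure_pmf.expectation (kernel_iter \<kappa> (m + n) w) \<phi> =
    measure_pmf.expectation (kernel_iter \<kappa> m w) (\<lambda>x. measure_pmf.expectation (kernel_iter \<kappa> n x) \<phi>)"
  by (simp add: kernel_iter_add expectation_bind_pmf_complex assms)

lemma bounded_range_expectation:
  fixes \<phi> :: "'a \<Rightarrow> complex"
  assumes "bounded (range \<phi>)"
  shows "bounded (range (\<lambda>x. measure_pmf.expectation (\<kappa> x) \<phi>))"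
proof -
  obtain B where "\<And>x. norm (\<phi> x) \<le> B" using assms by (auto simp: bounded_iff)
  then show ?thesis
    using norm_expectation_pmf_le[of \<phi> B] by (auto simp: bounded_iff)
qed

text \<open>A tent over the ball: a continuous stand-in for its indicator, positive on the same set,
  to which the Feller property applies.\<close>

definition hat :: "'a::metric_space \<Rightarrow> real \<Rightarrow> 'a \<Rightarrow> real" where
  "hat a r z = max 0 (1 - dist z a / r)"

lemma hat_bounds: "r > 0 \<Longrightarrow> 0 \<le> hat a r z" "r > 0 \<Longrightarrow> hat a r z \<le> 1"
  by (auto simp: hat_def)

lemma hat_pos_iff: "r > 0 \<Longrightarrow> 0 < hat a r z \<longleftrightarrow> z \<in> ball a r"
  by (auto simp: hat_def dist_commute field_simps less_max_iff_disj)

lemma continuous_on_hat: "r > 0 \<Longrightarrow> continuous_on S (hat a r)"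
  unfolding hat_def by (intro continuous_intros) auto

lemma bounded_range_hat: "r > 0 \<Longrightarrow> bounded (range (hat a r))"
  using hat_bounds[of r a] by (auto simp: bounded_iff intro!: exI[of _ 1])

text \<open>Turns reachability, a statement about supports, into positivity of an expectation, which
  for a Feller kernel and continuous \<open>\<phi>\<close> varies continuously with the starting
  point.\<close>

lemma expectation_pos_iff:
  fixes \<phi> :: "'a \<Rightarrow> real"
  assumes "bounded (range \<phi>)" "\<And>x. 0 \<le> \<phi> x"
  shows "0 < measure_pmf.expectation p \<phi> \<longleftrightarrow> (\<exists>x\<in>set_pmf p. 0 < \<phi> x)"
proof -
  have "measure_pmf.expectation p \<phi> = 0 \<longleftrightarrow> (AE x in measure_pmf p. \<phi> x = 0)"
    by (intro integral_nonneg_eq_0_iff_AE integrable_pmf_bounded assms) (auto simp: assms)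
  moreover have "0 \<le> measure_pmf.expectation p \<phi>" by (simp add: assms)
  ultimately show ?thesis
    using assms(2) by (auto simp: AE_measure_pmf_iff less_le)
qed

text \<open>The assumptions distil weak continuity, normality, tightness and the expansion at one
  point \<open>p\<close>. In \<open>reaches\<close> a single time serves the whole compact set; in
  \<open>tight_kernel\<close> the set \<open>K\<close> is common to all starting points but the time
  is not.\<close>

locale equicontinuous_kernel =
  fixes \<kappa> :: "'a::metric_space \<Rightarrow> 'a pmf" and p :: 'a
  assumes feller: "\<And>\<phi>::'a \<Rightarrow> complex. continuous_on UNIV \<phi> \<Longrightarrow> bounded (range \<phi>) \<Longrightarrow>
      continuous_on UNIV (\<lambda>w. measure_pmf.expectation (\<kappa> w) \<phi>)"
    and equicontinuous: "\<And>(\<phi>::'a \<Rightarrow> complex) w \<epsilon>. continuous_on UNIV \<phi> \<Longrightarrow> bounded (range \<phi>) \<Longrightarrow> \<epsilon> > 0 \<Longrightarrow>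
      \<exists>\<delta>>0. \<forall>n. \<forall>w'. dist w' w < \<delta> \<longrightarrow>
        dist (measure_pmf.expectation (kernel_iter \<kappa> n w') \<phi>)
          (measure_pmf.expectation (kernel_iter \<kappa> n w) \<phi>) < \<epsilon>"
    and tight_kernel: "\<And>\<epsilon>. \<epsilon> > 0 \<Longrightarrow>
      \<exists>K. compact K \<and> (\<forall>w. \<exists>n0. \<forall>n\<ge>n0. measure_pmf.prob (kernel_iter \<kappa> n w) K \<ge> 1 - \<epsilon>)"
    and reaches: "\<And>r K. r > 0 \<Longrightarrow> compact K \<Longrightarrow>
      \<exists>n. \<forall>w\<in>K. set_pmf (kernel_iter \<kappa> n w) \<inter> ball p r \<noteq> {}"
begin

lemma feller_iter:
  fixes \<phi> :: "'a \<Rightarrow> complex"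
  assumes "continuous_on UNIV \<phi>" "bounded (range \<phi>)"
  shows "continuous_on UNIV (\<lambda>w. measure_pmf.expectation (kernel_iter \<kappa> n w) \<phi>)"
proof (induction n)
  case 0
  then show ?case using assms by simp
next
  case (Suc n)
  have "continuous_on UNIV (\<lambda>w. measure_pmf.expectation (\<kappa> w) (\<lambda>x. measure_pmf.expectation (kernel_iter \<kappa> n x) \<phi>))"
    by (intro feller Suc bounded_range_expectation assms)
  then show ?case by (simp add: expectation_bind_pmf_complex assms)
qed

lemma feller_iter_hat:
  assumes "r > 0"
  shows "continuous_on UNIV (\<lambda>w. measure_pmf.expectation (kernel_iter \<kappa> n w) (hat a r))"
proof -
  have "continuous_on UNIV (\<lambda>w. measure_pmf.expectation (kernel_iter \<kappa> n w) (\<lambda>x. complex_of_real (hat a r x)))"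
    using hat_bounds[OF assms, of a]
    by (intro feller_iter continuous_intros continuous_on_hat assms)
       (auto simp: bounded_iff intro!: exI[of _ 1])
  then have "continuous_on UNIV (\<lambda>w. Re (complex_of_real (measure_pmf.expectation (kernel_iter \<kappa> n w) (hat a r))))"
    by (intro continuous_on_Re) (simp only: integral_complex_of_real)
  then show ?thesis by simp
qed

text \<open>After a long time at least half of the mass lies in a fixed compact \<open>K\<close>,
  and \<open>m\<close> further steps from any point of \<open>K\<close> give the tent an expectation
  bounded below. Thus \<open>c\<close> is common to all starting points and only \<open>N\<close>
  varies.\<close>

lemma lower_bound:
  assumes "r > 0"
  obtains c where "c > 0"
    "\<And>w. \<exists>N. \<forall>n\<ge>N. c \<le> measure_pmf.expectation (kernel_iter \<kappa> n w) (hat p r)"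
proof -
  obtain K where K: "compact K"
    "\<And>w. \<exists>n0. \<forall>n\<ge>n0. measure_pmf.prob (kernel_iter \<kappa> n w) K \<ge> 1/2"
    using tight_kernel[of "1/2"] by auto
  have "K \<noteq> {}"
    using K(2)[of p] by force
  obtain m where m: "\<And>w. w \<in> K \<Longrightarrow> set_pmf (kernel_iter \<kappa> m w) \<inter> ball p r \<noteq> {}"
    using reaches[OF assms K(1)] by blast
  define h where "h w = measure_pmf.expectation (kernel_iter \<kappa> m w) (hat p r)" for w
  have h_pos: "0 < h w" if "w \<in> K" for w
    unfolding h_def using m[OF that]
    by (subst expectation_pos_iff) (auto simp: bounded_range_hat hat_bounds hat_pos_iff assms)
  have h_bounds: "0 \<le> h w" "h w \<le> 1" for w
    unfolding h_def using norm_expectation_pmf_le[of "hat p r" 1 "kernel_iter \<kappa> m w"]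
      hat_bounds[OF assms, of p] by (auto simp: abs_le_iff)
  \<comment> \<open>One \<open>m\<close> for all of \<open>K\<close> makes \<open>h\<close> a single
    continuous function, whose minimum on \<open>K\<close> is positive by
    \<open>h_pos\<close>.\<close>
  obtain w0 where w0: "w0 \<in> K" "\<And>w. w \<in> K \<Longrightarrow> h w0 \<le> h w"
    using continuous_attains_inf[OF K(1) \<open>K \<noteq> {}\<close>, of h]
      continuous_on_subset[OF feller_iter_hat[OF assms, of m p]] unfolding h_def by blast
  show ?thesis
  proof (rule that[of "h w0 / 2"])
    show "h w0 / 2 > 0" using h_pos w0 by simp
    fix w
    obtain n0 where n0: "\<And>n. n \<ge> n0 \<Longrightarrow> measure_pmf.prob (kernel_iter \<kappa> n w) K \<ge> 1/2"
      using K(2) by blast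
    have "h w0 / 2 \<le> measure_pmf.expectation (kernel_iter \<kappa> n w) (hat p r)" if "n \<ge> n0 + m" for n
    proof -
      have "measure_pmf.expectation (kernel_iter \<kappa> (n - m + m) w) (hat p r) =
          measure_pmf.expectation (kernel_iter \<kappa> (n - m) w) h"
        unfolding h_def kernel_iter_add by (rule expectation_bind_pmf_real[OF bounded_range_hat[OF assms]])
      then have "measure_pmf.expectation (kernel_iter \<kappa> n w) (hat p r) =
          measure_pmf.expectation (kernel_iter \<kappa> (n - m) w) h"
        using that by simp
      moreover have "measure_pmf.expectation (kernel_iter \<kappa> (n - m) w) (\<lambda>x. h w0 * indicator K x) \<le>
          measure_pmf.expectation (kernel_iter \<kappa> (n - m) w) h"
        using w0 h_bounds
        by (intro integral_mono integrable_pmf_bounded)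
           (auto simp: bounded_iff abs_le_iff split: split_indicator intro!: exI[of _ 1] intro: order_trans[of _ 0])
      moreover have "measure_pmf.expectation (kernel_iter \<kappa> (n - m) w) (\<lambda>x. h w0 * indicator K x) =
          h w0 * measure_pmf.prob (kernel_iter \<kappa> (n - m) w) K"
        by simp
      moreover have "h w0 * measure_pmf.prob (kernel_iter \<kappa> (n - m) w) K \<ge> h w0 * (1/2)"
        using n0[of "n - m"] that h_bounds by (intro mult_left_mono) auto
      ultimately show ?thesis by simp
    qed
    then show "\<exists>N. \<forall>n\<ge>N. h w0 / 2 \<le> measure_pmf.expectation (kernel_iter \<kappa> n w) (hat p r)"
      by blast
  qed
qed

text \<open>Coupling at a large time \<open>N\<close>: independent copies started at \<open>w\<close> and \<open>w'\<close> are both near \<open>p\<close> with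
  probability at least \<open>c\<^sup>2\<close>, and on that event the later values differ by at most \<open>2 \<epsilon>\<close>. Hence an
  asymptotic bound \<open>d > 2 \<epsilon>\<close> for the oscillation improves to \<open>d - c\<^sup>2 (d - 2 \<epsilon>)\<close>.\<close>

lemma coalescence:
  fixes \<phi> :: "'a \<Rightarrow> complex"
  assumes \<phi>: "continuous_on UNIV \<phi>" "bounded (range \<phi>)"
  shows "(\<lambda>n. dist (measure_pmf.expectation (kernel_iter \<kappa> n w) \<phi>)
    (measure_pmf.expectation (kernel_iter \<kappa> n w') \<phi>)) \<longlonglongrightarrow> 0"
proof -
  define u where "u n w = measure_pmf.expectation (kernel_iter \<kappa> n w) \<phi>" for n w
  define g where "g n x = dist (u n (fst x)) (u n (snd x))" for n and x :: "'a \<times> 'a"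
  obtain B where B: "\<And>x. norm (\<phi> x) \<le> B" using \<phi>(2) by (auto simp: bounded_iff)
  have u_le: "norm (u n x) \<le> B" for n x
    unfolding u_def by (rule norm_expectation_pmf_le[OF B])
  have g_bounds: "0 \<le> g n x" "g n x \<le> 2 * B" for n x
    using norm_triangle_ineq4[of "u n (fst x)" "u n (snd x)"] u_le[of n "fst x"] u_le[of n "snd x"]
    by (auto simp: g_def dist_norm)
  have "0 \<le> B" using u_le[of 0 p] norm_ge_zero order_trans by blast
  \<comment> \<open>An eventual bound for each pair separately, with no common time. The slack
    \<open>e\<close> is what makes the infimum of such bounds a bound itself.\<close>
  define bound where "bound d \<longleftrightarrow> 0 \<le> d \<and> (\<forall>x. \<forall>e>0. \<forall>\<^sub>F n in sequentially. g n x < d + e)" for d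
  have improve: "bound (d - c\<^sup>2 * (d - 2 * \<epsilon>))"
    if d: "bound d" "2 * \<epsilon> < d" and \<epsilon>: "0 < \<epsilon>" and c: "0 < c" and \<delta>: "0 < \<delta>"
      and near: "\<And>k x. dist x p < \<delta> \<Longrightarrow> dist (u k x) (u k p) < \<epsilon>"
      and lower: "\<And>w. \<exists>N. \<forall>n\<ge>N. c \<le> measure_pmf.expectation (kernel_iter \<kappa> n w) (hat p \<delta>)"
    for d \<epsilon> c \<delta> :: real
  proof -
    have hat_le: "measure_pmf.expectation q (hat p \<delta>) \<le> 1" for q
      using norm_expectation_pmf_le[of "hat p \<delta>" 1 q] hat_bounds[OF \<delta>, of p] by (auto simp: abs_le_iff)
    have "c \<le> 1" using lower[of p] hat_le by (meson order_refl order_trans)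
    then have "c\<^sup>2 \<le> 1" using c by (simp add: power_le_one)
    have nonneg: "0 \<le> d - c\<^sup>2 * (d - 2 * \<epsilon>)"
    proof -
      have "c\<^sup>2 * (d - 2 * \<epsilon>) \<le> 1 * (d - 2 * \<epsilon>)"
        using \<open>c\<^sup>2 \<le> 1\<close> d by (intro mult_right_mono) auto
      then show ?thesis using \<epsilon> by simp
    qed
    have "\<forall>\<^sub>F n in sequentially. g n z < d - c\<^sup>2 * (d - 2 * \<epsilon>) + e" if "0 < e" for z and e :: real
    proof -
      obtain w w' where z: "z = (w, w')" by (cases z)
      obtain N1 N2 where N12: "\<And>n. n \<ge> N1 \<Longrightarrow> c \<le> measure_pmf.expectation (kernel_iter \<kappa> n w) (hat p \<delta>)"
        "\<And>n. n \<ge> N2 \<Longrightarrow> c \<le> measure_pmf.expectation (kernel_iter \<kappa> n w') (hat p \<delta>)"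
        using lower[of w] lower[of w'] by blast
      define N where "N = max N1 N2"
      define \<pi> where "\<pi> = pair_pmf (kernel_iter \<kappa> N w) (kernel_iter \<kappa> N w')"
      \<comment> \<open>\<open>H\<close> is positive only if both copies are within
        \<open>\<delta>\<close> of \<open>p\<close>, and its expectation factors by
        independence.\<close>
      define H where "H x = hat p \<delta> (fst x) * hat p \<delta> (snd x)" for x :: "'a \<times> 'a"
      have H_bounds: "0 \<le> H x" "H x \<le> 1" for x
        using hat_bounds[OF \<delta>, of p] by (auto simp: H_def mult_le_one)
      define \<eta> where "\<eta> = measure_pmf.expectation \<pi> H"
      have int: "integrable (measure_pmf \<pi>) h" if "\<And>x. \<bar>h x\<bar> \<le> C" for h :: "'a \<times> 'a \<Rightarrow> real" and C
        using that by (intro integrable_pmf_bounded) (auto simp: bounded_iff)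
      have int_H: "integrable (measure_pmf \<pi>) H"
        using H_bounds by (intro int[of _ 1]) auto
      have int_g: "integrable (measure_pmf \<pi>) (g k)" for k
        using g_bounds by (intro int[of _ "2*B"]) auto
      have "\<eta> = measure_pmf.expectation (kernel_iter \<kappa> N w) (hat p \<delta>) *
          measure_pmf.expectation (kernel_iter \<kappa> N w') (hat p \<delta>)"
      proof -
        have bH: "bounded (range H)"
          using H_bounds by (auto simp: bounded_iff intro!: exI[of _ 1])
        show ?thesis
          unfolding \<eta>_def \<pi>_def pair_pmf_def
          by (simp add: expectation_bind_pmf_real bH)(simp add: H_def)
      qed
      then have "c\<^sup>2 \<le> \<eta>"
        using N12[of N] c by (simp add: N_def power2_eq_square mult_mono)
      \<comment> \<open>The expected excess over \<open>d\<close> at later times. Pairs drawn from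
        \<open>\<pi>\<close> obey the bound only eventually, so \<open>t k\<close> need not vanish,
        but it tends to 0 by dominated convergence.\<close>
      define t where "t k = measure_pmf.expectation \<pi> (\<lambda>x. max (g k x - d) 0)" for k
      have t_lim: "t \<longlonglongrightarrow> 0"
      proof -
        have "(\<lambda>k. measure_pmf.expectation \<pi> (\<lambda>x. max (g k x - d) 0)) \<longlonglongrightarrow> measure_pmf.expectation \<pi> (\<lambda>x. 0)"
        proof (rule integral_dominated_convergence[where w="\<lambda>_. 2 * B"])
          have "(\<lambda>k. max (g k x - d) 0) \<longlonglongrightarrow> 0" for x
          proof (rule tendstoI)
            fix e :: real assume "0 < e"
            then have "\<forall>\<^sub>F n in sequentially. g n x < d + e" using d(1) unfolding bound_def by blast
            then show "\<forall>\<^sub>F n in sequentially. dist (max (g n x - d) 0) 0 < e"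
              by eventually_elim (use \<open>0 < e\<close> in auto)
          qed
          then show "AE x in measure_pmf \<pi>. (\<lambda>k. max (g k x - d) 0) \<longlonglongrightarrow> 0" by simp
          show "AE x in measure_pmf \<pi>. norm (max (g k x - d) 0) \<le> 2 * B" for k
          proof (rule AE_I2)
            fix x show "norm (max (g k x - d) 0) \<le> 2 * B"
              using g_bounds(2)[of k x] d(1) \<open>0 \<le> B\<close> by (auto simp: bound_def)
          qed
        qed auto
        then show ?thesis unfolding t_def by simp
      qed
      have int_t: "integrable (measure_pmf \<pi>) (\<lambda>x. max (g k x - d) 0)" for k
      proof (rule int[of _ "2*B"])
        fix x show "\<bar>max (g k x - d) 0\<bar> \<le> 2 * B"
          using g_bounds(2)[of k x] d(1) \<open>0 \<le> B\<close> by (auto simp: bound_def)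
      qed
      have main: "g (N + k) z \<le> d - c\<^sup>2 * (d - 2 * \<epsilon>) + t k" for k
      proof -
        have bu': "bounded (range (\<lambda>x::'a\<times>'a. u k (fst x)))" "bounded (range (\<lambda>x::'a\<times>'a. u k (snd x)))"
          using u_le by (auto simp: bounded_iff)
        \<comment> \<open>Both marginals of \<open>\<pi>\<close> are \<open>N\<close>-step laws, so
          the difference of the two later values becomes one expectation under
          \<open>\<pi>\<close>.\<close>
        have "u (N + k) w = measure_pmf.expectation (map_pmf fst \<pi>) (u k)"
          "u (N + k) w' = measure_pmf.expectation (map_pmf snd \<pi>) (u k)"
          unfolding \<pi>_def map_fst_pair_pmf map_snd_pair_pmf
          unfolding u_def by (simp_all add: expectation_kernel_iter_add \<phi>)
        then have "u (N + k) w - u (N + k) w' = measure_pmf.expectation \<pi> (\<lambda>x. u k (fst x) - u k (snd x))"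
          by (simp add: integrable_pmf_bounded bu')
        then have "g (N + k) z = norm (measure_pmf.expectation \<pi> (\<lambda>x. u k (fst x) - u k (snd x)))"
          by (simp add: g_def z dist_norm)
        also have "\<dots> \<le> measure_pmf.expectation \<pi> (g k)"
          unfolding g_def dist_norm by (rule integral_norm_bound)
        also have "\<dots> \<le> measure_pmf.expectation \<pi> (\<lambda>x. d - (d - 2 * \<epsilon>) * H x + max (g k x - d) 0)"
        proof (intro integral_mono Bochner_Integration.integrable_add Bochner_Integration.integrable_diff
            int_g int_t integrable_mult_right int_H)
          fix x
          \<comment> \<open>With both points near \<open>p\<close> the oscillation is at most
            \<open>2 * \<epsilon>\<close> and \<open>H x\<close> at most 1; otherwise
            \<open>H x\<close> is 0 and the excess term makes up for what exceeds
            \<open>d\<close>.\<close>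
          show "g k x \<le> d - (d - 2 * \<epsilon>) * H x + max (g k x - d) 0"
          proof (cases "dist (fst x) p < \<delta> \<and> dist (snd x) p < \<delta>")
            case True
            then have "g k x \<le> 2 * \<epsilon>"
              using near[of "fst x" k] near[of "snd x" k] dist_triangle2[of "u k (fst x)" "u k (snd x)" "u k p"]
              by (simp add: g_def)
            moreover have "(d - 2 * \<epsilon>) * H x \<le> (d - 2 * \<epsilon>) * 1"
              using H_bounds d by (intro mult_left_mono) auto
            ultimately show ?thesis by simp
          next
            case False
            then have "hat p \<delta> (fst x) = 0 \<or> hat p \<delta> (snd x) = 0"
              using \<delta> by (auto simp: hat_def field_simps max_def)
            then have "H x = 0" by (auto simp: H_def)
            then show ?thesis by auto
          qed
        qed auto
        also have "\<dots> = d - (d - 2 * \<epsilon>) * \<eta> + t k"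
          unfolding t_def \<eta>_def using int_H int_t by simp
        also have "\<dots> \<le> d - c\<^sup>2 * (d - 2 * \<epsilon>) + t k"
          using mult_left_mono[OF \<open>c\<^sup>2 \<le> \<eta>\<close>, of "d - 2 * \<epsilon>"] d(2) by (simp add: mult.commute)
        finally show ?thesis .
      qed
      have "\<forall>\<^sub>F k in sequentially. t k < e"
        using t_lim \<open>0 < e\<close> by (rule order_tendstoD)
      then have "\<forall>\<^sub>F k in sequentially. g (k + N) z < d - c\<^sup>2 * (d - 2 * \<epsilon>) + e"
      proof eventually_elim
        case (elim k)
        then show ?case using main[of k] by (simp add: add.commute)
      qed
      then show ?thesis by (rule eventually_sequentially_seg[THEN iffD1])
    qed
    then show ?thesis using nonneg by (auto simp: bound_def)
  qed
  \<comment> \<open>The least eventual bound: if it exceeded \<open>2 * \<epsilon>\<close>,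
    \<open>improve\<close> would lower it further.\<close>
  define D where "D = Inf {d. bound d}"
  have "bound (2 * B)"
    unfolding bound_def
    using \<open>0 \<le> B\<close> by (auto intro!: always_eventually le_less_trans[OF g_bounds(2)])
  have bdd: "bdd_below {d. bound d}" by (auto simp: bound_def bdd_below_def)
  have D_le: "D \<le> d" if "bound d" for d
    unfolding D_def using that bdd by (intro cInf_lower) auto
  have "0 \<le> D"
    unfolding D_def
  proof (rule cInf_greatest)
    show "{d. bound d} \<noteq> {}" using \<open>bound (2 * B)\<close> by blast
  qed (auto simp: bound_def)
  have "bound D"
  proof -
    have "\<forall>\<^sub>F n in sequentially. g n x < D + e" if "0 < e" for x e
    proof -
      have "\<exists>d\<in>{d. bound d}. d < D + e/2"
        unfolding D_def using \<open>bound (2 * B)\<close> that bdd by (intro cInf_lessD) auto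
      then obtain d where d: "bound d" "d < D + e/2" by blast
      have "\<forall>\<^sub>F n in sequentially. g n x < d + e/2" using d that unfolding bound_def by (meson half_gt_zero)
      then show ?thesis by eventually_elim (use d in auto)
    qed
    then show ?thesis using \<open>0 \<le> D\<close> by (auto simp: bound_def)
  qed
  have "D \<le> 2 * \<epsilon>" if \<epsilon>: "0 < \<epsilon>" for \<epsilon>
  proof (rule ccontr)
    assume D: "\<not> D \<le> 2 * \<epsilon>"
    obtain \<delta> where \<delta>: "\<delta> > 0" "\<And>k x. dist x p < \<delta> \<Longrightarrow> dist (u k x) (u k p) < \<epsilon>"
      using equicontinuous[OF \<phi> \<epsilon>, of p] unfolding u_def by blast
    obtain c where c: "c > 0" "\<And>w. \<exists>N. \<forall>n\<ge>N. c \<le> measure_pmf.expectation (kernel_iter \<kappa> n w) (hat p \<delta>)"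
      using lower_bound[OF \<delta>(1)] by blast
    have "D \<le> D - c\<^sup>2 * (D - 2 * \<epsilon>)"
      using D by (intro D_le improve[OF \<open>bound D\<close> _ \<epsilon> c(1) \<delta>(1) \<delta>(2) c(2)]) auto
    moreover have "0 < c\<^sup>2 * (D - 2 * \<epsilon>)" using c D by simp
    ultimately show False by simp
  qed
  \<comment> \<open>If \<open>D\<close> were positive, the choice \<open>D / 4\<close> for
    \<open>\<epsilon>\<close> would give \<open>D \<le> D / 2\<close>.\<close>
  from this[of "D/4"] \<open>0 \<le> D\<close> have "D = 0" by (cases "D = 0") auto
  with \<open>bound D\<close> have *: "\<forall>\<^sub>F n in sequentially. g n (w, w') < e" if "0 < e" for e
    using that by (auto simp: bound_def)
  have "(\<lambda>n. g n (w, w')) \<longlonglongrightarrow> 0"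
    using * g_bounds(1) by (intro order_tendstoI) (auto intro!: always_eventually elim: less_le_trans)
  then show ?thesis by (simp add: g_def u_def)
qed

text \<open>Coalescence leaves only the convergence at \<open>p\<close>. The value at a late time
  \<open>i\<close> is an average of the values at time \<open>N\<close> under the law at time
  \<open>i - N\<close>, which sits mostly on a compact set where these values are close to
  \<open>u N p\<close>. Hence the sequence at \<open>p\<close> is Cauchy.\<close>

theorem converges_to_constant:
  fixes \<phi> :: "'a \<Rightarrow> complex"
  assumes \<phi>: "continuous_on UNIV \<phi>" "bounded (range \<phi>)"
  shows "\<exists>c. \<forall>w. (\<lambda>n. measure_pmf.expectation (kernel_iter \<kappa> n w) \<phi>) \<longlonglongrightarrow> c"
proof -
  define u where "u n w = measure_pmf.expectation (kernel_iter \<kappa> n w) \<phi>" for n w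
  obtain B where B: "\<And>x. norm (\<phi> x) \<le> B" using \<phi>(2) by (auto simp: bounded_iff)
  have u_le: "norm (u n x) \<le> B" for n x
    unfolding u_def by (rule norm_expectation_pmf_le[OF B])
  have "0 \<le> B" using u_le[of 0 p] norm_ge_zero order_trans by blast
  have "Cauchy (\<lambda>n. u n p)"
  proof (rule metric_CauchyI)
    fix e :: real assume "0 < e"
    \<comment> \<open>The final estimate is \<open>\<epsilon> + 2 * B * \<epsilon>\<close>, strictly
      below \<open>\<epsilon> * (2 + 2 * B) = e / 2\<close>.\<close>
    define \<epsilon> where "\<epsilon> = e / (2 * (2 + 2 * B))"
    have \<epsilon>: "0 < \<epsilon>" using \<open>0 < e\<close> \<open>0 \<le> B\<close> by (simp add: \<epsilon>_def)
    obtain K n0 where K: "compact K" "\<And>n. n \<ge> n0 \<Longrightarrow> measure_pmf.prob (kernel_iter \<kappa> n p) K \<ge> 1 - \<epsilon>"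
      using tight_kernel[OF \<epsilon>] by blast
    \<comment> \<open>Differences are used because their limit 0 comes from coalescence, before
      \<open>u n p\<close> is known to converge.\<close>
    have "uniform_limit K (\<lambda>n x. u n x - u n p) (\<lambda>_. 0) sequentially"
    proof (rule equicontinuous_uniform_limit_const[OF K(1)])
      show "\<exists>\<delta>>0. \<forall>n y. dist y x < \<delta> \<longrightarrow> dist (u n y - u n p) (u n x - u n p) < \<epsilon>" if "0 < \<epsilon>" for x \<epsilon>
        using equicontinuous[OF \<phi> that, of x] by (simp add: u_def dist_norm)
      show "(\<lambda>n. u n x - u n p) \<longlonglongrightarrow> 0" for x
        using coalescence[OF \<phi>, of x p] unfolding u_def dist_norm by (rule tendsto_norm_zero_cancel)
    qed
    then have "\<forall>\<^sub>F n in sequentially. \<forall>x\<in>K. dist (u n x - u n p) 0 < \<epsilon>"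
      using \<epsilon> by (rule uniform_limitD)
    then obtain N where N: "\<And>x. x \<in> K \<Longrightarrow> norm (u N x - u N p) < \<epsilon>"
      by (auto simp: eventually_sequentially)
    have close: "dist (u i p) (u N p) < e/2" if "i \<ge> N + n0" for i
    proof -
      define q where "q = kernel_iter \<kappa> (i - N) p"
      have "u (i - N + N) p = measure_pmf.expectation q (u N)"
        unfolding u_def q_def by (rule expectation_kernel_iter_add[OF \<phi>(2)])
      then have "u i p - u N p = measure_pmf.expectation q (\<lambda>x. u N x - u N p)"
        using that u_le
        by (subst Bochner_Integration.integral_diff)
           (auto intro!: integrable_pmf_bounded exI[of _ B] simp: bounded_iff)
      then have "dist (u i p) (u N p) \<le> measure_pmf.expectation q (\<lambda>x. norm (u N x - u N p))"
        using integral_norm_bound by (simp add: dist_norm)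
      also have "\<dots> \<le> measure_pmf.expectation q (\<lambda>x. \<epsilon> + 2 * B * indicator (- K) x)"
      proof (rule integral_mono)
        have *: "norm (u N x - u N p) \<le> 2 * B" for x
          using norm_triangle_ineq4[of "u N x" "u N p"] u_le[of N x] u_le[of N p] by simp
        then show "integrable (measure_pmf q) (\<lambda>x. norm (u N x - u N p))"
          by (intro integrable_pmf_bounded) (auto simp: bounded_iff)
        show "norm (u N x - u N p) \<le> \<epsilon> + 2 * B * indicator (- K) x" for x
        proof (cases "x \<in> K")
          case True
          then show ?thesis using N[of x] by simp
        next
          case False
          then show ?thesis using *[of x] \<epsilon> by simp
        qed
        show "integrable (measure_pmf q) (\<lambda>x. \<epsilon> + 2 * B * indicator (- K) x)"
          by (intro integrable_pmf_bounded)
            (use \<open>0 \<le> B\<close> \<epsilon> in \<open>auto simp: bounded_iff split: split_indicator intro!: exI[of _ "\<epsilon> + 2 * B"]\<close>)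
      qed
      also have "\<dots> = \<epsilon> + 2 * B * measure_pmf.prob q (- K)"
        by (subst Bochner_Integration.integral_add)
           (auto intro!: integrable_pmf_bounded exI[of _ 1] simp: bounded_iff split: split_indicator)
      also have "measure_pmf.prob q (- K) = 1 - measure_pmf.prob q K"
        using measure_pmf.prob_compl[of K q] by (simp add: Compl_eq_Diff_UNIV)
      also have "\<epsilon> + 2 * B * (1 - measure_pmf.prob q K) \<le> \<epsilon> + 2 * B * \<epsilon>"
        using K(2)[of "i - N", folded q_def] that \<open>0 \<le> B\<close> by (intro add_left_mono mult_left_mono) linarith+
      also have "\<dots> < \<epsilon> * (2 + 2 * B)" using \<epsilon> by (simp add: algebra_simps)
      also have "\<dots> = e / 2" using \<open>0 \<le> B\<close> by (simp add: \<epsilon>_def field_simps)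
      finally show ?thesis .
    qed
    show "\<exists>M. \<forall>m\<ge>M. \<forall>n\<ge>M. dist (u m p) (u n p) < e"
    proof (intro exI[of _ "N + n0"] allI impI)
      fix m n assume "N + n0 \<le> m" "N + n0 \<le> n"
      then show "dist (u m p) (u n p) < e"
        using close[of m] close[of n] dist_triangle2[of "u m p" "u n p" "u N p"] by linarith
    qed
  qed
  then obtain c where c: "(\<lambda>n. u n p) \<longlonglongrightarrow> c"
    by (auto simp: Cauchy_convergent_iff convergent_def)
  have "(\<lambda>n. u n w) \<longlonglongrightarrow> c" for w
  proof -
    have "(\<lambda>n. u n w - u n p) \<longlonglongrightarrow> 0"
      using coalescence[OF \<phi>, of w p] unfolding u_def dist_norm by (rule tendsto_norm_zero_cancel)
    from tendsto_add[OF this c] show ?thesis by simp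
  qed
  then show ?thesis by (auto simp: u_def)
qed

end

section \<open>Limits of tight sequences of measures on the plane\<close>

definition binary_digit :: "nat \<Rightarrow> real \<Rightarrow> nat" where
  "binary_digit k x = nat (\<lfloor>2 ^ Suc k * x\<rfloor> - 2 * \<lfloor>2 ^ k * x\<rfloor>)"

lemma floor_double_cases: "\<lfloor>2 * y\<rfloor> - 2 * \<lfloor>y\<rfloor> \<in> {0, 1 :: int}" for y :: real
proof -
  have "2 * \<lfloor>y\<rfloor> \<le> \<lfloor>2 * y\<rfloor>" by (simp add: le_floor_iff)
  moreover have "\<lfloor>2 * y\<rfloor> \<le> 2 * \<lfloor>y\<rfloor> + 1" by linarith
  ultimately show ?thesis by auto
qed

text \<open>Doubling shifts one binary digit into the integer part. Working with floors makes this
  valid for negative numbers too.\<close>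

lemma floor_Suc: "\<lfloor>2 ^ Suc k * x\<rfloor> = 2 * \<lfloor>2 ^ k * x\<rfloor> + int (binary_digit k x)" for x :: real
  using floor_double_cases[of "2 ^ k * x"] by (auto simp: binary_digit_def mult.assoc)

lemma binary_digit_le: "binary_digit k x \<le> 1"
  using floor_double_cases[of "2 ^ k * x"] by (auto simp: binary_digit_def mult.assoc)

lemma binary_digits_eq_imp_close:
  assumes "\<lfloor>x\<rfloor> = \<lfloor>y\<rfloor>" "\<And>k. k < n \<Longrightarrow> binary_digit k x = binary_digit k y"
  shows "\<bar>x - y\<bar> < 1 / 2 ^ n"
proof -
  have "k \<le> n \<Longrightarrow> \<lfloor>2 ^ k * x\<rfloor> = \<lfloor>2 ^ k * y\<rfloor>" for k
  proof (induction k)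
    case 0
    then show ?case using assms(1) by simp
  next
    case (Suc k)
    then show ?case using assms(2)[of k] by (simp only: floor_Suc)
  qed
  then have "\<lfloor>2 ^ n * x\<rfloor> = \<lfloor>2 ^ n * y\<rfloor>" by simp
  then have "\<bar>2 ^ n * x - 2 ^ n * y\<bar> < 1" by linarith
  moreover have "\<bar>2 ^ n * x - 2 ^ n * y\<bar> = 2 ^ n * \<bar>x - y\<bar>"
    by (simp add: abs_mult flip: right_diff_distrib)
  ultimately show ?thesis by (simp add: field_simps)
qed

text \<open>Base 8 leaves gaps between the values of series with digits in \<open>{0, 1, 2, 3}\<close>, so that nearby
  values force equal leading digits.\<close>

lemma digit_series_bounds:
  fixes d :: "nat \<Rightarrow> nat"
  assumes "\<And>k. d k \<le> 3"
  shows "summable (\<lambda>k. d k / 8 ^ k)" "0 \<le> (\<Sum>k. d k / 8 ^ k)" "(\<Sum>k. d k / 8 ^ k) \<le> 7/2"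
proof -
  \<comment> \<open>All digits equal to 3 give \<open>3 / (1 - 1/8) = 24/7\<close>, rounded up to
    7/2 in the conclusion.\<close>
  have geo: "(\<lambda>k. 3 * (1/8) ^ k) sums (24/7 :: real)"
    using sums_mult[OF geometric_sums[of "1/8::real"], of 3] by simp
  have le: "d k / 8 ^ k \<le> 3 * (1/8) ^ k" for k
    using assms[of k] by (simp add: power_divide divide_right_mono)
  show s: "summable (\<lambda>k. d k / 8 ^ k)"
    using le by (intro summable_comparison_test[OF _ sums_summable[OF geo]]) auto
  show "0 \<le> (\<Sum>k. d k / 8 ^ k)" by (intro suminf_nonneg s) auto
  have "(\<Sum>k. d k / 8 ^ k) \<le> (\<Sum>k. 3 * (1/8) ^ k)"
    by (intro suminf_le le s sums_summable[OF geo])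
  also have "\<dots> = 24/7" using geo by (simp add: sums_iff)
  finally show "(\<Sum>k. d k / 8 ^ k) \<le> 7/2" by simp
qed

lemma digit_series_split:
  fixes d :: "nat \<Rightarrow> nat"
  assumes "\<And>k. d k \<le> 3"
  shows "(\<Sum>k. d k / 8 ^ k) = d 0 + (\<Sum>k. d (Suc k) / 8 ^ k) / 8"
  using suminf_split_head[OF digit_series_bounds(1)[of d, OF assms]]
    suminf_divide[OF digit_series_bounds(1)[of "\<lambda>k. d (Suc k)", OF assms], of 8]
  by (simp add: mult.commute)

text \<open>The parts after the first digit lie between 0 and 7/16, so values less than 1/2 apart
  have first digits differing by less than 1/2 + 7/16 < 1. Removing the common digit and scaling by
  8 lowers \<open>n\<close> by one.\<close>

lemma digit_series_close:
  fixes a b :: "nat \<Rightarrow> nat"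
  assumes "\<And>k. a k \<le> 3" "\<And>k. b k \<le> 3"
    and "\<bar>(\<Sum>k. a k / 8 ^ k) - (\<Sum>k. b k / 8 ^ k)\<bar> < 1 / (2 * 8 ^ n)" and "k \<le> n"
  shows "a k = b k"
  using assms
proof (induction n arbitrary: a b k)
  case (0 a b k)
  have "\<bar>real (a 0) - real (b 0)\<bar> < 1"
    using 0(3)[unfolded power_0] digit_series_split[of a, OF 0(1)] digit_series_split[of b, OF 0(2)]
      digit_series_bounds[of "\<lambda>k. a (Suc k)", OF 0(1)] digit_series_bounds[of "\<lambda>k. b (Suc k)", OF 0(2)]
    by linarith
  then have "a 0 = b 0" by linarith
  then show ?case using 0(4) by simp
next
  case (Suc n a b k)
  have "(1::real) / (2 * 8 ^ Suc n) \<le> 1/16"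
    by (simp add: field_simps)
  then have "\<bar>real (a 0) - real (b 0)\<bar> < 1"
    using Suc.prems(3) digit_series_split[of a, OF Suc.prems(1)] digit_series_split[of b, OF Suc.prems(2)]
      digit_series_bounds[of "\<lambda>k. a (Suc k)", OF Suc.prems(1)]
      digit_series_bounds[of "\<lambda>k. b (Suc k)", OF Suc.prems(2)]
    by linarith
  then have eq: "a 0 = b 0" by linarith
  have "\<bar>(\<Sum>k. a (Suc k) / 8 ^ k) - (\<Sum>k. b (Suc k) / 8 ^ k)\<bar> < 1 / (2 * 8 ^ n)"
  proof -
    have "(1::real) / (2 * 8 ^ Suc n) = 1 / (2 * 8 ^ n) / 8" by simp
    moreover have "\<bar>x - y\<bar> < e'"
      if "e = e' / 8" "\<bar>s - t\<bar> < e" "s = c + x / 8" "t = c + y / 8" for x y s t c e e' :: real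
      using that by linarith
    ultimately show ?thesis
      using Suc.prems(3) digit_series_split[of a, OF Suc.prems(1)] digit_series_split[of b, OF Suc.prems(2)] unfolding eq by blast
  qed
  then have *: "j \<le> n \<Longrightarrow> a (Suc j) = b (Suc j)" for j
    using Suc.IH[of "\<lambda>k. a (Suc k)" "\<lambda>k. b (Suc k)" j] Suc.prems(1,2) by simp
  show ?case using eq * Suc.prems(4) by (cases k) auto
qed

text \<open>The floors of the coordinates number the unit square, and each base-8 digit holds one
  binary digit of each coordinate. The factor 8 exceeds the largest digit sum 7/2, which keeps codes
  of different squares apart. The code jumps between squares, but for discrete laws every map is
  measurable; continuity is wanted of the inverse only.\<close>

definition plane_code :: "complex \<Rightarrow> real" where
  "plane_code z = 8 * real (prod_encode (int_encode \<lfloor>Re z\<rfloor>, int_encode \<lfloor>Im z\<rfloor>)) +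
     (\<Sum>k. real (binary_digit k (Re z) + 2 * binary_digit k (Im z)) / 8 ^ k)"

lemma plane_code_bounds:
  "8 * real (prod_encode (int_encode \<lfloor>Re z\<rfloor>, int_encode \<lfloor>Im z\<rfloor>)) \<le> plane_code z"
  "plane_code z \<le> 8 * real (prod_encode (int_encode \<lfloor>Re z\<rfloor>, int_encode \<lfloor>Im z\<rfloor>)) + 7/2"
proof -
  have "binary_digit k (Re z) + 2 * binary_digit k (Im z) \<le> 3" for k
    using binary_digit_le[of k "Re z"] binary_digit_le[of k "Im z"] by linarith
  from digit_series_bounds[of "\<lambda>k. binary_digit k (Re z) + 2 * binary_digit k (Im z)", OF this]
  show "8 * real (prod_encode (int_encode \<lfloor>Re z\<rfloor>, int_encode \<lfloor>Im z\<rfloor>)) \<le> plane_code z"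
    "plane_code z \<le> 8 * real (prod_encode (int_encode \<lfloor>Re z\<rfloor>, int_encode \<lfloor>Im z\<rfloor>)) + 7/2"
    by (simp_all add: plane_code_def)
qed

text \<open>Codes of different squares differ by at least 8 - 7/2, so close codes share the square.
  They also share the leading base-8 digits, whose parity is the digit of the real part.\<close>

lemma plane_code_close:
  assumes "\<bar>plane_code z - plane_code w\<bar> < 1 / (2 * 8 ^ n)"
  shows "dist z w < 2 / 2 ^ n"
proof -
  let ?N = "\<lambda>z. prod_encode (int_encode \<lfloor>Re z\<rfloor>, int_encode \<lfloor>Im z\<rfloor>)"
  let ?d = "\<lambda>z k. binary_digit k (Re z) + 2 * binary_digit k (Im z)"
  have "(1::real) / (2 * 8 ^ n) \<le> 1/2" by (simp add: field_simps)
  then have "\<bar>real (?N z) - real (?N w)\<bar> < 1"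
    using assms plane_code_bounds[of z] plane_code_bounds[of w] by linarith
  then have N: "?N z = ?N w" by linarith
  then have fl: "\<lfloor>Re z\<rfloor> = \<lfloor>Re w\<rfloor>" "\<lfloor>Im z\<rfloor> = \<lfloor>Im w\<rfloor>" by (auto dest: injD[OF inj_int_encode])
  have d3: "?d u k \<le> 3" for u k
    using binary_digit_le[of k "Re u"] binary_digit_le[of k "Im u"] by linarith
  have d_eq: "?d z k = ?d w k" if "k \<le> n" for k
    using assms N that by (intro digit_series_close[of "?d z" "?d w" n k] d3) (simp_all add: plane_code_def)
  have "binary_digit k (Re z) = binary_digit k (Re w) \<and> binary_digit k (Im z) = binary_digit k (Im w)"
    if "k < n" for k
  proof -
    have "?d z k = ?d w k" using that by (intro d_eq) simp
    then show ?thesis using binary_digit_le[of k "Re z"] binary_digit_le[of k "Re w"] by presburger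
  qed
  then have "\<bar>Re z - Re w\<bar> < 1 / 2 ^ n" "\<bar>Im z - Im w\<bar> < 1 / 2 ^ n"
    using binary_digits_eq_imp_close fl by blast+
  moreover have "dist z w \<le> \<bar>Re z - Re w\<bar> + \<bar>Im z - Im w\<bar>"
    using cmod_le[of "z - w"] by (simp add: dist_norm)
  moreover have "2 / 2 ^ n = 1 / 2 ^ n + (1 / 2 ^ n :: real)" by simp
  ultimately show ?thesis by linarith
qed

text \<open>A bounded set meets only finitely many unit squares.\<close>

lemma plane_code_bounded:
  assumes "bounded K"
  obtains R where "R > 0" "\<And>z. z \<in> K \<Longrightarrow> \<bar>plane_code z\<bar> < R"
proof -
  obtain B where B: "\<And>z. z \<in> K \<Longrightarrow> norm z \<le> B" using assms by (auto simp: bounded_iff)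
  define S where "S = (\<lambda>(i, j). prod_encode (int_encode i, int_encode j)) ` ({\<lfloor>-B\<rfloor>..\<lfloor>B\<rfloor>} \<times> {\<lfloor>-B\<rfloor>..\<lfloor>B\<rfloor>})"
  have "finite S" by (simp add: S_def)
  show ?thesis
  proof (rule that[of "8 * real (Max (insert 0 S)) + 4"])
    fix z assume "z \<in> K"
    then have "\<bar>Re z\<bar> \<le> B" "\<bar>Im z\<bar> \<le> B"
      using B abs_Re_le_cmod abs_Im_le_cmod order_trans by blast+
    then have "prod_encode (int_encode \<lfloor>Re z\<rfloor>, int_encode \<lfloor>Im z\<rfloor>) \<in> S"
      unfolding S_def by (intro image_eqI[where x="(\<lfloor>Re z\<rfloor>, \<lfloor>Im z\<rfloor>)"]) (auto intro!: floor_mono)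
    then have "prod_encode (int_encode \<lfloor>Re z\<rfloor>, int_encode \<lfloor>Im z\<rfloor>) \<le> Max (insert 0 S)"
      using \<open>finite S\<close> by (intro Max_ge) auto
    then show "\<bar>plane_code z\<bar> < 8 * real (Max (insert 0 S)) + 4"
      using plane_code_bounds[of z] by linarith
  qed auto
qed

text \<open>By \<open>plane_code_close\<close> the inverse is uniformly continuous on the range, so
  it extends to the closure of the range and, by Tietze, to the line.\<close>

lemma plane_code_section:
  obtains g :: "real \<Rightarrow> complex" where "continuous_on UNIV g" "\<And>z. g (plane_code z) = z"
proof -
  have inj: "inj plane_code"
  proof (rule injI)
    fix z w assume "plane_code z = plane_code w"
    then have *: "dist z w < 2 * (1/2) ^ n" for n using plane_code_close[of z w n] by (simp add: power_one_over)
    have "(\<lambda>n. 2 * (1/2::real) ^ n) \<longlonglongrightarrow> 2 * 0"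
      by (intro tendsto_intros LIMSEQ_power_zero) auto
    then have "dist z w \<le> 2 * 0"
      by (rule LIMSEQ_le_const) (use * less_imp_le in blast)
    then show "z = w" by simp
  qed
  have "uniformly_continuous_on (range plane_code) (inv plane_code)"
    unfolding uniformly_continuous_on_def
  proof safe
    fix e :: real assume "0 < e"
    then obtain n where n: "(1/2::real) ^ n < e/2"
      using real_arch_pow_inv[of "e/2" "1/2"] by auto
    show "\<exists>d>0. \<forall>x\<in>range plane_code. \<forall>x'\<in>range plane_code.
        dist x' x < d \<longrightarrow> dist (inv plane_code x') (inv plane_code x) < e"
    proof (intro exI[of _ "1 / (2 * 8 ^ n)"] conjI ballI impI)
      fix x x' assume "x \<in> range plane_code" "x' \<in> range plane_code" "dist x' x < 1 / (2 * 8 ^ n)"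
      then obtain z z' where z: "x = plane_code z" "x' = plane_code z'" "dist z' z < 2 / 2 ^ n"
        using plane_code_close by (auto simp: dist_real_def)
      have "2 / 2 ^ n < e" using n by (simp add: power_one_over field_simps)
      with z show "dist (inv plane_code x') (inv plane_code x) < e"
        by (simp add: inv_f_f[OF inj])
    qed simp
  qed
  from this obtain h where h: "uniformly_continuous_on (closure (range plane_code)) h"
    "\<And>x. x \<in> range plane_code \<Longrightarrow> inv plane_code x = h x"
    by (rule uniformly_continuous_on_extension_on_closure) blast
  obtain g where g: "continuous_on UNIV g" "\<And>x. x \<in> closure (range plane_code) \<Longrightarrow> g x = h x"
    by (rule Tietze_unbounded[OF uniformly_continuous_imp_continuous[OF h(1)], of UNIV]) auto
  have "g (plane_code z) = z" for z
    using g(2)[of "plane_code z"] h(2)[of "plane_code z"] closure_subset[of "range plane_code"] inv_f_f[OF inj]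
    by auto
  with g(1) show ?thesis by (rule that)
qed

text \<open>Prokhorov's theorem for discrete measures on the plane. The code transports the measures to the
  line, where Helly's selection theorem applies, and a continuous left inverse of the code brings the
  limit back.\<close>

theorem tight_pmf_imp_convergent_subsequence:
  fixes P :: "nat \<Rightarrow> complex pmf"
  assumes "\<And>\<epsilon>. \<epsilon> > 0 \<Longrightarrow> \<exists>K. compact K \<and> (\<forall>n. measure_pmf.prob (P n) K \<ge> 1 - \<epsilon>)"
  obtains M r where "prob_space M" "sets M = sets borel" "strict_mono (r :: nat \<Rightarrow> nat)"
    "\<And>\<phi> :: complex \<Rightarrow> complex. continuous_on UNIV \<phi> \<Longrightarrow> bounded (range \<phi>) \<Longrightarrow>
      (\<lambda>n. measure_pmf.expectation (P (r n)) \<phi>) \<longlonglongrightarrow> (\<integral>z. \<phi> z \<partial>M)"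
proof -
  obtain g :: "real \<Rightarrow> complex" where g: "continuous_on UNIV g" "\<And>z. g (plane_code z) = z"
    using plane_code_section by blast
  have [measurable]: "g \<in> borel_measurable borel"
    using g(1) by (rule borel_measurable_continuous_onI)
  define D where "D n = distr (measure_pmf (P n)) borel plane_code" for n
  have D: "real_distribution (D n)" for n
    by (intro real_distribution.intro real_distribution_axioms.intro)
       (auto simp: D_def intro: measure_pmf.prob_space_distr)
  have "tight D"
    unfolding tight_def
  proof (intro conjI allI impI)
    fix \<epsilon> :: real assume "0 < \<epsilon>"
    \<comment> \<open>\<open>tight\<close> demands a strict inequality, hence
      \<open>\<epsilon>/2\<close>.\<close>
    then obtain K where K: "compact K" "\<And>n. measure_pmf.prob (P n) K \<ge> 1 - \<epsilon>/2"
      using assms[of "\<epsilon>/2"] by auto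
    obtain R where R: "R > 0" "\<And>z. z \<in> K \<Longrightarrow> \<bar>plane_code z\<bar> < R"
      using plane_code_bounded[OF compact_imp_bounded[OF K(1)]] by blast
    show "\<exists>a b. a < b \<and> (\<forall>n. 1 - \<epsilon> < measure (D n) {a<..b})"
    proof (rule exI[of _ "-R"], rule exI[of _ R], intro conjI allI)
      fix n
      have "measure_pmf.prob (P n) K \<le> measure_pmf.prob (P n) (plane_code -` {-R<..R})"
        using R(2) by (intro measure_pmf.finite_measure_mono) (fastforce simp: abs_less_iff)+
      also have "\<dots> = measure (D n) {-R<..R}"
        by (simp add: D_def measure_distr)
      finally show "1 - \<epsilon> < measure (D n) {-R<..R}" using K(2)[of n] \<open>0 < \<epsilon>\<close> by simp
    qed (use R in auto)
  qed (rule D)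
  then obtain r M where r: "strict_mono r" and M: "real_distribution M" "weak_conv_m (D \<circ> id \<circ> r) M"
    using tight_imp_convergent_subsubsequence[of D id] strict_mono_id by blast
  interpret M: real_distribution M by fact
  interpret D: real_distribution "D n" for n by (rule D)
  show ?thesis
  proof (rule that[of "distr M borel g" r])
    show "prob_space (distr M borel g)" by (intro M.prob_space_distr) simp
    fix \<phi> :: "complex \<Rightarrow> complex" assume \<phi>: "continuous_on UNIV \<phi>" "bounded (range \<phi>)"
    have [measurable]: "\<phi> \<in> borel_measurable borel"
      using \<phi>(1) by (rule borel_measurable_continuous_onI)
    obtain B where B: "\<And>x. norm (\<phi> x) \<le> B" using \<phi>(2) by (auto simp: bounded_iff)
    \<comment> \<open>On the line the test function is \<open>\<phi>\<close> after \<open>g\<close>: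
      it is continuous, and composed with the code it is \<open>\<phi>\<close> again.\<close>
    have "continuous_on UNIV (\<lambda>x. \<phi> (g x))"
      using continuous_on_compose2[OF \<phi>(1) g(1)] by auto
    then have "(\<lambda>n. \<integral>x. \<phi> (g x) \<partial>((D \<circ> id \<circ> r) n)) \<longlonglongrightarrow> (\<integral>x. \<phi> (g x) \<partial>M)"
      using B by (intro weak_conv_imp_integral_bdd_continuous_conv[OF _ M(1) M(2)])
        (auto simp: continuous_on_eq_continuous_at D)
    moreover have "(\<integral>x. \<phi> (g x) \<partial>((D \<circ> id \<circ> r) n)) = measure_pmf.expectation (P (r n)) \<phi>" for n
      unfolding D_def comp_def id_def by (subst integral_distr) (auto simp: g(2))
    moreover have "(\<integral>x. \<phi> (g x) \<partial>M) = (\<integral>z. \<phi> z \<partial>distr M borel g)"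
      by (subst integral_distr) auto
    ultimately show "(\<lambda>n. measure_pmf.expectation (P (r n)) \<phi>) \<longlonglongrightarrow> (\<integral>z. \<phi> z \<partial>distr M borel g)"
      by simp
  qed (auto simp: r)
qed

section \<open>The Markov kernel of a weight function\<close>

lemma entire_eventually_ne:
  assumes "f holomorphic_on UNIV" "surj f"
  shows "\<forall>\<^sub>F u in at z. f u - f z \<noteq> (0::complex)"
proof -
  \<comment> \<open>Surjectivity provides a value other than \<open>f z\<close>, so \<open>f\<close>
    is nonconstant and the zero at \<open>z\<close> is isolated.\<close>
  obtain \<beta> where \<beta>: "f \<beta> = f z + 1" using \<open>surj f\<close> by (metis surjD)
  obtain r where r: "0 < r" "\<And>u. u \<in> ball z r - {z} \<Longrightarrow> f u - f z \<noteq> 0"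
  proof (rule isolated_zeros[of "\<lambda>u. f u - f z" UNIV z \<beta>])
    show "(\<lambda>u. f u - f z) holomorphic_on UNIV" by (intro holomorphic_intros assms)
  qed (use \<beta> in auto)
  then show ?thesis
    by (auto simp: eventually_at dist_commute intro!: exI[of _ r])
qed

lemma entire_analytic:
  assumes "f holomorphic_on UNIV"
  shows "(\<lambda>u. f u - c) analytic_on {z}"
  using assms by (auto simp: analytic_at intro!: exI[of _ UNIV] holomorphic_intros)

lemma zorder_entire_pos:
  assumes "f holomorphic_on UNIV" "surj f"
  shows "zorder (\<lambda>u. f u - f z) z > 0"
  using zorder_pos_iff'[OF entire_analytic[OF assms(1), of "f z" z]]
    eventually_frequently[OF at_neq_bot entire_eventually_ne[OF assms, of z]] by simp

lemma mult_pos: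
  assumes "f holomorphic_on UNIV" "surj f"
  shows "mult f z > 0"
  using zorder_entire_pos[OF assms, of z] by (simp add: mult_def)

text \<open>Orders of zeros multiply under composition. This is why iterating a kernel weighted by
  \<open>mult f\<close> counts preimages with the multiplicity of \<open>f ^^ n\<close>, as
  \<open>Q_measure\<close> does.\<close>

lemma mult_compose:
  assumes "f holomorphic_on UNIV" "surj f" "g holomorphic_on UNIV" "surj g"
  shows "mult (f \<circ> g) z = mult f (g z) * mult g z"
proof -
  let ?f = "\<lambda>u. f u - f (g z)"
  have an: "?f analytic_on {g z}" by (rule entire_analytic[OF assms(1)])
  have "\<forall>\<^sub>F w in at z. g w \<noteq> g z"
    using entire_eventually_ne[OF assms(3,4), of z] by simp
  then have "zorder (?f \<circ> g) z = zorder ?f (g z) * zorder (\<lambda>x. g x - g z) z"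
    using an assms entire_eventually_ne[OF assms(1,2), of "g z"] entire_analytic[OF assms(3), of 0 z]
    by (intro zorder_compose') (auto intro: isolated_singularity_at_analytic not_essential_analytic)
  moreover have "(\<lambda>u. (f \<circ> g) u - (f \<circ> g) z) = ?f \<circ> g" by auto
  ultimately show ?thesis
    using zorder_entire_pos[OF assms(1,2), of "g z"] zorder_entire_pos[OF assms(3,4), of z]
    unfolding mult_def by (simp add: nat_mult_distrib)
qed

text \<open>Serves the identity, which is the zeroth iterate, and a repelling fixed point, where the
  derivative does not vanish.\<close>

lemma mult_eq_1:
  assumes "f holomorphic_on UNIV" "deriv f z \<noteq> 0"
  shows "mult f z = 1"
proof -
  have "deriv (\<lambda>u. f u - f z) z = deriv f z"
    using holomorphic_derivI[OF assms(1)] by (intro DERIV_imp_deriv derivative_eq_intros) auto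
  then have "zorder (\<lambda>u. f u - f z) z = 1"
    using assms by (intro zorder_zero_eqI[of _ UNIV]) (auto intro!: holomorphic_intros)
  then show ?thesis by (simp add: mult_def)
qed

text \<open>The law of one backward step from \<open>w\<close>. A multiple preimage is a single atom
  with its multiplicity in the mass, and the weight condition says that the total mass is
  one.\<close>

definition preimage_pmf :: "(complex \<Rightarrow> complex) \<Rightarrow> (complex \<Rightarrow> real) \<Rightarrow> complex \<Rightarrow> complex pmf" where
  "preimage_pmf f Q w = embed_pmf (\<lambda>z. if f z = w then real (mult f z) * Q z else 0)"

abbreviation transfer_kernel ::
  "(complex \<Rightarrow> complex) \<Rightarrow> (complex \<Rightarrow> real) \<Rightarrow> nat \<Rightarrow> complex \<Rightarrow> complex pmf" where
  "transfer_kernel f Q \<equiv> kernel_iter (preimage_pmf f Q)"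

section \<open>Iterated transfer operators as expectations\<close>

locale entire_weight =
  fixes f :: "complex \<Rightarrow> complex" and Q :: "complex \<Rightarrow> real"
  assumes holomorphic: "f holomorphic_on UNIV" and surj: "surj f"
    and weight: "weight_function f Q"
begin

lemma Q_nonneg: "0 \<le> Q z"
  using weight by (auto simp: weight_function_def)

lemma continuous_funpow: "continuous_on UNIV (f ^^ n)"
proof (induction n)
  case (Suc n)
  have "continuous_on UNIV (f \<circ> f ^^ n)"
    using Suc holomorphic_on_imp_continuous_on[OF holomorphic]
    by (intro continuous_on_compose) (auto intro: continuous_on_subset)
  then show ?case by simp
qed (simp add: id_def)

lemma holomorphic_funpow: "(f ^^ n) holomorphic_on UNIV"
proof (induction n)
  case (Suc n)
  have "(f \<circ> f ^^ n) holomorphic_on UNIV"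
    using Suc holomorphic_on_subset[OF holomorphic] by (intro holomorphic_on_compose) auto
  then show ?case by (simp add: comp_def)
qed (auto simp: id_def intro: holomorphic_on_ident)

lemma surj_funpow: "surj (f ^^ n)"
proof (induction n)
  case (Suc n)
  then have "surj (f \<circ> f ^^ n)" using surj by (rule comp_surj)
  then show ?case by simp
qed simp

text \<open>The point is total mass one: the sum in the weight condition has nonnegative terms,
  hence converges absolutely, and becomes an integral for the counting measure.\<close>

lemma pmf_preimage_pmf:
  "pmf (preimage_pmf f Q w) z = (if f z = w then real (mult f z) * Q z else 0)"
  unfolding preimage_pmf_def
proof (rule pmf_embed_pmf)
  let ?h = "\<lambda>z. real (mult f z) * Q z"
  let ?A = "f -` {w}"
  have sum: "(?h has_sum 1) ?A" using weight by (simp add: weight_function_def)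
  have nonneg: "0 \<le> ?h z" for z using Q_nonneg by simp
  have "?h summable_on ?A" using sum by (rule has_sum_imp_summable)
  then have abs: "Infinite_Set_Sum.abs_summable_on ?h ?A"
    using nonneg by (simp add: abs_summable_equivalent[symmetric] abs_of_nonneg)
  then have "infsetsum ?h ?A = 1" using infsumI[OF sum] by (simp add: infsetsum_infsum)
  then have "(\<integral>\<^sup>+z. ennreal (?h z) \<partial>count_space ?A) = ennreal 1"
    using abs nonneg unfolding infsetsum_def Infinite_Set_Sum.abs_summable_on_def
    by (subst nn_integral_eq_integral) auto
  moreover have "(\<integral>\<^sup>+z. ennreal (if f z = w then ?h z else 0) \<partial>count_space UNIV) =
      (\<integral>\<^sup>+z. ennreal (?h z) * indicator ?A z \<partial>count_space UNIV)"
    by (intro nn_integral_cong) (auto split: split_indicator)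
  ultimately show "(\<integral>\<^sup>+z. ennreal (if f z = w then ?h z else 0) \<partial>count_space UNIV) = 1"
    by (simp add: nn_integral_count_space_indicator)
qed (use Q_nonneg in auto)

lemma transfer_eq_expectation:
  assumes "bounded (range \<phi>)"
  shows "transfer f Q \<phi> w = measure_pmf.expectation (preimage_pmf f Q w) \<phi>"
proof -
  let ?p = "preimage_pmf f Q w"
  let ?A = "f -` {w}"
  have eq: "indicator ?A z *\<^sub>R (of_nat (mult f z) * of_real (Q z) * \<phi> z) = pmf ?p z *\<^sub>R \<phi> z" for z
    by (auto simp: pmf_preimage_pmf scaleR_conv_of_real split: split_indicator)
  have "integrable (measure_pmf ?p) \<phi>" using assms by (rule integrable_pmf_bounded)
  then have "integrable (count_space UNIV) (\<lambda>z. pmf ?p z *\<^sub>R \<phi> z)"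
    by (simp add: measure_pmf_eq_density integrable_density)
  then have "Infinite_Set_Sum.abs_summable_on (\<lambda>z. of_nat (mult f z) * of_real (Q z) * \<phi> z) ?A"
    unfolding abs_summable_on_altdef set_integrable_def eq .
  then have "transfer f Q \<phi> w = infsetsum (\<lambda>z. of_nat (mult f z) * of_real (Q z) * \<phi> z) ?A"
    by (simp add: transfer_def infsetsum_infsum)
  also have "\<dots> = (\<integral>z. pmf ?p z *\<^sub>R \<phi> z \<partial>count_space UNIV)"
    unfolding infsetsum_altdef set_lebesgue_integral_def eq ..
  also have "\<dots> = measure_pmf.expectation ?p \<phi>"
    by (simp add: measure_pmf_eq_density integral_density)
  finally show ?thesis .
qed

lemma transfer_funpow_eq_expectation:
  assumes "bounded (range \<phi>)"
  shows "(transfer f Q ^^ n) \<phi> w = measure_pmf.expectation (transfer_kernel f Q n w) \<phi>"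
proof (induction n arbitrary: w)
  case (Suc n)
  have "(transfer f Q ^^ n) \<phi> = (\<lambda>w. measure_pmf.expectation (transfer_kernel f Q n w) \<phi>)"
    using Suc by blast
  then show ?case
    by (simp add: transfer_eq_expectation bounded_range_expectation assms expectation_bind_pmf_complex)
qed simp

text \<open>A chain at \<open>z\<close> after \<open>Suc n\<close> steps was at
  \<open>(f ^^ n) z\<close> after its first step, so \<open>bind\<close> contributes a single term.
  Multiplicities and weights then multiply along the orbit.\<close>

lemma pmf_transfer_kernel:
  "pmf (transfer_kernel f Q n w) z =
    (if (f ^^ n) z = w then real (mult (f ^^ n) z) * Q_iter f Q n z else 0)"
proof (induction n arbitrary: w)
  case 0
  have "mult id z = 1" by (rule mult_eq_1) (auto simp: id_def intro: holomorphic_on_ident)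
  then show ?case by (auto simp: Q_iter_def id_def)
next
  case (Suc n)
  define y where "y = (f ^^ n) z"
  define c where "c = real (mult (f ^^ n) z) * Q_iter f Q n z"
  have "pmf (transfer_kernel f Q (Suc n) w) z =
      measure_pmf.expectation (preimage_pmf f Q w) (\<lambda>x. c * indicator {y} x)"
    unfolding kernel_iter.simps pmf_bind Suc y_def c_def
    by (intro Bochner_Integration.integral_cong) (auto split: split_indicator)
  also have "\<dots> = c * pmf (preimage_pmf f Q w) y"
    by (simp add: measure_pmf_single)
  also have "\<dots> = (if f y = w then (real (mult f y) * real (mult (f ^^ n) z)) * (Q_iter f Q n z * Q y) else 0)"
    by (simp add: pmf_preimage_pmf c_def)
  also have "Q_iter f Q n z * Q y = Q_iter f Q (Suc n) z"
    by (simp add: Q_iter_def y_def)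
  also have "real (mult f y) * real (mult (f ^^ n) z) = real (mult (f ^^ Suc n) z)"
    using mult_compose[OF holomorphic surj holomorphic_funpow[of n] surj_funpow, of z]
    by (simp add: y_def)
  finally show ?case by (simp add: y_def)
qed

lemma Q_iter_nonneg: "0 \<le> Q_iter f Q n z"
  unfolding Q_iter_def by (intro prod_nonneg) (simp add: Q_nonneg)

lemma set_transfer_kernel:
  "set_pmf (transfer_kernel f Q n w) = {z. (f ^^ n) z = w \<and> 0 < Q_iter f Q n z}"
proof (rule set_eqI)
  fix z
  have "0 < mult (f ^^ n) z" by (rule mult_pos[OF holomorphic_funpow surj_funpow])
  moreover have "0 < Q_iter f Q n z \<longleftrightarrow> Q_iter f Q n z \<noteq> 0"
    using Q_iter_nonneg[of n z] by linarith
  ultimately show "z \<in> set_pmf (transfer_kernel f Q n w) \<longleftrightarrow> z \<in> {z. (f ^^ n) z = w \<and> 0 < Q_iter f Q n z}"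
    by (simp add: set_pmf_iff pmf_transfer_kernel)
qed

lemma Q_measure_eq_distr:
  "Q_measure f Q n w = distr (measure_pmf (transfer_kernel f Q n w)) borel (\<lambda>z. z)"
proof (rule measure_eqI)
  fix B assume "B \<in> sets (Q_measure f Q n w)"
  then have B: "B \<in> sets borel" by (simp add: Q_measure_def)
  let ?A = "(f ^^ n) -` {w}"
  let ?h = "\<lambda>z. ennreal (real (mult (f ^^ n) z) * Q_iter f Q n z)"
  have "emeasure (Q_measure f Q n w) B = emeasure (point_measure ?A ?h) (B \<inter> ?A)"
    unfolding Q_measure_def
    using B by (subst emeasure_distr) (auto simp: space_point_measure sets_point_measure measurable_def)
  also have "\<dots> = (\<integral>\<^sup>+z. ?h z * indicator (B \<inter> ?A) z \<partial>count_space ?A)"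
    unfolding point_measure_def by (subst emeasure_density) auto
  also have "\<dots> = (\<integral>\<^sup>+z. ?h z * indicator (B \<inter> ?A) z * indicator ?A z \<partial>count_space UNIV)"
    by (subst nn_integral_count_space_indicator) auto
  also have "\<dots> = (\<integral>\<^sup>+z. ennreal (pmf (transfer_kernel f Q n w) z) * indicator B z \<partial>count_space UNIV)"
    by (intro nn_integral_cong) (auto simp: pmf_transfer_kernel split: split_indicator)
  also have "\<dots> = (\<integral>\<^sup>+z. indicator B z \<partial>measure_pmf (transfer_kernel f Q n w))"
    by (simp only: nn_integral_measure_pmf)
  also have "\<dots> = emeasure (distr (measure_pmf (transfer_kernel f Q n w)) borel (\<lambda>z. z)) B"
    using B by (simp add: emeasure_distr)
  finally show "emeasure (Q_measure f Q n w) B =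
    emeasure (distr (measure_pmf (transfer_kernel f Q n w)) borel (\<lambda>z. z)) B" .
qed (simp add: Q_measure_def)

end

lemma equicontinuous_kernelI:
  assumes "f holomorphic_on UNIV" "surj f" "weight_function f Q" "weakly_continuous f Q"
    "normal_weight f Q" "tight_weight f Q" "expands_over_compacts f Q p"
  shows "equicontinuous_kernel (preimage_pmf f Q) p"
proof -
  interpret entire_weight f Q using assms by unfold_locales
  show ?thesis
  proof
    fix \<phi> :: "complex \<Rightarrow> complex" assume \<phi>: "continuous_on UNIV \<phi>" "bounded (range \<phi>)"
    then have Cb: "\<phi> \<in> Cb UNIV" by (simp add: Cb_def)
    then have "continuous_on UNIV (transfer f Q \<phi>)"
      using assms(4) by (simp add: weakly_continuous_def)
    moreover have "transfer f Q \<phi> = (\<lambda>w. measure_pmf.expectation (preimage_pmf f Q w) \<phi>)"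
      using transfer_eq_expectation[OF \<phi>(2)] by blast
    ultimately show "continuous_on UNIV (\<lambda>w. measure_pmf.expectation (preimage_pmf f Q w) \<phi>)" by simp
    show "\<exists>\<delta>>0. \<forall>n w'. dist w' w < \<delta> \<longrightarrow> dist (measure_pmf.expectation (transfer_kernel f Q n w') \<phi>)
        (measure_pmf.expectation (transfer_kernel f Q n w) \<phi>) < \<epsilon>" if "\<epsilon> > 0" for w \<epsilon>
    proof -
      have "\<exists>\<delta>>0. \<forall>n. \<forall>w'. dist w' w < \<delta> \<longrightarrow>
          dist ((transfer f Q ^^ n) \<phi> w') ((transfer f Q ^^ n) \<phi> w) < \<epsilon>"
        using assms(5) Cb that unfolding normal_weight_def by simp
      then show ?thesis by (simp only: transfer_funpow_eq_expectation[OF \<phi>(2)])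
    qed
  next
    fix \<epsilon> :: real assume "0 < \<epsilon>"
    then obtain K where K: "compact K" "\<And>w. \<exists>n0. \<forall>n\<ge>n0. measure (Q_measure f Q n w) K \<ge> 1 - \<epsilon>"
      using assms(6) unfolding tight_weight_def by blast
    have "measure (Q_measure f Q n w) K = measure_pmf.prob (transfer_kernel f Q n w) K" for n w
      using compact_imp_closed[OF K(1)] by (simp add: Q_measure_eq_distr measure_distr)
    then show "\<exists>K. compact K \<and> (\<forall>w. \<exists>n0. \<forall>n\<ge>n0. 1 - \<epsilon> \<le> measure_pmf.prob (transfer_kernel f Q n w) K)"
      using K by auto
  next
    fix r :: real and K :: "complex set" assume "0 < r" "compact K"
    then obtain n where "\<forall>w\<in>K. \<exists>z\<in>ball p r. (f ^^ n) z = w \<and> Q_iter f Q n z > 0"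
      using assms(7) unfolding expands_over_compacts_def by blast
    then show "\<exists>n. \<forall>w\<in>K. set_pmf (transfer_kernel f Q n w) \<inter> ball p r \<noteq> {}"
      unfolding set_transfer_kernel by blast
  qed
qed

section \<open>Borel measures and continuous test functions\<close>

text \<open>Continuous functions tending to the indicator of a closed set. The empty set is separate
  because \<open>infdist z {}\<close> is 0, which would give the constant 1.\<close>

definition closed_approx :: "'a::metric_space set \<Rightarrow> nat \<Rightarrow> 'a \<Rightarrow> real" where
  "closed_approx F n z = (if F = {} then 0 else max 0 (1 - real n * infdist z F))"

lemma closed_approx_bounds: "0 \<le> closed_approx F n z" "closed_approx F n z \<le> 1"
  by (auto simp: closed_approx_def infdist_nonneg)

lemma continuous_on_closed_approx: "continuous_on S (closed_approx F n)"
  unfolding closed_approx_def by (cases "F = {}") (auto intro!: continuous_intros)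

lemma closed_approx_tendsto:
  assumes "closed F"
  shows "(\<lambda>n. closed_approx F n z) \<longlonglongrightarrow> indicator F z"
proof (cases "z \<in> F")
  case True
  then have "closed_approx F n z = 1" for n by (auto simp: closed_approx_def)
  with True show ?thesis by simp
next
  case False
  have "\<forall>\<^sub>F n in sequentially. closed_approx F n z = 0"
  proof (cases "F = {}")
    case False
    with \<open>z \<notin> F\<close> have "infdist z F > 0"
      using infdist_pos_not_in_closed[OF assms] by blast
    then obtain N where N: "1 < real N * infdist z F" using ex_less_of_nat_mult by blast
    show ?thesis
    proof (rule eventually_sequentiallyI)
      fix n assume "N \<le> n"
      then have "real N * infdist z F \<le> real n * infdist z F"
        by (intro mult_right_mono infdist_nonneg) auto
      with N show "closed_approx F n z = 0" by (auto simp: closed_approx_def)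
    qed
  qed (simp add: closed_approx_def)
  then have "(\<lambda>n. closed_approx F n z) \<longlonglongrightarrow> 0" by (rule tendsto_eventually)
  then show ?thesis using False by simp
qed

lemma integral_closed_approx_tendsto:
  fixes F :: "'a::metric_space set"
  assumes "prob_space M" "sets M = sets borel" "closed F"
  shows "(\<lambda>n. \<integral>z. closed_approx F n z \<partial>M) \<longlonglongrightarrow> measure M F"
proof -
  interpret prob_space M by fact
  have m: "g \<in> borel_measurable M" if "continuous_on UNIV g" for g :: "'a \<Rightarrow> real"
    using borel_measurable_continuous_onI[OF that] assms(2) by (simp cong: measurable_cong_sets)
  have F: "F \<in> sets M" using assms by simp
  have "(\<lambda>n. \<integral>z. closed_approx F n z \<partial>M) \<longlonglongrightarrow> (\<integral>z. indicator F z \<partial>M)"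
  proof (rule integral_dominated_convergence[where w="\<lambda>_. 1"])
    show "closed_approx F n \<in> borel_measurable M" for n by (intro m continuous_on_closed_approx)
    show "AE x in M. (\<lambda>n. closed_approx F n x) \<longlonglongrightarrow> indicator F x"
      using closed_approx_tendsto[OF assms(3)] by simp
    show "AE x in M. norm (closed_approx F n x) \<le> 1" for n
      using closed_approx_bounds[of F n] by (intro AE_I2) auto
  qed (use F in auto)
  then show ?thesis using F by simp
qed

text \<open>\<open>closed_approx\<close> recovers the measure of closed sets, and these form an
  intersection-stable generator of the Borel sets.\<close>

lemma prob_measure_eqI_continuous:
  fixes M N :: "'a::metric_space measure"
  assumes M: "prob_space M" "sets M = sets borel" and N: "prob_space N" "sets N = sets borel"
    and eq: "\<And>\<phi>::'a \<Rightarrow> real. continuous_on UNIV \<phi> \<Longrightarrow> bounded (range \<phi>) \<Longrightarrow> (\<integral>z. \<phi> z \<partial>M) = (\<integral>z. \<phi> z \<partial>N)"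
  shows "M = N"
proof -
  interpret M: prob_space M by fact
  interpret N: prob_space N by fact
  show ?thesis
  proof (rule measure_eqI_generator_eq[where \<Omega>=UNIV and E="Collect closed" and A="\<lambda>_. UNIV"])
    fix F :: "'a set" assume "F \<in> Collect closed"
    then have F: "closed F" by simp
    have "(\<integral>z. closed_approx F n z \<partial>M) = (\<integral>z. closed_approx F n z \<partial>N)" for n
      using closed_approx_bounds[of F n]
      by (intro eq continuous_on_closed_approx) (auto simp: bounded_iff intro!: exI[of _ 1])
    then have "measure M F = measure N F"
      using integral_closed_approx_tendsto[OF M F] integral_closed_approx_tendsto[OF N F]
      by (auto intro: LIMSEQ_unique)
    then show "emeasure M F = emeasure N F"
      by (simp add: M.emeasure_eq_measure N.emeasure_eq_measure)
  qed (use M N in \<open>auto simp: Int_stable_def borel_eq_closed sets_measure_of M.emeasure_eq_measure\<close>)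
qed

lemma abs_indicator_diff_le: "0 \<le> a \<Longrightarrow> a \<le> 1 \<Longrightarrow> \<bar>indicator A z - a\<bar> \<le> (1 :: real)"
  by (auto split: split_indicator)

text \<open>Inner regularity gives compact subsets of \<open>A\<close> and of its complement that
  together miss mass less than \<open>\<epsilon>\<close>. A Urysohn function separating them errs
  only outside both.\<close>

lemma indicator_approx_continuous:
  fixes M :: "'a::euclidean_space measure"
  assumes M: "prob_space M" "sets M = sets borel" and A: "A \<in> sets borel" and "0 < \<epsilon>"
  obtains \<phi> :: "'a \<Rightarrow> real" where "continuous_on UNIV \<phi>" "\<And>z. 0 \<le> \<phi> z" "\<And>z. \<phi> z \<le> 1"
    "(\<integral>z. \<bar>indicator A z - \<phi> z\<bar> \<partial>M) \<le> \<epsilon>"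
proof -
  interpret prob_space M by fact
  have sp: "space M = UNIV" using sets_eq_imp_space_eq[OF M(2)] by simp
  have inner: "\<exists>K. K \<subseteq> B \<and> compact K \<and> measure M B < measure M K + \<epsilon>/2" if B: "B \<in> sets borel" for B
  \<comment> \<open>The split keeps \<open>measure M B - \<epsilon>/2\<close> nonnegative in the
    main case, since \<open>ennreal\<close> truncates negative numbers to 0.\<close>
  proof (cases "measure M B < \<epsilon>/2")
    case True
    then show ?thesis by (intro exI[of _ "{}"]) auto
  next
    case False
    have "ennreal (measure M B - \<epsilon>/2) < ennreal (measure M B)"
      using False \<open>0 < \<epsilon>\<close> by (intro ennreal_lessI) auto
    also have "\<dots> = (SUP K \<in> {K. K \<subseteq> B \<and> compact K}. emeasure M K)"
      using inner_regular[OF M(2) _ B] by (simp add: emeasure_eq_measure)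
    finally obtain K where K: "K \<subseteq> B" "compact K" "ennreal (measure M B - \<epsilon>/2) < emeasure M K"
      by (auto simp: less_SUP_iff)
    then have "measure M B - \<epsilon>/2 < measure M K"
      using False by (simp add: emeasure_eq_measure ennreal_less_iff)
    with K show ?thesis by (intro exI[of _ K]) auto
  qed
  obtain K where K: "K \<subseteq> A" "compact K" "measure M A < measure M K + \<epsilon>/2" using inner[OF A] by blast
  have "- A \<in> sets borel" using A by auto
  then obtain C where C: "C \<subseteq> - A" "compact C" "measure M (- A) < measure M C + \<epsilon>/2" using inner by blast
  have disj: "K \<inter> C = {}" using K C by blast
  obtain \<phi> :: "'a \<Rightarrow> real" where \<phi>: "continuous_on UNIV \<phi>" "\<And>x. \<phi> x \<in> closed_segment 1 0"
    "\<And>x. x \<in> K \<Longrightarrow> \<phi> x = 1" "\<And>x. x \<in> C \<Longrightarrow> \<phi> x = 0"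
    using Urysohn_local[of UNIV K C "1::real" 0] compact_imp_closed K(2) C(2) disj
    by (metis UNIV_I closed_closedin subtopology_UNIV)
  have \<phi>01: "0 \<le> \<phi> z" "\<phi> z \<le> 1" for z
    using \<phi>(2)[of z] by (auto simp: closed_segment_eq_real_ivl)
  have [measurable]: "\<phi> \<in> borel_measurable M"
    using borel_measurable_continuous_onI[OF \<phi>(1)] M(2) by (simp cong: measurable_cong_sets)
  have sets: "A \<in> sets M" "K \<in> sets M" "C \<in> sets M"
    using A K(2) C(2) M(2) by (auto simp: compact_imp_closed)
  show ?thesis
  proof (rule that[OF \<phi>(1) \<phi>01])
    have "(\<integral>z. \<bar>indicator A z - \<phi> z\<bar> \<partial>M) \<le> (\<integral>z. indicator (- (K \<union> C)) z \<partial>M)"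
    proof (rule integral_mono)
      show "integrable M (\<lambda>z. \<bar>indicator A z - \<phi> z\<bar>)"
        using sets \<phi>01
        by (intro integrable_const_bound[where B=1] AE_I2) (auto intro: abs_indicator_diff_le)
      show "integrable M (\<lambda>z. indicator (- (K \<union> C)) z :: real)"
        using sets sp by (intro integrable_const_bound[where B=1]) (auto simp: Compl_eq_Diff_UNIV)
      show "\<bar>indicator A z - \<phi> z\<bar> \<le> indicator (- (K \<union> C)) z" for z
        using \<phi>(3,4)[of z] \<phi>01[of z] K(1) C(1) by (auto simp: abs_le_iff split: split_indicator)
    qed
    also have "\<dots> = measure M (- (K \<union> C))"
      using sets sp by (simp add: Compl_eq_Diff_UNIV)
    also have "\<dots> = 1 - (measure M K + measure M C)"
      using prob_compl[of "K \<union> C"] finite_measure_Union[of K C] sets disj sp by (simp add: Compl_eq_Diff_UNIV)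
    also have "\<dots> \<le> \<epsilon>"
      using prob_compl[of A] sets sp K(3) C(3) by (simp add: Compl_eq_Diff_UNIV)
    finally show "(\<integral>z. \<bar>indicator A z - \<phi> z\<bar> \<partial>M) \<le> \<epsilon>" .
  qed
qed

section \<open>Mixing from correlations of continuous functions\<close>

lemma invariant_integral_funpow:
  fixes g :: "'a \<Rightarrow> real"
  assumes T: "T \<in> measurable M M" "distr M M T = M" and g: "g \<in> borel_measurable M"
  shows "(\<integral>z. g ((T ^^ n) z) \<partial>M) = (\<integral>z. g z \<partial>M)"
proof (induction n)
  case (Suc n)
  have [measurable]: "(T ^^ n) \<in> measurable M M" using T(1) by (rule measurable_compose_n)
  have "(\<integral>z. g ((T ^^ Suc n) z) \<partial>M) = (\<integral>z. g ((T ^^ n) (T z)) \<partial>M)"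
    by (simp add: funpow_swap1)
  also have "\<dots> = (\<integral>z. g ((T ^^ n) z) \<partial>distr M M T)"
    using T(1) g by (subst integral_distr) auto
  finally show ?case using Suc T(2) by simp
qed simp

text \<open>Both indicators are replaced by continuous functions close to them in the mean. By
  invariance the error at \<open>(T ^^ n) z\<close> has the same mean as the error at
  \<open>z\<close>, so the replacement is uniform in \<open>n\<close>.\<close>

lemma mixing_from_continuous:
  fixes M :: "'a::euclidean_space measure"
  assumes M: "prob_space M" "sets M = sets borel"
    and T: "T \<in> measurable M M" "distr M M T = M"
    and correlations: "\<And>\<phi> \<psi>::'a \<Rightarrow> real. continuous_on UNIV \<phi> \<Longrightarrow> bounded (range \<phi>) \<Longrightarrow>
        continuous_on UNIV \<psi> \<Longrightarrow> bounded (range \<psi>) \<Longrightarrow>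
        (\<lambda>n. \<integral>z. \<phi> ((T ^^ n) z) * \<psi> z \<partial>M) \<longlonglongrightarrow> (\<integral>z. \<phi> z \<partial>M) * (\<integral>z. \<psi> z \<partial>M)"
    and A: "A \<in> sets borel" and B: "B \<in> sets borel"
  shows "(\<lambda>n. measure M ((T ^^ n) -` A \<inter> B)) \<longlonglongrightarrow> measure M A * measure M B"
proof (rule LIMSEQ_I)
  interpret prob_space M by fact
  fix e :: real assume "0 < e"
  \<comment> \<open>Spent as \<open>2 * \<epsilon>\<close> on the correlation,
    \<open>2 * \<epsilon>\<close> on the product of the means and \<open>\<epsilon>\<close> on the
    limit.\<close>
  define \<epsilon> where "\<epsilon> = e / 5"
  have \<epsilon>: "0 < \<epsilon>" using \<open>0 < e\<close> by (simp add: \<epsilon>_def)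
  have sp: "space M = UNIV" using sets_eq_imp_space_eq[OF M(2)] by simp
  obtain \<phi> :: "'a \<Rightarrow> real" where \<phi>: "continuous_on UNIV \<phi>" "\<And>z. 0 \<le> \<phi> z" "\<And>z. \<phi> z \<le> 1"
    "(\<integral>z. \<bar>indicator A z - \<phi> z\<bar> \<partial>M) \<le> \<epsilon>"
    using indicator_approx_continuous[OF M A \<epsilon>] by blast
  obtain \<psi> :: "'a \<Rightarrow> real" where \<psi>: "continuous_on UNIV \<psi>" "\<And>z. 0 \<le> \<psi> z" "\<And>z. \<psi> z \<le> 1"
    "(\<integral>z. \<bar>indicator B z - \<psi> z\<bar> \<partial>M) \<le> \<epsilon>"
    using indicator_approx_continuous[OF M B \<epsilon>] by blast
  have [measurable]: "\<phi> \<in> borel_measurable M" "\<psi> \<in> borel_measurable M" "A \<in> sets M" "B \<in> sets M"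
    using borel_measurable_continuous_onI[OF \<phi>(1)] borel_measurable_continuous_onI[OF \<psi>(1)] A B M(2)
    by (simp_all cong: measurable_cong_sets)
  have [measurable]: "(T ^^ n) \<in> measurable M M" for n using T(1) by (rule measurable_compose_n)
  have int: "integrable M g" if "g \<in> borel_measurable M" "\<And>z. \<bar>g z\<bar> \<le> 1" for g :: "'a \<Rightarrow> real"
    using that by (intro integrable_const_bound[where B=1] AE_I2) auto
  have prod_le: "\<bar>a * b - c * d\<bar> \<le> \<bar>a - c\<bar> + \<bar>b - d\<bar>"
    if "0 \<le> b" "b \<le> 1" "0 \<le> c" "c \<le> 1" for a b c d :: real
  proof -
    have "a * b - c * d = (a - c) * b + c * (b - d)" by (simp add: algebra_simps)
    also have "\<bar>\<dots>\<bar> \<le> \<bar>a - c\<bar> * \<bar>b\<bar> + \<bar>c\<bar> * \<bar>b - d\<bar>"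
      using abs_triangle_ineq[of "(a - c) * b" "c * (b - d)"] by (simp add: abs_mult)
    also have "\<dots> \<le> \<bar>a - c\<bar> * 1 + 1 * \<bar>b - d\<bar>"
      using that by (intro add_mono mult_left_mono mult_right_mono) auto
    finally show ?thesis by simp
  qed
  have close: "\<bar>measure M ((T ^^ n) -` A \<inter> B) - (\<integral>z. \<phi> ((T ^^ n) z) * \<psi> z \<partial>M)\<bar> \<le> 2 * \<epsilon>" for n
  proof -
    have [measurable]: "(T ^^ n) -` A \<in> sets M"
      using measurable_sets[of "T ^^ n" M M A] sp by simp
    have i1: "integrable M (\<lambda>z. indicator A ((T ^^ n) z) * indicator B z :: real)"
      by (intro int) (auto split: split_indicator)
    have i2: "integrable M (\<lambda>z. \<phi> ((T ^^ n) z) * \<psi> z)"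
      using \<phi> \<psi> by (intro int) (auto simp: abs_mult mult_le_one)
    have i3: "integrable M (\<lambda>z. \<bar>indicator A ((T ^^ n) z) - \<phi> ((T ^^ n) z)\<bar>)"
      using \<phi> by (intro int) (auto intro: abs_indicator_diff_le)
    have i4: "integrable M (\<lambda>z. \<bar>indicator B z - \<psi> z\<bar>)"
      using \<psi> by (intro int) (auto intro: abs_indicator_diff_le)
    have "measure M ((T ^^ n) -` A \<inter> B) = (\<integral>z. indicator ((T ^^ n) -` A \<inter> B) z \<partial>M)"
      by simp
    also have "\<dots> = (\<integral>z. indicator A ((T ^^ n) z) * indicator B z \<partial>M)"
      by (intro Bochner_Integration.integral_cong) (auto split: split_indicator)
    finally have "\<bar>measure M ((T ^^ n) -` A \<inter> B) - (\<integral>z. \<phi> ((T ^^ n) z) * \<psi> z \<partial>M)\<bar> =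
        \<bar>\<integral>z. indicator A ((T ^^ n) z) * indicator B z - \<phi> ((T ^^ n) z) * \<psi> z \<partial>M\<bar>"
      using i1 i2 by simp
    also have "\<dots> \<le> (\<integral>z. \<bar>indicator A ((T ^^ n) z) * indicator B z - \<phi> ((T ^^ n) z) * \<psi> z\<bar> \<partial>M)"
      by (rule integral_abs_bound)
    also have "\<dots> \<le> (\<integral>z. \<bar>indicator A ((T ^^ n) z) - \<phi> ((T ^^ n) z)\<bar> + \<bar>indicator B z - \<psi> z\<bar> \<partial>M)"
    proof (rule integral_mono)
      show "integrable M (\<lambda>z. \<bar>indicator A ((T ^^ n) z) * indicator B z - \<phi> ((T ^^ n) z) * \<psi> z\<bar>)"
        by (intro integrable_abs Bochner_Integration.integrable_diff i1 i2)
      show "integrable M (\<lambda>z. \<bar>indicator A ((T ^^ n) z) - \<phi> ((T ^^ n) z)\<bar> + \<bar>indicator B z - \<psi> z\<bar>)"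
        by (intro Bochner_Integration.integrable_add i3 i4)
    qed (intro prod_le, use \<phi> in auto)
    also have "\<dots> = (\<integral>z. \<bar>indicator A ((T ^^ n) z) - \<phi> ((T ^^ n) z)\<bar> \<partial>M) + (\<integral>z. \<bar>indicator B z - \<psi> z\<bar> \<partial>M)"
      using i3 i4 by simp
    also have "(\<integral>z. \<bar>indicator A ((T ^^ n) z) - \<phi> ((T ^^ n) z)\<bar> \<partial>M) = (\<integral>z. \<bar>indicator A z - \<phi> z\<bar> \<partial>M)"
      by (rule invariant_integral_funpow[OF T]) simp
    finally show ?thesis using \<phi>(4) \<psi>(4) by simp
  qed
  have "\<bar>measure M A * measure M B - (\<integral>z. \<phi> z \<partial>M) * (\<integral>z. \<psi> z \<partial>M)\<bar> \<le> 2 * \<epsilon>"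
  proof -
    have *: "\<bar>measure M C - (\<integral>z. g z \<partial>M)\<bar> \<le> (\<integral>z. \<bar>indicator C z - g z\<bar> \<partial>M)" "0 \<le> (\<integral>z. g z \<partial>M)" "(\<integral>z. g z \<partial>M) \<le> 1"
      if [measurable]: "C \<in> sets M" "g \<in> borel_measurable M" and g: "\<And>z. 0 \<le> g z" "\<And>z. g z \<le> 1"
      for C and g :: "'a \<Rightarrow> real"
    proof -
      have i: "integrable M g" using g by (intro int) (auto simp: abs_le_iff intro: order_trans[of _ 0])
      have "measure M C - (\<integral>z. g z \<partial>M) = (\<integral>z. indicator C z - g z \<partial>M)"
        using i by (subst Bochner_Integration.integral_diff) (auto intro!: int split: split_indicator)
      then show "\<bar>measure M C - (\<integral>z. g z \<partial>M)\<bar> \<le> (\<integral>z. \<bar>indicator C z - g z\<bar> \<partial>M)"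
        using integral_abs_bound by simp
      show "0 \<le> (\<integral>z. g z \<partial>M)" using g by simp
      have "(\<integral>z. g z \<partial>M) \<le> (\<integral>z. 1 \<partial>M)" using g i by (intro integral_mono) auto
      then show "(\<integral>z. g z \<partial>M) \<le> 1" by (simp add: prob_space)
    qed
    have "\<bar>measure M A * measure M B - (\<integral>z. \<phi> z \<partial>M) * (\<integral>z. \<psi> z \<partial>M)\<bar> \<le>
        \<bar>measure M A - (\<integral>z. \<phi> z \<partial>M)\<bar> + \<bar>measure M B - (\<integral>z. \<psi> z \<partial>M)\<bar>"
      using *(2,3)[of A \<phi>] \<phi> by (intro prod_le) auto
    then show ?thesis
      using *(1)[of A \<phi>] *(1)[of B \<psi>] \<phi> \<psi> by simp
  qed
  moreover obtain N where N: "\<And>n. n \<ge> N \<Longrightarrow>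
      \<bar>(\<integral>z. \<phi> ((T ^^ n) z) * \<psi> z \<partial>M) - (\<integral>z. \<phi> z \<partial>M) * (\<integral>z. \<psi> z \<partial>M)\<bar> < \<epsilon>"
  proof -
    have "(\<lambda>n. \<integral>z. \<phi> ((T ^^ n) z) * \<psi> z \<partial>M) \<longlonglongrightarrow> (\<integral>z. \<phi> z \<partial>M) * (\<integral>z. \<psi> z \<partial>M)"
      using \<phi> \<psi> by (intro correlations) (auto simp: bounded_iff intro!: exI[of _ 1])
    from LIMSEQ_D[OF this \<epsilon>] show ?thesis using that by auto
  qed
  ultimately have "\<bar>measure M ((T ^^ n) -` A \<inter> B) - measure M A * measure M B\<bar> < e" if "n \<ge> N" for n
    using close[of n] N[OF that] unfolding \<epsilon>_def by linarith
  then show "\<exists>no. \<forall>n\<ge>no. norm (measure M ((T ^^ n) -` A \<inter> B) - measure M A * measure M B) < e"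
    by auto
qed

section \<open>The limit of the iterated kernels as a measure\<close>

lemma (in equicontinuous_kernel) limit_lower_bound:
  assumes "0 < r" "(\<lambda>n. measure_pmf.expectation (kernel_iter \<kappa> n w) (hat p r)) \<longlonglongrightarrow> c"
  shows "0 < c"
proof -
  obtain c' N where "0 < c'" "\<And>n. n \<ge> N \<Longrightarrow> c' \<le> measure_pmf.expectation (kernel_iter \<kappa> n w) (hat p r)"
    using lower_bound[OF assms(1)] by metis
  then have "c' \<le> c" using assms(2) by (intro LIMSEQ_le_const) auto
  with \<open>0 < c'\<close> show ?thesis by simp
qed

lemma pmf_tight:
  fixes q :: "complex pmf"
  assumes "0 < \<epsilon>"
  shows "\<exists>K. compact K \<and> measure_pmf.prob q K \<ge> 1 - \<epsilon>"
proof -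
  have "(\<lambda>n. measure_pmf.prob q (cball 0 (real n))) \<longlonglongrightarrow> measure_pmf.prob q (\<Union>n. cball 0 (real n))"
    by (intro measure_pmf.finite_Lim_measure_incseq) (auto simp: incseq_def)
  moreover have "(\<Union>n. cball (0::complex) (real n)) = UNIV"
    using real_arch_simple by (auto simp: dist_norm)
  ultimately have "(\<lambda>n. measure_pmf.prob q (cball 0 (real n))) \<longlonglongrightarrow> 1" by simp
  then have "\<forall>\<^sub>F n in sequentially. 1 - \<epsilon> < measure_pmf.prob q (cball 0 (real n))"
    using assms by (intro order_tendstoD) auto
  then obtain n where "1 - \<epsilon> < measure_pmf.prob q (cball 0 (real n))"
    by (auto simp: eventually_sequentially)
  then show ?thesis by (intro exI[of _ "cball 0 (real n)"]) auto
qed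

theorem equidistribution:
  fixes \<kappa> :: "complex \<Rightarrow> complex pmf"
  assumes "equicontinuous_kernel \<kappa> p"
  obtains M where "prob_space M" "sets M = sets borel"
    "\<And>(\<phi> :: complex \<Rightarrow> complex) w. continuous_on UNIV \<phi> \<Longrightarrow> bounded (range \<phi>) \<Longrightarrow>
      (\<lambda>n. measure_pmf.expectation (kernel_iter \<kappa> n w) \<phi>) \<longlonglongrightarrow> (\<integral>z. \<phi> z \<partial>M)"
proof -
  interpret equicontinuous_kernel \<kappa> p by fact
  have "\<exists>K. compact K \<and> (\<forall>n. measure_pmf.prob (kernel_iter \<kappa> n p) K \<ge> 1 - \<epsilon>)" if \<epsilon>: "0 < \<epsilon>" for \<epsilon>
  proof -
    obtain K n0 where K: "compact K" "\<And>n. n \<ge> n0 \<Longrightarrow> measure_pmf.prob (kernel_iter \<kappa> n p) K \<ge> 1 - \<epsilon>"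
      using tight_kernel[OF \<epsilon>] by blast
    obtain C where C: "\<And>n. compact (C n)" "\<And>n. measure_pmf.prob (kernel_iter \<kappa> n p) (C n) \<ge> 1 - \<epsilon>"
      using choice[OF allI[OF pmf_tight[OF \<epsilon>]], of "\<lambda>n. kernel_iter \<kappa> n p"] by auto
    \<comment> \<open>Tightness of the kernel concerns late times only; each of the finitely many
      earlier laws contributes a compact set of its own.\<close>
    have "1 - \<epsilon> \<le> measure_pmf.prob (kernel_iter \<kappa> n p) (K \<union> (\<Union>i<n0. C i))" for n
    proof (cases "n < n0")
      case True
      then have "measure_pmf.prob (kernel_iter \<kappa> n p) (C n) \<le> measure_pmf.prob (kernel_iter \<kappa> n p) (K \<union> (\<Union>i<n0. C i))"
        by (intro measure_pmf.finite_measure_mono) auto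
      then show ?thesis using C(2)[of n] by linarith
    next
      case False
      have "measure_pmf.prob (kernel_iter \<kappa> n p) K \<le> measure_pmf.prob (kernel_iter \<kappa> n p) (K \<union> (\<Union>i<n0. C i))"
        by (intro measure_pmf.finite_measure_mono) auto
      then show ?thesis using K(2)[of n] False by linarith
    qed
    moreover have "compact (K \<union> (\<Union>i<n0. C i))"
      using K(1) C(1) by (intro compact_Un compact_UN) auto
    ultimately show ?thesis by blast
  qed
  then obtain M r where M: "prob_space M" "sets M = sets borel" and r: "strict_mono (r :: nat \<Rightarrow> nat)"
    and lim: "\<And>\<phi> :: complex \<Rightarrow> complex. continuous_on UNIV \<phi> \<Longrightarrow> bounded (range \<phi>) \<Longrightarrow>
      (\<lambda>n. measure_pmf.expectation (kernel_iter \<kappa> (r n) p) \<phi>) \<longlonglongrightarrow> (\<integral>z. \<phi> z \<partial>M)"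
    using tight_pmf_imp_convergent_subsequence[of "\<lambda>n. kernel_iter \<kappa> n p"] by metis
  show ?thesis
  proof (rule that[OF M])
    fix \<phi> :: "complex \<Rightarrow> complex" and w
    assume \<phi>: "continuous_on UNIV \<phi>" "bounded (range \<phi>)"
    obtain c where c: "\<And>w. (\<lambda>n. measure_pmf.expectation (kernel_iter \<kappa> n w) \<phi>) \<longlonglongrightarrow> c"
      using converges_to_constant[OF \<phi>] by blast
    \<comment> \<open>The subsequence at \<open>p\<close> identifies the constant, which is the
      limit of the full sequence from every starting point.\<close>
    have "(\<lambda>n. measure_pmf.expectation (kernel_iter \<kappa> (r n) p) \<phi>) \<longlonglongrightarrow> c"
      using LIMSEQ_subseq_LIMSEQ[OF c[of p] r] by (simp add: comp_def)
    then have "c = (\<integral>z. \<phi> z \<partial>M)" using lim[OF \<phi>] LIMSEQ_unique by blast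
    with c show "(\<lambda>n. measure_pmf.expectation (kernel_iter \<kappa> n w) \<phi>) \<longlonglongrightarrow> (\<integral>z. \<phi> z \<partial>M)" by simp
  qed
qed

section \<open>The Julia set of an irreducible weight\<close>

lemma Q_iter_add: "Q_iter f Q (m + n) z = Q_iter f Q m z * Q_iter f Q n ((f ^^ m) z)"
proof (induction n)
  case (Suc n)
  have "(f ^^ (m + n)) z = (f ^^ n) ((f ^^ m) z)" by (simp add: add.commute[of m] funpow_add)
  then show ?case using Suc by (simp add: Q_iter_def mult.assoc)
qed (simp add: Q_iter_def)

lemma Q_iter_Suc: "Q_iter f Q (Suc n) z = Q z * Q_iter f Q n (f z)"
  using Q_iter_add[of f Q 1 n z] by (simp add: Q_iter_def)

lemma kernel_iter_1: "kernel_iter \<kappa> (Suc 0) = \<kappa>"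
proof
  have "kernel_iter \<kappa> 0 = return_pmf" by (rule ext) simp
  then show "kernel_iter \<kappa> (Suc 0) w = \<kappa> w" for w by (simp add: bind_return_pmf')
qed

text \<open>If the orbits met, both points would lie on one cycle and each minimal period would
  divide the other. Coprimality makes both periods 1, and the cycle of a fixed point has no second
  point.\<close>

lemma coprime_cycles_disjoint:
  assumes p1: "m1 > 0" "(f ^^ m1) p1 = p1" "\<And>k. 0 < k \<Longrightarrow> k < m1 \<Longrightarrow> (f ^^ k) p1 \<noteq> p1"
    and p2: "m2 > 0" "(f ^^ m2) p2 = p2" "\<And>k. 0 < k \<Longrightarrow> k < m2 \<Longrightarrow> (f ^^ k) p2 \<noteq> p2"
    and "coprime m1 m2" "p1 \<noteq> p2"
  shows "(f ^^ i) p1 \<noteq> (f ^^ j) p2"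
proof
  assume eq: "(f ^^ i) p1 = (f ^^ j) p2"
  have per: "(f ^^ (m * k)) p = p" if "(f ^^ m) p = p" for m k and p :: 'a
    using that by (induction k) (simp_all add: funpow_add)
  have dvd: "m dvd n"
    if m: "m > 0" "(f ^^ m) p = p" "\<And>k. 0 < k \<Longrightarrow> k < m \<Longrightarrow> (f ^^ k) p \<noteq> p" "(f ^^ n) p = p" for m n and p :: 'a
  proof -
    have "(f ^^ n) p = (f ^^ (n mod m)) ((f ^^ (m * (n div m))) p)"
      using funpow_add[of "n mod m" "m * (n div m)" f] by simp
    then have "(f ^^ (n mod m)) p = p" using m(4) per[OF m(2)] by simp
    then show ?thesis using m(3)[of "n mod m"] m(1) by (auto simp: dvd_eq_mod_eq_0)
  qed
  \<comment> \<open>From \<open>(f ^^ i) p1\<close>, the remaining \<open>m1 * i - i\<close> steps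
    of \<open>i\<close> full turns lead back to \<open>p1\<close>.\<close>
  have "i \<le> m1 * i" "j \<le> m2 * j" using p1(1) p2(1) by auto
  then have "(f ^^ (m1 * i - i)) ((f ^^ i) p1) = p1" "(f ^^ (m2 * j - j)) ((f ^^ j) p2) = p2"
    using per[OF p1(2), of i] per[OF p2(2), of j] by (simp_all flip: funpow_add[unfolded comp_def, THEN fun_cong])
  then obtain k l where k: "p1 = (f ^^ k) p2" and l: "p2 = (f ^^ l) p1"
    using eq by (metis comp_apply funpow_add)
  have comm: "(f ^^ a) ((f ^^ b) x) = (f ^^ b) ((f ^^ a) x)" for a b x
    by (metis add.commute comp_apply funpow_add)
  have "(f ^^ m2) p1 = p1" by (simp add: k comm[of m2] p2(2))
  then have "m1 dvd m2" using p1 by (intro dvd[of m1 p1]) auto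
  moreover have "(f ^^ m1) p2 = p2" by (simp add: l comm[of m1] p1(2))
  then have "m2 dvd m1" using p2 by (intro dvd[of m2 p2]) auto
  ultimately have "m1 = 1" using coprime_common_divisor[OF \<open>coprime m1 m2\<close>, of m1] by simp
  then have "(f ^^ l) p1 = p1" using per[OF p1(2), of l] by simp
  with l \<open>p1 \<noteq> p2\<close> show False by simp
qed

section \<open>Points reachable from small disks\<close>

locale irreducible_system = entire_weight +
  assumes weakly_continuous: "weakly_continuous f Q" and normal: "normal_weight f Q"
    and tight: "tight_weight f Q" and irreducible: "irreducible_weight f Q"
begin

abbreviation J :: "complex set" where "J \<equiv> Q_Julia f Q"

definition reachable :: "complex \<Rightarrow> real \<Rightarrow> complex set" where
  "reachable z0 r = {w. \<exists>z\<in>ball z0 r. \<exists>n\<ge>1. (f ^^ n) z = w \<and> Q_iter f Q n z > 0}"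

lemma expands_reachable:
  assumes "expands_over_compacts f Q p" "0 < r"
  shows "reachable p r = UNIV"
proof -
  have "w \<in> reachable p r" for w
  proof -
    have "\<exists>n\<ge>1. \<forall>w\<in>{w}. \<exists>z\<in>ball p r. (f ^^ n) z = w \<and> Q_iter f Q n z > 0"
      using assms(1)[unfolded expands_over_compacts_def, rule_format, of r "{w}"] assms(2) by simp
    then show ?thesis by (auto simp: reachable_def)
  qed
  then show ?thesis by auto
qed

lemma reachable_trans:
  assumes "z \<in> reachable z0 r" "(f ^^ n) z = w" "Q_iter f Q n z > 0"
  shows "w \<in> reachable z0 r"
proof -
  obtain y m where y: "y \<in> ball z0 r" "m \<ge> 1" "(f ^^ m) y = z" "Q_iter f Q m y > 0"
    using assms(1) by (auto simp: reachable_def)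
  have "(f ^^ (n + m)) y = w" "Q_iter f Q (m + n) y > 0"
    using y assms by (auto simp: funpow_add Q_iter_add)
  then show ?thesis
    using y(1,2) unfolding reachable_def by (auto intro!: bexI[of _ y] exI[of _ "n + m"] simp: add.commute)
qed

text \<open>\<open>w\<close> is pulled back to a point \<open>z\<close> near \<open>p\<close> that
  is not the exceptional \<open>a\<close>; then \<open>z\<close> is reachable, and so is
  \<open>w\<close>.\<close>

lemma reachable_off_orbit:
  assumes "- reachable z0 r \<subseteq> {a}" "expands_over_compacts f Q p" "\<And>n. (f ^^ n) p \<noteq> w"
  shows "w \<in> reachable z0 r"
proof -
  \<comment> \<open>The open ball of radius \<open>dist a p\<close> misses \<open>a\<close>. If
    \<open>a = p\<close> any radius will do, because \<open>z = p\<close> would put \<open>w\<close>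
    on the orbit of \<open>p\<close>.\<close>
  define s where "s = (if a = p then 1 else dist a p)"
  have "0 < s" by (simp add: s_def)
  then have "w \<in> reachable p s" using expands_reachable[OF assms(2)] by blast
  then obtain z n where z: "z \<in> ball p s" "(f ^^ n) z = w" "Q_iter f Q n z > 0"
    by (auto simp: reachable_def)
  have "z \<noteq> a" using z(1,2) assms(3)[of n] by (auto simp: s_def dist_commute split: if_splits)
  then have "z \<in> reachable z0 r" using assms(1) by blast
  then show ?thesis using z(2,3) by (rule reachable_trans)
qed

text \<open>An exceptional value \<open>w\<close> could only lie on the orbit of the expanding point. A second expanding
  point with a disjoint cycle, or a second weighted preimage of the fixed point, rules this out.\<close>

lemma reachable_eq_UNIV:
  assumes "- reachable z0 r \<subseteq> {a}"
  shows "reachable z0 r = UNIV"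
proof -
  have "w \<in> reachable z0 r" for w
    using irreducible unfolding irreducible_weight_def
  proof (elim disjE exE conjE)
    fix p assume p: "repelling_periodic f 1 p" "0 < Q p" "Q p < 1" "expands_over_compacts f Q p"
    have fp: "f p = p" "norm (deriv f p) > 1" using p(1) by (auto simp: repelling_periodic_def)
    have orbit: "(f ^^ n) p = p" for n using fp by (induction n) auto
    have off: "v \<in> reachable z0 r" if "v \<noteq> p" for v
      using that orbit by (intro reachable_off_orbit[OF assms p(4)]) auto
    show ?thesis
    proof (cases "w = p")
      case True
      \<comment> \<open>Multiplicity one makes the mass at \<open>p\<close> equal to
        \<open>Q p < 1\<close>, which forces a second weighted preimage \<open>p'\<close> of
        \<open>p\<close>.\<close>
      have "mult f p = 1" using fp by (intro mult_eq_1 holomorphic) auto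
      then have pmf_p: "pmf (preimage_pmf f Q p) p = Q p" using fp by (simp add: pmf_preimage_pmf)
      obtain p' where p': "p' \<in> set_pmf (preimage_pmf f Q p)" "p' \<noteq> p"
      proof -
        have "set_pmf (preimage_pmf f Q p) \<noteq> {p}"
        proof
          assume "set_pmf (preimage_pmf f Q p) = {p}"
          then have "preimage_pmf f Q p = return_pmf p"
            by (metis set_pmf_subset_singleton order_refl)
          with pmf_p p(3) show False by simp
        qed
        then show ?thesis using that set_pmf_not_empty[of "preimage_pmf f Q p"] by blast
      qed
      have p'_reachable: "p' \<in> reachable z0 r" using p'(2) by (rule off)
      have "f p' = p" "Q p' \<noteq> 0" using p'(1) by (auto simp: set_pmf_iff pmf_preimage_pmf split: if_splits)
      then have "(f ^^ 1) p' = w" "Q_iter f Q 1 p' > 0"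
        using True Q_nonneg[of p'] by (auto simp: Q_iter_def order_less_le)
      with p'_reachable show ?thesis by (rule reachable_trans)
    qed (rule off)
  next
    fix p1 p2 m1 m2
    assume p: "p1 \<noteq> p2" "repelling_periodic f m1 p1" "repelling_periodic f m2 p2" "coprime m1 m2"
      "expands_over_compacts f Q p1" "expands_over_compacts f Q p2"
    \<comment> \<open>Hence \<open>w\<close> is off the orbit of at least one of the two
      points.\<close>
    have *: "(f ^^ i) p1 \<noteq> (f ^^ j) p2" for i j
      using p unfolding repelling_periodic_def by (intro coprime_cycles_disjoint[of m1 f p1 m2 p2]) auto
    show ?thesis
    proof (cases "\<exists>i. (f ^^ i) p1 = w")
      case True
      then show ?thesis using * by (intro reachable_off_orbit[OF assms p(6)]) metis
    next
      case False
      then show ?thesis by (intro reachable_off_orbit[OF assms p(5)]) blast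
    qed
  qed
  then show ?thesis by blast
qed

text \<open>The definition tolerates an omitted point for each radius; by
  \<open>reachable_eq_UNIV\<close> none is ever omitted.\<close>

lemma Julia_eq: "J = {z0. \<forall>r>0. reachable z0 r = UNIV}"
proof (intro set_eqI iffI)
  fix z0 assume "z0 \<in> J"
  then have "\<forall>r>0. \<exists>a. - reachable z0 r \<subseteq> {a}"
    by (simp add: Q_Julia_def reachable_def)
  then show "z0 \<in> {z0. \<forall>r>0. reachable z0 r = UNIV}"
    using reachable_eq_UNIV by blast
next
  fix z0 assume "z0 \<in> {z0. \<forall>r>0. reachable z0 r = UNIV}"
  then have "\<forall>r>0. \<exists>a. - reachable z0 r \<subseteq> {a}" by blast
  then show "z0 \<in> J" by (simp add: Q_Julia_def reachable_def)
qed

section \<open>Closedness and invariance of the Julia set\<close>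

lemma closed_Julia: "closed J"
  unfolding closed_sequential_limits
proof (intro allI impI)
  fix x z0 assume x: "(\<forall>n. x n \<in> J) \<and> x \<longlonglongrightarrow> z0"
  have "reachable z0 r = UNIV" if r: "0 < r" for r
  proof -
    obtain n where n: "dist (x n) z0 < r/2"
      using conjunct2[OF x, unfolded lim_sequentially, rule_format, of "r/2"] r by auto
    have "reachable (x n) (r/2) \<subseteq> reachable z0 r"
    proof -
      have "ball (x n) (r/2) \<subseteq> ball z0 r"
      proof
        fix y assume "y \<in> ball (x n) (r/2)"
        then show "y \<in> ball z0 r"
          using n dist_triangle[of z0 y "x n"] by (simp add: dist_commute)
      qed
      then show ?thesis unfolding reachable_def by blast
    qed
    moreover have "reachable (x n) (r/2) = UNIV" using x r by (auto simp: Julia_eq)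
    ultimately show ?thesis by blast
  qed
  then show "z0 \<in> J" by (simp add: Julia_eq)
qed

lemma obtain_expanding_point:
  obtains p where "p \<in> J" "equicontinuous_kernel (preimage_pmf f Q) p"
proof -
  obtain p where p: "expands_over_compacts f Q p"
    using irreducible unfolding irreducible_weight_def by blast
  show ?thesis
  proof (rule that)
    show "p \<in> J" using expands_reachable[OF p] by (simp add: Julia_eq)
    show "equicontinuous_kernel (preimage_pmf f Q) p"
      by (rule equicontinuous_kernelI[OF holomorphic surj weight weakly_continuous normal tight p])
  qed
qed

text \<open>Orbits from a small disk about \<open>z0\<close> lose their first step, which lands near
  \<open>f z0\<close>. Only the value \<open>f z0\<close> itself could be missed this way, and
  \<open>reachable_eq_UNIV\<close> recovers it.\<close>

lemma Julia_forward: "z0 \<in> J \<Longrightarrow> f z0 \<in> J"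
proof -
  assume z0: "z0 \<in> J"
  have "- reachable (f z0) r \<subseteq> {f z0}" if r: "0 < r" for r
  proof (rule ccontr)
    assume "\<not> ?thesis"
    then obtain w where w: "w \<notin> reachable (f z0) r" "w \<noteq> f z0" by blast
    \<comment> \<open>\<open>t \<le> dist w (f z0)\<close> excludes a one-step orbit
      \<open>f z = w\<close>, so the shortened orbit still has the length at least 1 that
      \<open>reachable\<close> asks for.\<close>
    define t where "t = min r (dist w (f z0))"
    have "0 < t" using r w by (simp add: t_def)
    have "isCont f z0"
      using continuous_funpow[of 1] by (simp add: continuous_on_eq_continuous_at)
    then obtain s where s: "0 < s" "\<And>z. dist z z0 < s \<Longrightarrow> dist (f z) (f z0) < t"
      using \<open>0 < t\<close> unfolding continuous_at_eps_delta by blast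
    have "w \<in> reachable z0 s" using z0 s(1) by (auto simp: Julia_eq)
    then obtain z n where z: "z \<in> ball z0 s" "n \<ge> 1" "(f ^^ n) z = w" "Q_iter f Q n z > 0"
      by (auto simp: reachable_def)
    obtain m where m: "n = Suc m" using z(2) by (cases n) auto
    have fz: "dist (f z) (f z0) < t" using s(2)[of z] z(1) by (simp add: dist_commute)
    have w_eq: "(f ^^ m) (f z) = w" using z(3) m by (simp add: funpow_swap1)
    have "m \<noteq> 0"
    proof
      assume "m = 0"
      then show False using fz w_eq by (simp add: t_def)
    qed
    moreover have "Q_iter f Q m (f z) > 0"
      using z(4) Q_nonneg[of z] unfolding m Q_iter_Suc by (simp add: zero_less_mult_iff)
    moreover have "f z \<in> ball (f z0) r" using fz by (simp add: t_def dist_commute)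
    ultimately have "w \<in> reachable (f z0) r"
      using w_eq unfolding reachable_def by (auto intro!: bexI[of _ "f z"] exI[of _ m])
    with w(1) show False ..
  qed
  then have "reachable (f z0) r = UNIV" if "0 < r" for r
    using that by (intro reachable_eq_UNIV)
  then show "f z0 \<in> J" by (simp add: Julia_eq)
qed

text \<open>Openness of \<open>f\<close> alone would not do, as the preimages near \<open>z\<close>
  must carry weight. Weak continuity makes \<open>h\<close>, the one-step expectation of a tent at
  \<open>z\<close>, continuous, so every point near \<open>f z\<close> has a weighted preimage near
  \<open>z\<close>, and orbits starting near \<open>f z\<close> can be prolonged backwards.\<close>

lemma Julia_backward:
  assumes "f z \<in> J" "Q z > 0"
  shows "z \<in> J"
proof -
  obtain p where "equicontinuous_kernel (preimage_pmf f Q) p" using obtain_expanding_point by blast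
  then interpret equicontinuous_kernel "preimage_pmf f Q" p .
  have "v \<in> reachable z r" if r: "0 < r" for r v
  proof -
    define h where "h w = measure_pmf.expectation (preimage_pmf f Q w) (hat z r)" for w
    have h_pos: "0 < h w \<longleftrightarrow> (\<exists>x\<in>ball z r. f x = w \<and> Q x > 0)" for w
    proof -
      have "0 < h w \<longleftrightarrow> (\<exists>x\<in>set_pmf (preimage_pmf f Q w). x \<in> ball z r)"
        unfolding h_def using expectation_pos_iff[OF bounded_range_hat[OF r] hat_bounds(1)[OF r]]
        by (simp add: hat_pos_iff[OF r])
      also have "set_pmf (preimage_pmf f Q w) = {x. f x = w \<and> Q x > 0}"
        using set_transfer_kernel[of 1 w] by (simp add: bind_return_pmf' Q_iter_def kernel_iter_1)
      finally show ?thesis by blast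
    qed
    have "0 < h (f z)" using assms(2) r unfolding h_pos by (intro bexI[of _ z]) auto
    moreover have "isCont h (f z)"
      using feller_iter_hat[OF r, of 1 z]
      unfolding h_def by (simp add: continuous_on_eq_continuous_at kernel_iter_1)
    ultimately obtain s where s: "0 < s" "\<And>w. dist w (f z) < s \<Longrightarrow> dist (h w) (h (f z)) < h (f z)"
      unfolding continuous_at_eps_delta by blast
    have "v \<in> reachable (f z) s" using assms(1) s(1) by (auto simp: Julia_eq)
    then obtain y n where y: "y \<in> ball (f z) s" "(f ^^ n) y = v" "Q_iter f Q n y > 0"
      by (auto simp: reachable_def)
    then have "0 < h y" using s(2)[of y] by (simp add: dist_commute dist_real_def)
    then obtain x where x: "x \<in> ball z r" "f x = y" "Q x > 0" unfolding h_pos by blast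
    have "(f ^^ Suc n) x = v" "Q_iter f Q (Suc n) x > 0"
      using x y by (simp_all add: funpow_swap1 Q_iter_Suc)
    then show ?thesis using x(1) unfolding reachable_def by (auto intro!: bexI[of _ x] exI[of _ "Suc n"])
  qed
  then show ?thesis by (auto simp: Julia_eq)
qed

lemma set_transfer_kernel_Julia:
  assumes "w \<in> J"
  shows "set_pmf (transfer_kernel f Q n w) \<subseteq> J"
proof
  fix z assume "z \<in> set_pmf (transfer_kernel f Q n w)"
  then have "(f ^^ n) z \<in> J" "Q_iter f Q n z > 0" using assms by (auto simp: set_transfer_kernel)
  then show "z \<in> J"
  proof (induction n arbitrary: z)
    case (Suc n)
    have pos: "0 < Q z" "0 < Q_iter f Q n (f z)"
      using Suc.prems(2) Q_nonneg[of z] unfolding Q_iter_Suc by (auto simp: zero_less_mult_iff)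
    have "(f ^^ n) (f z) \<in> J" using Suc.prems(1) by (simp add: funpow_swap1)
    then have "f z \<in> J" using pos(2) by (rule Suc.IH)
    then show ?case using pos(1) by (rule Julia_backward)
  qed simp
qed

lemma transfer_cong:
  assumes "\<And>z. f z = w \<Longrightarrow> Q z \<noteq> 0 \<Longrightarrow> g z = h z"
  shows "transfer f Q g w = transfer f Q h w"
  unfolding transfer_def using assms by (intro infsum_cong) auto

text \<open>Weighted preimages of points of \<open>J\<close> stay in \<open>J\<close>, so values off
  \<open>J\<close> never enter the sums.\<close>

lemma transfer_funpow_cong:
  assumes "\<And>z. z \<in> J \<Longrightarrow> \<phi> z = \<psi> z" "w \<in> J"
  shows "(transfer f Q ^^ n) \<phi> w = (transfer f Q ^^ n) \<psi> w"
  using assms(2)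
proof (induction n arbitrary: w)
  case (Suc n)
  have "transfer f Q ((transfer f Q ^^ n) \<phi>) w = transfer f Q ((transfer f Q ^^ n) \<psi>) w"
  proof (rule transfer_cong)
    fix z assume "f z = w" "Q z \<noteq> 0"
    then have "z \<in> J" using Julia_backward[of z] Suc.prems Q_nonneg[of z] by (simp add: order_less_le)
    then show "(transfer f Q ^^ n) \<phi> z = (transfer f Q ^^ n) \<psi> z" by (rule Suc.IH)
  qed
  then show ?case by simp
qed (use assms(1) in simp)

end

section \<open>The limit measure\<close>

lemma
  fixes M :: "'a::topological_space measure"
  assumes M: "prob_space M" "sets M = sets borel" and S: "S \<in> sets borel" "AE x in M. x \<in> S"
  shows prob_space_restrict: "prob_space (restrict_space M S)"
    and measure_Int_full: "A \<in> sets borel \<Longrightarrow> measure M (A \<inter> S) = measure M A"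
    and integral_restrict_full: "g \<in> borel_measurable borel \<Longrightarrow>
      (\<integral>x. g x \<partial>restrict_space M S) = (\<integral>x. g x \<partial>M :: 'b::{banach, second_countable_topology})"
proof -
  interpret prob_space M by fact
  have sp: "space M = UNIV" using sets_eq_imp_space_eq[OF M(2)] by simp
  have S': "S \<inter> space M \<in> sets M" using S M sp by simp
  show "prob_space (restrict_space M S)"
  proof
    have "emeasure (restrict_space M S) (space (restrict_space M S)) = emeasure M S"
      using S' sp by (simp add: space_restrict_space emeasure_restrict_space)
    also have "\<dots> = 1" using S M by (intro emeasure_eq_1_AE) auto
    finally show "emeasure (restrict_space M S) (space (restrict_space M S)) = 1" .
  qed
  show "measure M (A \<inter> S) = measure M A" if "A \<in> sets borel"
    using that S M(2) by (intro finite_measure_eq_AE) auto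
  show "(\<integral>x. g x \<partial>restrict_space M S) = (\<integral>x. g x \<partial>M)" if g: "g \<in> borel_measurable borel"
  proof -
    have [measurable]: "g \<in> borel_measurable M" "S \<in> sets M"
      using g S M(2) by (simp_all cong: measurable_cong_sets)
    have "(\<integral>x. g x \<partial>restrict_space M S) = (\<integral>x. indicator S x *\<^sub>R g x \<partial>M)"
      by (rule integral_restrict_space[OF S'])
    also have "\<dots> = (\<integral>x. g x \<partial>M)"
      using S(2) by (intro integral_cong_AE) auto
    finally show ?thesis .
  qed
qed

lemma Cb_extension:
  assumes "closed S" "\<phi> \<in> Cb S"
  obtains \<psi> where "continuous_on UNIV \<psi>" "bounded (range \<psi>)" "\<And>z. z \<in> S \<Longrightarrow> \<psi> z = \<phi> z"
proof -
  obtain B where B: "B > 0" "\<And>z. z \<in> S \<Longrightarrow> norm (\<phi> z) \<le> B"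
    using assms(2) by (auto simp: Cb_def bounded_pos)
  obtain \<psi> where "continuous_on UNIV \<psi>" "\<And>z. z \<in> S \<Longrightarrow> \<psi> z = \<phi> z" "\<And>z. norm (\<psi> z) \<le> B"
    using Tietze[of S \<phi> UNIV B] assms B by (auto simp: Cb_def)
  then show ?thesis by (intro that[of \<psi>]) (auto simp: bounded_iff)
qed

text \<open>Closed subsets of \<open>S\<close> are the generator on which measurability of the
  restricted kernels is tested; traces of closed sets are closed because \<open>S\<close>
  is.\<close>

lemma sets_restrict_closed:
  assumes "closed S"
  shows "sets (restrict_space borel S) = sigma_sets S {F. closed F \<and> F \<subseteq> S}"
proof -
  have "sets (restrict_space borel S) = (\<inter>) S ` sigma_sets UNIV (Collect closed)"
    by (simp add: sets_restrict_space borel_eq_closed sets_measure_of)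
  also have "\<dots> = sigma_sets S ((\<inter>) S ` Collect closed)"
    using assms by (intro sigma_sets_Int) (auto intro: sigma_sets.Basic)
  also have "(\<inter>) S ` Collect closed = {F. closed F \<and> F \<subseteq> S}"
    using assms by (auto simp: image_iff intro: closed_Int intro!: exI)
  finally show ?thesis .
qed

text \<open>\<open>M\<close> is the limit measure on the whole plane. The point \<open>p\<close>
  lies in the Julia set, so that \<open>M\<close> is a limit of laws carried by that set.\<close>

locale equidistributed_system =
  irreducible_system f Q + equicontinuous_kernel "preimage_pmf f Q" p
  for f :: "complex \<Rightarrow> complex" and Q :: "complex \<Rightarrow> real" and p :: complex +
  fixes M :: "complex measure"
  assumes p_Julia: "p \<in> Q_Julia f Q" and prob_M: "prob_space M" and sets_M: "sets M = sets borel"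
    and lim: "\<And>(\<phi> :: complex \<Rightarrow> complex) w. continuous_on UNIV \<phi> \<Longrightarrow> bounded (range \<phi>) \<Longrightarrow>
      (\<lambda>n. measure_pmf.expectation (transfer_kernel f Q n w) \<phi>) \<longlonglongrightarrow> (\<integral>z. \<phi> z \<partial>M)"
begin

sublocale M: prob_space M by (rule prob_M)

abbreviation P :: "nat \<Rightarrow> (complex \<Rightarrow> 'b::{banach, second_countable_topology}) \<Rightarrow> complex \<Rightarrow> 'b" where
  "P n \<phi> w \<equiv> measure_pmf.expectation (transfer_kernel f Q n w) \<phi>"

section \<open>Invariance, decay of correlations and positivity on the plane\<close>

lemma space_M: "space M = UNIV"
  using sets_eq_imp_space_eq[OF sets_M] by simp

lemma borel_measurable_M:
  fixes g :: "complex \<Rightarrow> 'b::topological_space"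
  shows "continuous_on UNIV g \<Longrightarrow> g \<in> borel_measurable M"
  using borel_measurable_continuous_onI[of g] sets_M by (simp cong: measurable_cong_sets)

lemma complex_test_function:
  fixes \<phi> :: "complex \<Rightarrow> real"
  assumes "continuous_on UNIV \<phi>" "bounded (range \<phi>)"
  shows "continuous_on UNIV (\<lambda>z. complex_of_real (\<phi> z))" "bounded (range (\<lambda>z. complex_of_real (\<phi> z)))"
  using assms by (auto intro!: continuous_intros simp: bounded_iff)

lemma lim_real:
  fixes \<phi> :: "complex \<Rightarrow> real"
  assumes "continuous_on UNIV \<phi>" "bounded (range \<phi>)"
  shows "(\<lambda>n. P n \<phi> w) \<longlonglongrightarrow> (\<integral>z. \<phi> z \<partial>M)"
  using tendsto_Re[OF lim[OF complex_test_function[OF assms], of w]] by simp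

lemma continuous_P:
  fixes \<phi> :: "complex \<Rightarrow> real"
  assumes "continuous_on UNIV \<phi>" "bounded (range \<phi>)"
  shows "continuous_on UNIV (P n \<phi>)"
  using continuous_on_Re[OF feller_iter[OF complex_test_function[OF assms], of n]] by simp

text \<open>Averaging \<open>P n \<phi>\<close> instead of \<open>\<phi>\<close> along the chain
  from \<open>p\<close> only shifts the time by \<open>n\<close>, which does not change the
  limit.\<close>

lemma integral_P:
  fixes \<phi> :: "complex \<Rightarrow> complex"
  assumes \<phi>: "continuous_on UNIV \<phi>" "bounded (range \<phi>)"
  shows "(\<integral>z. P n \<phi> z \<partial>M) = (\<integral>z. \<phi> z \<partial>M)"
proof (rule LIMSEQ_unique)
  show "(\<lambda>m. P m (P n \<phi>) p) \<longlonglongrightarrow> (\<integral>z. P n \<phi> z \<partial>M)"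
    by (intro lim feller_iter bounded_range_expectation \<phi>)
  have "(\<lambda>m. P (m + n) \<phi> p) \<longlonglongrightarrow> (\<integral>z. \<phi> z \<partial>M)"
    using lim[OF \<phi>] by (rule LIMSEQ_ignore_initial_segment)
  then show "(\<lambda>m. P m (P n \<phi>) p) \<longlonglongrightarrow> (\<integral>z. \<phi> z \<partial>M)"
    by (simp only: expectation_kernel_iter_add[OF \<phi>(2)])
qed

lemma integral_P_real:
  fixes \<phi> :: "complex \<Rightarrow> real"
  assumes \<phi>: "continuous_on UNIV \<phi>" "bounded (range \<phi>)"
  shows "(\<integral>z. P n \<phi> z \<partial>M) = (\<integral>z. \<phi> z \<partial>M)"
  using integral_P[OF complex_test_function[OF \<phi>], of n] by (simp only: integral_complex_of_real of_real_eq_iff)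

text \<open>The laws started at \<open>p\<close> give mean 0 to a bounded continuous function that
  vanishes exactly on \<open>J\<close>, hence so does their limit.\<close>

lemma AE_Julia: "AE z in M. z \<in> J"
proof -
  define d where "d z = min 1 (infdist z J)" for z
  have ne: "J \<noteq> {}" using p_Julia by blast
  have d: "continuous_on UNIV d" "bounded (range d)"
    unfolding d_def by (auto intro!: continuous_intros exI[of _ 1] simp: bounded_iff infdist_nonneg)
  have d_J: "d z = 0 \<longleftrightarrow> z \<in> J" for z
    using in_closed_iff_infdist_zero[OF closed_Julia ne, of z] infdist_nonneg[of z J] by (auto simp: d_def min_def)
  have "P n d p = 0" for n
    using set_transfer_kernel_Julia[OF p_Julia, of n] d_J
    by (intro integral_eq_zero_AE) (auto simp: AE_measure_pmf_iff)
  then have "(\<integral>z. d z \<partial>M) = 0"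
    using lim_real[OF d, of p] by (simp add: LIMSEQ_const_iff)
  moreover have "integrable M d"
    by (intro M.integrable_const_bound[where B=1] AE_I2 borel_measurable_M d) (auto simp: d_def infdist_nonneg)
  moreover have "AE z in M. 0 \<le> d z" by (auto simp: d_def infdist_nonneg)
  ultimately have "AE z in M. d z = 0" by (simp add: integral_nonneg_eq_0_iff_AE)
  then show ?thesis by (simp add: d_J)
qed

text \<open>Under the \<open>n\<close>-step law from \<open>w\<close> the point
  \<open>(f ^^ n) z\<close> is almost surely \<open>w\<close>, so the first factor is
  constant.\<close>

lemma P_comp_mult:
  fixes \<phi> \<psi> :: "complex \<Rightarrow> real"
  shows "P n (\<lambda>z. \<phi> ((f ^^ n) z) * \<psi> z) w = \<phi> w * P n \<psi> w"
proof -
  have "P n (\<lambda>z. \<phi> ((f ^^ n) z) * \<psi> z) w = P n (\<lambda>z. \<phi> w * \<psi> z) w"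
    by (intro integral_cong_AE) (auto simp: AE_measure_pmf_iff set_transfer_kernel)
  then show ?thesis by simp
qed

lemma f_measurable: "f \<in> measurable M M"
  using borel_measurable_continuous_onI[OF continuous_funpow[of 1]] sets_M
  by (simp cong: measurable_cong_sets)

lemma bounded_mult_comp:
  fixes \<phi> \<psi> :: "complex \<Rightarrow> real"
  assumes "bounded (range \<phi>)" "bounded (range \<psi>)"
  shows "bounded (range (\<lambda>z. \<phi> (h z) * \<psi> z))"
proof -
  obtain A B where "\<And>z. \<bar>\<phi> z\<bar> \<le> A" "\<And>z. \<bar>\<psi> z\<bar> \<le> B"
    using assms by (auto simp: bounded_iff)
  then have "\<bar>\<phi> (h z) * \<psi> z\<bar> \<le> A * B" for z
    unfolding abs_mult by (intro mult_mono) (auto intro: order_trans[OF abs_ge_zero])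
  then show ?thesis by (auto simp: bounded_iff)
qed

lemma integral_correlation:
  fixes \<phi> \<psi> :: "complex \<Rightarrow> real"
  assumes \<phi>: "continuous_on UNIV \<phi>" "bounded (range \<phi>)" and \<psi>: "continuous_on UNIV \<psi>" "bounded (range \<psi>)"
  shows "(\<integral>z. \<phi> ((f ^^ n) z) * \<psi> z \<partial>M) = (\<integral>z. \<phi> z * P n \<psi> z \<partial>M)"
proof -
  have "continuous_on UNIV (\<lambda>z. \<phi> ((f ^^ n) z) * \<psi> z)"
    using continuous_on_compose2[OF \<phi>(1) continuous_funpow[of n]] \<psi>(1) by (intro continuous_intros) auto
  from integral_P_real[OF this bounded_mult_comp[OF \<phi>(2) \<psi>(2)], of n]
  show ?thesis by (simp add: P_comp_mult)
qed

lemma f_invariant: "distr M M f = M"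
proof (rule prob_measure_eqI_continuous)
  show "prob_space (distr M M f)" by (rule M.prob_space_distr[OF f_measurable])
  fix \<phi> :: "complex \<Rightarrow> real" assume \<phi>: "continuous_on UNIV \<phi>" "bounded (range \<phi>)"
  have "(\<integral>z. \<phi> z \<partial>distr M M f) = (\<integral>z. \<phi> (f z) \<partial>M)"
    using f_measurable borel_measurable_M[OF \<phi>(1)] by (rule integral_distr)
  \<comment> \<open>With the second function equal to 1, whose averages are 1, the correlation
    identity becomes invariance.\<close>
  also have "\<dots> = (\<integral>z. \<phi> z \<partial>M)"
    using integral_correlation[OF \<phi>, of "\<lambda>_. 1" 1] by simp
  finally show "(\<integral>z. \<phi> z \<partial>distr M M f) = (\<integral>z. \<phi> z \<partial>M)" .
qed (use sets_M prob_M in auto)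

text \<open>The correlation identity moves the time to \<open>P n \<psi>\<close>, which tends
  pointwise to a constant, and dominated convergence applies.\<close>

lemma correlations_decay:
  fixes \<phi> \<psi> :: "complex \<Rightarrow> real"
  assumes \<phi>: "continuous_on UNIV \<phi>" "bounded (range \<phi>)" and \<psi>: "continuous_on UNIV \<psi>" "bounded (range \<psi>)"
  shows "(\<lambda>n. \<integral>z. \<phi> ((f ^^ n) z) * \<psi> z \<partial>M) \<longlonglongrightarrow> (\<integral>z. \<phi> z \<partial>M) * (\<integral>z. \<psi> z \<partial>M)"
proof -
  obtain A B where AB: "\<And>z. \<bar>\<phi> z\<bar> \<le> A" "\<And>z. \<bar>\<psi> z\<bar> \<le> B"
    using \<phi>(2) \<psi>(2) by (auto simp: bounded_iff)
  have PB: "\<bar>P n \<psi> z\<bar> \<le> B" for n z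
    using norm_expectation_pmf_le[of \<psi> B] AB(2) by simp
  have "(\<lambda>n. \<integral>z. \<phi> z * P n \<psi> z \<partial>M) \<longlonglongrightarrow> (\<integral>z. \<phi> z * (\<integral>z. \<psi> z \<partial>M) \<partial>M)"
  proof (rule integral_dominated_convergence[where w="\<lambda>_. A * B"])
    show "(\<lambda>z. \<phi> z * (\<integral>z. \<psi> z \<partial>M)) \<in> borel_measurable M"
      by (intro borel_measurable_M continuous_intros \<phi>)
    show "(\<lambda>z. \<phi> z * P n \<psi> z) \<in> borel_measurable M" for n
      by (intro borel_measurable_M continuous_intros \<phi> continuous_P \<psi>)
    show "AE z in M. (\<lambda>n. \<phi> z * P n \<psi> z) \<longlonglongrightarrow> \<phi> z * (\<integral>z. \<psi> z \<partial>M)"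
      using lim_real[OF \<psi>] by (intro AE_I2 tendsto_intros)
    show "AE z in M. norm (\<phi> z * P n \<psi> z) \<le> A * B" for n
    proof (rule AE_I2)
      fix z
      show "norm (\<phi> z * P n \<psi> z) \<le> A * B"
        unfolding real_norm_def abs_mult
        by (intro mult_mono AB PB) (auto intro: order_trans[OF abs_ge_zero AB(1)])
    qed
  qed auto
  then show ?thesis unfolding integral_correlation[OF \<phi> \<psi>] by simp
qed

text \<open>As \<open>z0\<close> is in \<open>J\<close>, some orbit leads from the ball to
  \<open>p\<close>, so the \<open>n\<close>-step law from \<open>p\<close> charges the ball, and by
  continuity so do the laws from points near \<open>p\<close>. \<open>M\<close> charges every
  neighbourhood of \<open>p\<close> by \<open>limit_lower_bound\<close>, and invariance under
  \<open>P n\<close> transfers this to the ball.\<close>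

lemma positive_on_neighbourhoods:
  assumes "z0 \<in> J" "0 < r"
  shows "0 < measure M (ball z0 r)"
proof -
  note hat_r = continuous_on_hat[OF assms(2), of UNIV z0] bounded_range_hat[OF assms(2), of z0]
  have "p \<in> reachable z0 r" using assms by (simp add: Julia_eq)
  then obtain n z where z: "z \<in> ball z0 r" "(f ^^ n) z = p" "Q_iter f Q n z > 0"
    by (auto simp: reachable_def)
  define h where "h = P n (hat z0 r)"
  have h_cont: "continuous_on UNIV h" unfolding h_def by (rule continuous_P[OF hat_r])
  have h_bounds: "0 \<le> h w" "h w \<le> 1" for w
    unfolding h_def using norm_expectation_pmf_le[of "hat z0 r" 1 "transfer_kernel f Q n w"]
      hat_bounds[OF assms(2), of z0] by (auto simp: abs_le_iff)
  have "0 < h p"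
    unfolding h_def using z hat_pos_iff[OF assms(2)]
    by (subst expectation_pos_iff) (auto simp: hat_bounds[OF assms(2)] hat_r set_transfer_kernel intro!: exI[of _ z])
  moreover have "isCont h p" using h_cont by (simp add: continuous_on_eq_continuous_at)
  ultimately obtain s where s: "0 < s" "\<And>w. dist w p < s \<Longrightarrow> dist (h w) (h p) < h p / 2"
    unfolding continuous_at_eps_delta by (meson half_gt_zero)
  note hat_s = continuous_on_hat[OF s(1), of UNIV p] bounded_range_hat[OF s(1), of p]
  have int: "integrable M g" if "continuous_on UNIV g" "\<And>z. 0 \<le> g z" "\<And>z. g z \<le> 1" for g :: "complex \<Rightarrow> real"
    using that by (intro M.integrable_const_bound[where B=1] AE_I2 borel_measurable_M) auto
  have le: "h p / 2 * hat p s w \<le> h w" for w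
  proof (cases "dist w p < s")
    case True
    have "h p / 2 * hat p s w \<le> h p / 2 * 1"
      using \<open>0 < h p\<close> hat_bounds[OF s(1)] by (intro mult_left_mono) auto
    also have "\<dots> \<le> h w" using s(2)[OF True] unfolding dist_real_def by linarith
    finally show ?thesis .
  next
    case False
    then have "hat p s w = 0"
      using hat_pos_iff[OF s(1), of p w] hat_bounds(1)[OF s(1), of p w] by (auto simp: dist_commute)
    then show ?thesis using h_bounds by simp
  qed
  have "0 < (\<integral>z. hat p s z \<partial>M)"
    by (rule limit_lower_bound[OF s(1) lim_real[OF hat_s]])
  then have "0 < h p / 2 * (\<integral>z. hat p s z \<partial>M)" using \<open>0 < h p\<close> by simp
  also have "\<dots> = (\<integral>z. h p / 2 * hat p s z \<partial>M)" by simp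
  also have "\<dots> \<le> (\<integral>z. h z \<partial>M)"
    using le by (intro integral_mono integrable_mult_right int h_cont h_bounds hat_s(1) hat_bounds[OF s(1)])
  also have "\<dots> = (\<integral>z. hat z0 r z \<partial>M)" unfolding h_def by (rule integral_P_real[OF hat_r])
  also have "\<dots> \<le> (\<integral>z. indicator (ball z0 r) z \<partial>M)"
  proof (rule integral_mono)
    show "integrable M (indicator (ball z0 r) :: complex \<Rightarrow> real)"
      using sets_M by (intro M.integrable_const_bound[where B=1] borel_measurable_indicator) auto
    show "hat z0 r z \<le> indicator (ball z0 r) z" for z
      using hat_pos_iff[OF assms(2), of z0 z] hat_bounds[OF assms(2), of z0 z]
      by (auto split: split_indicator)
  qed (intro int hat_r hat_bounds[OF assms(2)])
  also have "\<dots> = measure M (ball z0 r)" using sets_M by simp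
  finally show ?thesis .
qed

end

text \<open>Integrates test functions against a mixture of laws over an initial measure that need
  not be discrete, through real and imaginary parts.\<close>

lemma integral_bind_complex:
  fixes g :: "'b \<Rightarrow> complex"
  assumes g: "g \<in> borel_measurable K" "\<And>x. x \<in> space K \<Longrightarrow> norm (g x) \<le> B"
    and N: "N \<in> measurable M (prob_algebra K)" and M: "prob_space M"
  shows "integral\<^sup>L (bind M N) g = (\<integral>x. integral\<^sup>L (N x) g \<partial>M)"
proof -
  interpret prob_space M by fact
  have N': "N \<in> measurable M (subprob_algebra K)" using N by (rule measurable_prob_algebraD)
  have Nx: "prob_space (N x)" "sets (N x) = sets K" if "x \<in> space M" for x
    using measurable_space[OF N that] by (auto simp: space_prob_algebra)
  have le1: "AE x in M. emeasure (N x) (space (N x)) \<le> ennreal 1"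
    using prob_space.emeasure_space_1[OF Nx(1)] by (intro AE_I2) simp
  have Re_Im_le: "\<bar>Re (g x)\<bar> \<le> B" "\<bar>Im (g x)\<bar> \<le> B" if "x \<in> space K" for x
    using order_trans[OF abs_Re_le_cmod g(2)[OF that]] order_trans[OF abs_Im_le_cmod g(2)[OF that]]
    by simp_all
  have Re_Im: "(\<lambda>x. Re (g x)) \<in> borel_measurable K" "(\<lambda>x. Im (g x)) \<in> borel_measurable K"
    using g(1) by simp_all
  have sp: "space M \<noteq> {}" by (rule not_empty)
  have bind_sets: "sets (bind M N) = sets K" using Nx(2) sp by (rule sets_bind)
  interpret b: prob_space "bind M N"
    using Nx(1) by (intro prob_space_bind[OF _ N'] AE_I2)
  have int_b: "integrable (bind M N) g"
    using g bind_sets sets_eq_imp_space_eq[OF bind_sets]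
    by (intro b.integrable_const_bound[where B=B] AE_I2) (auto cong: measurable_cong_sets)
  have int_N: "integrable (N x) g" "norm (integral\<^sup>L (N x) g) \<le> B" if x: "x \<in> space M" for x
  proof -
    interpret Nx: prob_space "N x" by (rule Nx(1)[OF x])
    have g': "g \<in> borel_measurable (N x)" using g(1) Nx(2)[OF x] by (simp cong: measurable_cong_sets)
    have bd: "AE y in N x. norm (g y) \<le> B"
      using g(2) sets_eq_imp_space_eq[OF Nx(2)[OF x]] by (intro AE_I2) auto
    show i: "integrable (N x) g" using g' bd by (intro Nx.integrable_const_bound)
    have "norm (integral\<^sup>L (N x) g) \<le> (\<integral>y. norm (g y) \<partial>N x)" by (rule integral_norm_bound)
    also have "\<dots> \<le> (\<integral>y. B \<partial>N x)" using i bd by (intro integral_mono_AE) auto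
    finally show "norm (integral\<^sup>L (N x) g) \<le> B" by (simp add: Nx.prob_space)
  qed
  have "(\<lambda>x. integral\<^sup>L (N x) g) \<in> borel_measurable M"
    using measurable_compose[OF N' integral_measurable_subprob_algebra[of g K]] g(1) by simp
  then have int: "integrable M (\<lambda>x. integral\<^sup>L (N x) g)"
    using int_N(2) by (intro integrable_const_bound[where B=B] AE_I2)
  have r: "(\<integral>y. Re (g y) \<partial>bind M N) = (\<integral>x. \<integral>y. Re (g y) \<partial>N x \<partial>M)"
    by (rule integral_bind[OF Re_Im(1) Re_Im_le(1) N' finite_measure_axioms le1])
  have i: "(\<integral>y. Im (g y) \<partial>bind M N) = (\<integral>x. \<integral>y. Im (g y) \<partial>N x \<partial>M)"
    by (rule integral_bind[OF Re_Im(2) Re_Im_le(2) N' finite_measure_axioms le1])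
  have "(\<integral>x. \<integral>y. Re (g y) \<partial>N x \<partial>M) = (\<integral>x. Re (integral\<^sup>L (N x) g) \<partial>M)"
    "(\<integral>x. \<integral>y. Im (g y) \<partial>N x \<partial>M) = (\<integral>x. Im (integral\<^sup>L (N x) g) \<partial>M)"
    by (intro Bochner_Integration.integral_cong refl; simp add: int_N)+
  then have "Re (integral\<^sup>L (bind M N) g) = Re (\<integral>x. integral\<^sup>L (N x) g \<partial>M)"
    "Im (integral\<^sup>L (bind M N) g) = Im (\<integral>x. integral\<^sup>L (N x) g \<partial>M)"
    unfolding integral_Re[OF int_b, symmetric] integral_Re[OF int, symmetric]
      integral_Im[OF int_b, symmetric] integral_Im[OF int, symmetric] r i .
  then show ?thesis by (rule complex_eqI)
qed

section \<open>The limit measure on the Julia set\<close>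

context equidistributed_system
begin

text \<open>Restriction makes \<open>J\<close> the whole space, as \<open>borel_prob_on J\<close>
  requires; no mass is lost, by \<open>AE_Julia\<close>.\<close>

definition \<mu> :: "complex measure" where "\<mu> = restrict_space M J"

lemma J_borel: "J \<in> sets borel"
  using closed_Julia by simp

lemma space_\<mu>: "space \<mu> = J"
  by (simp add: \<mu>_def space_restrict_space space_M)

lemma borel_prob_on_\<mu>: "borel_prob_on J \<mu>"
  unfolding borel_prob_on_def \<mu>_def
  using prob_space_restrict[OF prob_M sets_M J_borel AE_Julia] sets_restrict_space_cong[OF sets_M] by auto

lemma integral_\<mu>:
  fixes \<phi> :: "complex \<Rightarrow> complex"
  assumes "continuous_on UNIV \<phi>"
  shows "(\<integral>z. \<phi> z \<partial>\<mu>) = (\<integral>z. \<phi> z \<partial>M)"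
  unfolding \<mu>_def
  by (rule integral_restrict_full[OF prob_M sets_M J_borel AE_Julia borel_measurable_continuous_onI[OF assms]])

lemma emeasure_\<mu>: "A \<subseteq> J \<Longrightarrow> emeasure \<mu> A = emeasure M A"
  unfolding \<mu>_def by (rule emeasure_restrict_space) (use J_borel sets_M space_M in auto)

lemma measure_\<mu>: "A \<subseteq> J \<Longrightarrow> measure \<mu> A = measure M A"
  using emeasure_\<mu>[of A] by (simp add: measure_def)

lemma sets_\<mu>: "A \<in> sets \<mu> \<longleftrightarrow> A \<in> sets borel \<and> A \<subseteq> J"
  unfolding \<mu>_def using J_borel by (subst sets_restrict_space_iff) (auto simp: sets_M space_M)

text \<open>The bridge between \<open>Cb J\<close> and the plane: the continuous extension
  \<open>\<psi>\<close> has the same transfers on \<open>J\<close> and the same integral, and the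
  results on the kernel apply to it.\<close>

lemma test_function:
  assumes "\<phi> \<in> Cb J"
  obtains \<psi> where "continuous_on UNIV \<psi>" "bounded (range \<psi>)" "\<And>z. z \<in> J \<Longrightarrow> \<psi> z = \<phi> z"
    "\<And>n w. w \<in> J \<Longrightarrow> (transfer f Q ^^ n) \<phi> w = P n \<psi> w"
    "(\<integral>z. \<phi> z \<partial>\<mu>) = (\<integral>z. \<psi> z \<partial>M)"
proof -
  obtain \<psi> where \<psi>: "continuous_on UNIV \<psi>" "bounded (range \<psi>)" "\<And>z. z \<in> J \<Longrightarrow> \<psi> z = \<phi> z"
    using Cb_extension[OF closed_Julia assms] by blast
  show ?thesis
  proof (rule that[OF \<psi>])
    show "(transfer f Q ^^ n) \<phi> w = P n \<psi> w" if "w \<in> J" for n w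
      using transfer_funpow_cong[of \<phi> \<psi> w n] \<psi>(3) that transfer_funpow_eq_expectation[OF \<psi>(2), of n w] by simp
    have "(\<integral>z. \<phi> z \<partial>\<mu>) = (\<integral>z. \<psi> z \<partial>\<mu>)"
      by (intro Bochner_Integration.integral_cong refl) (simp add: space_\<mu> \<psi>(3))
    then show "(\<integral>z. \<phi> z \<partial>\<mu>) = (\<integral>z. \<psi> z \<partial>M)" using integral_\<mu>[OF \<psi>(1)] by simp
  qed
qed

lemma locally_uniform:
  assumes "\<phi> \<in> Cb J"
  shows "locally_uniform_limit J (\<lambda>n. (transfer f Q ^^ n) \<phi>) (\<lambda>_. integral_functional \<mu> \<phi>)"
proof -
  obtain \<psi> where \<psi>: "continuous_on UNIV \<psi>" "bounded (range \<psi>)"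
    "\<And>n w. w \<in> J \<Longrightarrow> (transfer f Q ^^ n) \<phi> w = P n \<psi> w" "(\<integral>z. \<phi> z \<partial>\<mu>) = (\<integral>z. \<psi> z \<partial>M)"
    using test_function[OF assms] by metis
  have "uniform_limit (ball x 1 \<inter> J) (\<lambda>n. (transfer f Q ^^ n) \<phi>) (\<lambda>_. integral_functional \<mu> \<phi>) sequentially" for x
  proof -
    \<comment> \<open>Convergence holds on the whole closed ball, which is compact; the radius 1 is
      arbitrary.\<close>
    have "uniform_limit (cball x 1) (\<lambda>n. P n \<psi>) (\<lambda>_. \<integral>z. \<psi> z \<partial>M) sequentially"
      using equicontinuous[OF \<psi>(1,2)] lim[OF \<psi>(1,2)]
      by (intro equicontinuous_uniform_limit_const) auto
    then have "uniform_limit (ball x 1 \<inter> J) (\<lambda>n. P n \<psi>) (\<lambda>_. \<integral>z. \<psi> z \<partial>M) sequentially"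
      by (rule uniform_limit_on_subset) auto
    moreover have "uniform_limit (ball x 1 \<inter> J) (\<lambda>n. P n \<psi>) (\<lambda>_. \<integral>z. \<psi> z \<partial>M) sequentially \<longleftrightarrow>
        uniform_limit (ball x 1 \<inter> J) (\<lambda>n. (transfer f Q ^^ n) \<phi>) (\<lambda>_. integral_functional \<mu> \<phi>) sequentially"
      by (intro uniform_limit_cong') (simp_all add: \<psi> integral_functional_def)
    ultimately show ?thesis by simp
  qed
  then show ?thesis unfolding locally_uniform_limit_def by (auto intro!: exI[of _ 1])
qed

lemma transfer_limit:
  assumes "\<phi> \<in> Cb J" "w \<in> J"
  shows "(\<lambda>n. (transfer f Q ^^ n) \<phi> w) \<longlonglongrightarrow> integral_functional \<mu> \<phi>"
proof -
  obtain \<psi> where "continuous_on UNIV \<psi>" "bounded (range \<psi>)"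
    "\<And>n w. w \<in> J \<Longrightarrow> (transfer f Q ^^ n) \<phi> w = P n \<psi> w" "(\<integral>z. \<phi> z \<partial>\<mu>) = (\<integral>z. \<psi> z \<partial>M)"
    using test_function[OF assms(1)] by metis
  then show ?thesis using lim[of \<psi> w] assms(2) by (simp add: integral_functional_def)
qed

lemma integrable_Cb:
  assumes "borel_prob_on J \<nu>" "\<phi> \<in> Cb J"
  shows "integrable \<nu> \<phi>"
proof -
  interpret \<nu>: prob_space \<nu> using assms(1) by (simp add: borel_prob_on_def)
  have sets: "sets \<nu> = sets (restrict_space borel J)" using assms(1) by (simp add: borel_prob_on_def)
  then have space: "space \<nu> = J" by (simp add: sets_eq_imp_space_eq[OF sets] space_restrict_space)
  obtain B where "\<And>z. z \<in> J \<Longrightarrow> norm (\<phi> z) \<le> B" using assms(2) by (auto simp: Cb_def bounded_iff)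
  moreover have "\<phi> \<in> borel_measurable \<nu>"
    using borel_measurable_continuous_on_restrict[of J \<phi>] assms(2) sets
    by (simp add: Cb_def cong: measurable_cong_sets)
  ultimately show ?thesis
    using space by (intro \<nu>.integrable_const_bound[where B=B] AE_I2) auto
qed

lemma integral_functional_dual: "integral_functional \<mu> \<in> Cb_dual J"
proof -
  interpret \<mu>: prob_space \<mu> using borel_prob_on_\<mu> by (simp add: borel_prob_on_def)
  have "norm (integral_functional \<mu> \<phi>) \<le> 1 * (SUP z\<in>J. norm (\<phi> z))" if \<phi>: "\<phi> \<in> Cb J" for \<phi>
  proof -
    have int: "integrable \<mu> \<phi>" by (rule integrable_Cb[OF borel_prob_on_\<mu> \<phi>])
    have "bdd_above ((\<lambda>z. norm (\<phi> z)) ` J)"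
      using \<phi> by (auto simp: Cb_def bounded_iff bdd_above_def)
    then have le: "norm (\<phi> z) \<le> (SUP z\<in>J. norm (\<phi> z))" if "z \<in> J" for z
      using that by (intro cSUP_upper)
    have "norm (integral_functional \<mu> \<phi>) \<le> (\<integral>z. norm (\<phi> z) \<partial>\<mu>)"
      unfolding integral_functional_def by (rule integral_norm_bound)
    also have "\<dots> \<le> (\<integral>z. (SUP z\<in>J. norm (\<phi> z)) \<partial>\<mu>)"
      using int le by (intro integral_mono) (auto simp: space_\<mu>)
    finally show ?thesis by (simp add: \<mu>.prob_space)
  qed
  then show ?thesis
    unfolding Cb_dual_def
    using integrable_Cb[OF borel_prob_on_\<mu>] by (auto simp: integral_functional_def intro!: exI[of _ 1])
qed

lemma full_support: "full_support_on J \<mu>"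
  unfolding full_support_on_def
proof (intro allI impI)
  fix U assume U: "open U \<and> U \<inter> J \<noteq> {}"
  then obtain z where z: "z \<in> U" "z \<in> J" by blast
  then obtain r where r: "0 < r" "ball z r \<subseteq> U" using U by (meson openE)
  have "0 < measure M (ball z r)" by (rule positive_on_neighbourhoods[OF z(2) r(1)])
  also have "\<dots> = measure M (ball z r \<inter> J)"
    by (rule measure_Int_full[OF prob_M sets_M J_borel AE_Julia, symmetric]) simp
  also have "\<dots> \<le> measure M (U \<inter> J)"
    using r U J_borel sets_M by (intro M.finite_measure_mono) auto
  also have "\<dots> = measure \<mu> (U \<inter> J)" by (simp add: measure_\<mu>)
  finally show "0 < emeasure \<mu> (U \<inter> J)"
    by (simp add: emeasure_\<mu> measure_\<mu> M.emeasure_eq_measure)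
qed

lemma transpose_invariant:
  assumes "\<phi> \<in> Cb J"
  shows "transfer_transpose f Q (integral_functional \<mu>) \<phi> = integral_functional \<mu> \<phi>"
proof -
  obtain \<psi> where \<psi>: "continuous_on UNIV \<psi>" "bounded (range \<psi>)"
    "\<And>n w. w \<in> J \<Longrightarrow> (transfer f Q ^^ n) \<phi> w = P n \<psi> w" "(\<integral>z. \<phi> z \<partial>\<mu>) = (\<integral>z. \<psi> z \<partial>M)"
    using test_function[OF assms] by metis
  have "(\<integral>z. transfer f Q \<phi> z \<partial>\<mu>) = (\<integral>z. P 1 \<psi> z \<partial>\<mu>)"
    using \<psi>(3)[of _ 1] by (intro Bochner_Integration.integral_cong refl) (simp add: space_\<mu>)
  also have "\<dots> = (\<integral>z. P 1 \<psi> z \<partial>M)" by (intro integral_\<mu> feller_iter \<psi>)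
  also have "\<dots> = (\<integral>z. \<phi> z \<partial>\<mu>)" using integral_P[OF \<psi>(1,2), of 1] \<psi>(4) by simp
  finally show ?thesis by (simp add: transfer_transpose_def integral_functional_def)
qed

lemma measure_\<mu>_borel:
  assumes "A \<in> sets borel"
  shows "measure M (A \<inter> J) = measure M A"
  by (rule measure_Int_full[OF prob_M sets_M J_borel AE_Julia assms])

lemma f_measurable_\<mu>: "f \<in> measurable \<mu> \<mu>"
proof (rule measurableI)
  fix A assume "A \<in> sets \<mu>"
  then have "A \<in> sets M" "A \<subseteq> J" by (auto simp: sets_\<mu> sets_M)
  then have "f -` A \<in> sets borel"
    using measurable_sets[OF f_measurable, of A] by (simp add: space_M sets_M)
  then show "f -` A \<inter> space \<mu> \<in> sets \<mu>" using J_borel by (auto simp: sets_\<mu> space_\<mu>)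
qed (simp add: space_\<mu> Julia_forward)

lemma invariant_\<mu>: "invariant_measure f \<mu>"
  unfolding invariant_measure_def
proof (intro conjI f_measurable_\<mu> measure_eqI)
  fix A assume "A \<in> sets (distr \<mu> \<mu> f)"
  then have A: "A \<in> sets \<mu>" "A \<in> sets borel" "A \<subseteq> J" by (auto simp: sets_\<mu>)
  have pre: "f -` A \<in> sets borel"
    using measurable_sets[OF f_measurable, of A] A(2) by (simp add: space_M sets_M)
  have "emeasure (distr \<mu> \<mu> f) A = emeasure \<mu> (f -` A \<inter> J)"
    using A(1) by (simp add: emeasure_distr f_measurable_\<mu> space_\<mu>)
  also have "\<dots> = emeasure M (f -` A)"
    using measure_\<mu>_borel[OF pre] by (simp add: emeasure_\<mu> M.emeasure_eq_measure)
  also have "\<dots> = emeasure (distr M M f) A"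
    using A(2) by (subst emeasure_distr) (auto simp: f_measurable space_M sets_M)
  also have "\<dots> = emeasure \<mu> A" using A(3) by (simp add: f_invariant emeasure_\<mu>)
  finally show "emeasure (distr \<mu> \<mu> f) A = emeasure \<mu> A" .
qed simp

lemma mixing_\<mu>: "mixing_measure f \<mu>"
  unfolding mixing_measure_def
proof (intro conjI invariant_\<mu> ballI)
  fix A B assume "A \<in> sets \<mu>" "B \<in> sets \<mu>"
  then have AB: "A \<in> sets borel" "B \<in> sets borel" "A \<subseteq> J" "B \<subseteq> J" by (auto simp: sets_\<mu>)
  have "(\<lambda>n. measure M ((f ^^ n) -` A \<inter> B)) \<longlonglongrightarrow> measure M A * measure M B"
    by (rule mixing_from_continuous[OF prob_M sets_M f_measurable f_invariant correlations_decay AB(1,2)])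
  moreover have "measure \<mu> ((f ^^ n) -` A \<inter> B) = measure M ((f ^^ n) -` A \<inter> B)" for n
    using AB by (intro measure_\<mu>) auto
  ultimately show "(\<lambda>n. measure \<mu> ((f ^^ n) -` A \<inter> B)) \<longlonglongrightarrow> measure \<mu> A * measure \<mu> B"
    using AB by (simp add: measure_\<mu>)
qed

section \<open>Kernels on the Julia set and iterates of the transpose\<close>

abbreviation \<kappa>J :: "nat \<Rightarrow> complex \<Rightarrow> complex measure" where
  "\<kappa>J n w \<equiv> restrict_space (Q_measure f Q n w) J"

lemma Q_measure_facts:
  assumes "w \<in> J"
  shows "prob_space (Q_measure f Q n w)" "sets (Q_measure f Q n w) = sets borel"
    "AE z in Q_measure f Q n w. z \<in> J"
proof -
  show "prob_space (Q_measure f Q n w)"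
    unfolding Q_measure_eq_distr by (rule measure_pmf.prob_space_distr) simp
  show "AE z in Q_measure f Q n w. z \<in> J"
    unfolding Q_measure_eq_distr using set_transfer_kernel_Julia[OF assms, of n] J_borel
    by (subst AE_distr_iff) (auto simp: AE_measure_pmf_iff)
qed (simp add: Q_measure_def)

lemma borel_prob_on_\<kappa>J: "w \<in> J \<Longrightarrow> borel_prob_on J (\<kappa>J n w)"
  unfolding borel_prob_on_def
  using prob_space_restrict[OF Q_measure_facts(1,2) J_borel Q_measure_facts(3)]
    sets_restrict_space_cong[OF Q_measure_facts(2)] by blast

lemma integral_\<kappa>J:
  assumes "w \<in> J" "\<phi> \<in> Cb J"
  shows "(\<integral>z. \<phi> z \<partial>\<kappa>J n w) = (transfer f Q ^^ n) \<phi> w"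
proof -
  obtain \<psi> where \<psi>: "continuous_on UNIV \<psi>" "bounded (range \<psi>)" "\<And>z. z \<in> J \<Longrightarrow> \<psi> z = \<phi> z"
    "\<And>n w. w \<in> J \<Longrightarrow> (transfer f Q ^^ n) \<phi> w = P n \<psi> w"
    using test_function[OF assms(2)] by metis
  have \<psi>_borel: "\<psi> \<in> borel_measurable borel" by (rule borel_measurable_continuous_onI[OF \<psi>(1)])
  have "(\<integral>z. \<phi> z \<partial>\<kappa>J n w) = (\<integral>z. \<psi> z \<partial>\<kappa>J n w)"
    by (intro Bochner_Integration.integral_cong refl) (simp add: \<psi>(3) space_restrict_space)
  also have "\<dots> = (\<integral>z. \<psi> z \<partial>Q_measure f Q n w)"
    using Q_measure_facts[OF assms(1)] J_borel \<psi>_borel by (intro integral_restrict_full)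
  also have "\<dots> = P n \<psi> w"
    unfolding Q_measure_eq_distr using \<psi>_borel by (subst integral_distr) auto
  finally show ?thesis using \<psi>(4)[OF assms(1)] by simp
qed

lemma weakly_converges_\<kappa>J:
  assumes "w \<in> J"
  shows "weakly_converges_on J (\<lambda>n. \<kappa>J n w) \<mu>"
  unfolding weakly_converges_on_def
  using assms borel_prob_on_\<kappa>J borel_prob_on_\<mu> transfer_limit
  by (simp add: integral_\<kappa>J integral_functional_def)

text \<open>On a closed subset of \<open>J\<close> the mass is a pointwise limit of the continuous
  functions \<open>P n (closed_approx F k)\<close>, hence measurable in \<open>w\<close>, and closed
  subsets generate.\<close>

lemma \<kappa>J_measurable: "\<kappa>J n \<in> measurable (restrict_space borel J) (prob_algebra (restrict_space borel J))"
proof (rule measurable_prob_algebra_generated[OF sets_restrict_closed[OF closed_Julia]])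
  show "Int_stable {F. closed F \<and> F \<subseteq> J}" by (auto simp: Int_stable_def)
  show "prob_space (\<kappa>J n w)" "sets (\<kappa>J n w) = sets (restrict_space borel J)"
    if "w \<in> space (restrict_space borel J)" for w
    using borel_prob_on_\<kappa>J[of w n] that by (auto simp: borel_prob_on_def space_restrict_space)
  fix F assume "F \<in> {F. closed F \<and> F \<subseteq> J}"
  then have F: "closed F" "F \<subseteq> J" by auto
  have Q_prob: "prob_space (Q_measure f Q n w)" for w
    unfolding Q_measure_eq_distr by (rule measure_pmf.prob_space_distr) simp
  have Q_sets: "sets (Q_measure f Q n w) = sets borel" for w by (simp add: Q_measure_def)
  have "(\<lambda>k. P n (closed_approx F k) w) \<longlonglongrightarrow> measure (Q_measure f Q n w) F" for w
  proof -
    have "(\<integral>z. closed_approx F k z \<partial>Q_measure f Q n w) = P n (closed_approx F k) w" for k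
      unfolding Q_measure_eq_distr
      using borel_measurable_continuous_onI[OF continuous_on_closed_approx] by (subst integral_distr) auto
    then show ?thesis using integral_closed_approx_tendsto[OF Q_prob Q_sets F(1), of w] by simp
  qed
  moreover have "P n (closed_approx F k) \<in> borel_measurable borel" for k
    using closed_approx_bounds[of F k]
    by (intro borel_measurable_continuous_onI continuous_P continuous_on_closed_approx)
      (auto simp: bounded_iff intro!: exI[of _ 1])
  ultimately have "(\<lambda>w. measure (Q_measure f Q n w) F) \<in> borel_measurable borel"
    by (rule borel_measurable_LIMSEQ_real)
  then have "(\<lambda>w. ennreal (measure (Q_measure f Q n w) F)) \<in> borel_measurable (restrict_space borel J)"
    by (intro measurable_restrict_space1) simp
  moreover have "emeasure (\<kappa>J n w) F = ennreal (measure (Q_measure f Q n w) F)" for w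
  proof -
    interpret Q: prob_space "Q_measure f Q n w" by (rule Q_prob)
    have "J \<inter> space (Q_measure f Q n w) \<in> sets (Q_measure f Q n w)"
      using J_borel Q_sets[of w] sets_eq_imp_space_eq[OF Q_sets[of w]] by simp
    then show ?thesis using F(2) by (simp add: emeasure_restrict_space Q.emeasure_eq_measure)
  qed
  ultimately show "(\<lambda>w. emeasure (\<kappa>J n w) F) \<in> borel_measurable (restrict_space borel J)" by simp
qed auto

lemma transpose_funpow:
  "(transfer_transpose f Q ^^ n) \<Lambda> \<phi> = \<Lambda> ((transfer f Q ^^ n) \<phi>)"
proof (induction n arbitrary: \<phi>)
  case (Suc n)
  have "(transfer_transpose f Q ^^ Suc n) \<Lambda> \<phi> = (transfer_transpose f Q ^^ n) \<Lambda> (transfer f Q \<phi>)"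
    by (simp add: transfer_transpose_def)
  then show ?case by (simp only: Suc funpow_Suc_right comp_apply)
qed simp

text \<open>The \<open>n\<close>-th transpose of \<open>\<nu>\<close> is the mixture of the laws
  \<open>\<kappa>J n w\<close> with \<open>w\<close> distributed by \<open>\<nu>\<close>. The
  transfers tend to a constant at each \<open>w\<close>, so dominated convergence under
  \<open>\<nu>\<close> gives the limit.\<close>

lemma transpose_converges:
  assumes \<nu>: "borel_prob_on J \<nu>"
  shows "\<exists>N. (\<forall>n. \<forall>\<phi>\<in>Cb J. (transfer_transpose f Q ^^ n) (integral_functional \<nu>) \<phi> = integral_functional (N n) \<phi>) \<and>
    weakly_converges_on J N \<mu>"
proof -
  interpret \<nu>: prob_space \<nu> using \<nu> by (simp add: borel_prob_on_def)
  have sets_\<nu>: "sets \<nu> = sets (restrict_space borel J)" using \<nu> by (simp add: borel_prob_on_def)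
  have space_\<nu>: "space \<nu> = J" by (simp add: sets_eq_imp_space_eq[OF sets_\<nu>] space_restrict_space)
  have meas: "\<kappa>J n \<in> measurable \<nu> (prob_algebra (restrict_space borel J))" for n
    using \<kappa>J_measurable sets_\<nu> by (simp cong: measurable_cong_sets)
  define N where "N n = bind \<nu> (\<kappa>J n)" for n
  have integral_N: "(\<integral>z. \<phi> z \<partial>N n) = (\<integral>w. (transfer f Q ^^ n) \<phi> w \<partial>\<nu>)" if \<phi>: "\<phi> \<in> Cb J" for n \<phi>
  proof -
    obtain B where B: "\<And>z. z \<in> J \<Longrightarrow> norm (\<phi> z) \<le> B" using \<phi> by (auto simp: Cb_def bounded_iff)
    have "\<phi> \<in> borel_measurable (restrict_space borel J)"
      using \<phi> by (intro borel_measurable_continuous_on_restrict) (simp add: Cb_def)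
    then have "(\<integral>z. \<phi> z \<partial>N n) = (\<integral>w. \<integral>z. \<phi> z \<partial>\<kappa>J n w \<partial>\<nu>)"
      unfolding N_def using B meas \<nu>.prob_space_axioms
      by (intro integral_bind_complex[where B=B]) (auto simp: space_restrict_space)
    also have "\<dots> = (\<integral>w. (transfer f Q ^^ n) \<phi> w \<partial>\<nu>)"
      using \<phi> by (intro Bochner_Integration.integral_cong refl) (simp add: space_\<nu> integral_\<kappa>J)
    finally show ?thesis .
  qed
  have prob_N: "borel_prob_on J (N n)" for n
    unfolding borel_prob_on_def
  proof
    have "prob_space (\<kappa>J n w)" "sets (\<kappa>J n w) = sets (restrict_space borel J)" if "w \<in> space \<nu>" for w
      using borel_prob_on_\<kappa>J[of w n] that by (auto simp: borel_prob_on_def space_\<nu>)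
    then show "prob_space (N n)" "sets (N n) = sets (restrict_space borel J)"
      unfolding N_def using measurable_prob_algebraD[OF meas] \<nu>.not_empty
      by (auto intro!: \<nu>.prob_space_bind AE_I2 sets_bind)
  qed
  have "(\<lambda>n. \<integral>z. \<phi> z \<partial>N n) \<longlonglongrightarrow> (\<integral>z. \<phi> z \<partial>\<mu>)" if \<phi>: "\<phi> \<in> Cb J" for \<phi>
  proof -
    obtain \<psi> where \<psi>: "continuous_on UNIV \<psi>" "bounded (range \<psi>)"
      "\<And>n w. w \<in> J \<Longrightarrow> (transfer f Q ^^ n) \<phi> w = P n \<psi> w" "(\<integral>z. \<phi> z \<partial>\<mu>) = (\<integral>z. \<psi> z \<partial>M)"
      using test_function[OF \<phi>] by metis
    obtain B where B: "\<And>z. norm (\<psi> z) \<le> B" using \<psi>(2) by (auto simp: bounded_iff)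
    have "(\<lambda>n. \<integral>w. P n \<psi> w \<partial>\<nu>) \<longlonglongrightarrow> (\<integral>w. (\<integral>z. \<psi> z \<partial>M) \<partial>\<nu>)"
    proof (rule integral_dominated_convergence[where w="\<lambda>_. B"])
      show "P n \<psi> \<in> borel_measurable \<nu>" for n
      proof -
        have "P n \<psi> \<in> borel_measurable (restrict_space borel J)"
          by (intro measurable_restrict_space1 borel_measurable_continuous_onI feller_iter \<psi>)
        then show ?thesis using sets_\<nu> by (simp cong: measurable_cong_sets)
      qed
      show "AE w in \<nu>. (\<lambda>n. P n \<psi> w) \<longlonglongrightarrow> (\<integral>z. \<psi> z \<partial>M)" using lim[OF \<psi>(1,2)] by simp
      show "AE w in \<nu>. norm (P n \<psi> w) \<le> B" for n using norm_expectation_pmf_le[of \<psi> B] B by simp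
    qed auto
    moreover have "(\<integral>w. P n \<psi> w \<partial>\<nu>) = (\<integral>z. \<phi> z \<partial>N n)" for n
      unfolding integral_N[OF \<phi>]
      by (intro Bochner_Integration.integral_cong refl) (simp add: space_\<nu> \<psi>(3))
    ultimately show ?thesis by (simp add: \<psi>(4) \<nu>.prob_space)
  qed
  then have "weakly_converges_on J N \<mu>"
    using prob_N borel_prob_on_\<mu> by (simp add: weakly_converges_on_def)
  moreover have "\<forall>n. \<forall>\<phi>\<in>Cb J. (transfer_transpose f Q ^^ n) (integral_functional \<nu>) \<phi> = integral_functional (N n) \<phi>"
    by (simp add: transpose_funpow integral_functional_def integral_N)
  ultimately show ?thesis by blast
qed

end

theorem theorem6p24:
  fixes f :: "complex \<Rightarrow> complex" and Q :: "complex \<Rightarrow> real"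
  assumes "f holomorphic_on UNIV" and "surj f"
    and "weight_function f Q" and "weakly_continuous f Q"
    and "normal_weight f Q" and "tight_weight f Q" and "irreducible_weight f Q"
  shows "\<exists>\<Phi> \<mu>.
    (\<forall>\<phi>\<in>Cb UNIV. locally_uniform_limit (Q_Julia f Q) (\<lambda>n. (transfer f Q ^^ n) \<phi>) (\<lambda>_. \<Phi> \<phi>)) \<and>
    (\<forall>\<phi>\<in>Cb (Q_Julia f Q).
       locally_uniform_limit (Q_Julia f Q) (\<lambda>n. (transfer f Q ^^ n) \<phi>) (\<lambda>_. \<Phi> \<phi>)) \<and>
    \<Phi> \<in> Cb_dual (Q_Julia f Q) \<and>
    borel_prob_on (Q_Julia f Q) \<mu> \<and>
    (\<forall>\<phi>\<in>Cb (Q_Julia f Q). \<Phi> \<phi> = integral_functional \<mu> \<phi>) \<and>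
    full_support_on (Q_Julia f Q) \<mu> \<and>
    (\<forall>\<phi>\<in>Cb (Q_Julia f Q).
       transfer_transpose f Q (integral_functional \<mu>) \<phi> = integral_functional \<mu> \<phi>) \<and>
    invariant_measure f \<mu> \<and>
    mixing_measure f \<mu> \<and>
    (\<forall>\<nu>. borel_prob_on (Q_Julia f Q) \<nu> \<longrightarrow>
       (\<exists>N. (\<forall>n. \<forall>\<phi>\<in>Cb (Q_Julia f Q).
               (transfer_transpose f Q ^^ n) (integral_functional \<nu>) \<phi> = integral_functional (N n) \<phi>) \<and>
            weakly_converges_on (Q_Julia f Q) N \<mu>)) \<and>
    (\<forall>w\<in>Q_Julia f Q.
       weakly_converges_on (Q_Julia f Q)
         (\<lambda>n. restrict_space (Q_measure f Q n w) (Q_Julia f Q)) \<mu>)"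
proof -
  interpret irreducible_system f Q by unfold_locales (rule assms)+
  obtain p where p: "p \<in> Q_Julia f Q" "equicontinuous_kernel (preimage_pmf f Q) p"
    by (rule obtain_expanding_point)
  obtain M where M: "prob_space M" "sets M = sets borel"
    "\<And>(\<phi> :: complex \<Rightarrow> complex) w. continuous_on UNIV \<phi> \<Longrightarrow> bounded (range \<phi>) \<Longrightarrow>
      (\<lambda>n. measure_pmf.expectation (transfer_kernel f Q n w) \<phi>) \<longlonglongrightarrow> (\<integral>z. \<phi> z \<partial>M)"
    using equidistribution[OF p(2)] by metis
  interpret equicontinuous_kernel "preimage_pmf f Q" p by (rule p(2))
  interpret equidistributed_system f Q p M
    by (intro equidistributed_system.intro equidistributed_system_axioms.intro irreducible_system_axioms p M)
  \<comment> \<open>Reduces the claim for test functions on the plane to the one for test functions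
    on the Julia set.\<close>
  have Cb_UNIV: "\<phi> \<in> Cb (Q_Julia f Q)" if "\<phi> \<in> Cb UNIV" for \<phi>
    using that by (auto simp: Cb_def intro: continuous_on_subset bounded_subset)
  show ?thesis
    by (rule exI[of _ "integral_functional \<mu>"], rule exI[of _ \<mu>])
      (simp add: Cb_UNIV locally_uniform integral_functional_dual borel_prob_on_\<mu> full_support
        transpose_invariant invariant_\<mu> mixing_\<mu> transpose_converges weakly_converges_\<kappa>J)
qed

end
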